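(* Let $S^2$ be the round sphere with a right flippable tiling $T_r$. There is a unique (up to isometry) left flippable tiling $T_l$ on $S^2$ such that $T_l$ is obtained by flipping $T_r$. Similarly, there is a right flippable tiling obtained by flipping any left flippable tiling, and flipping a tiling $T$ twice yields $T$.
   Context: Flippable tilings. Let $(S,g)$ be a closed oriented surface with a constant curvature metric. A right flippable tiling of $(S,g)$ is a triple $T=(F_b,F_w,E)$ where (1) $F_b$ and $F_w$ are two sets of closed convex polygons homeomorphic to disks in $S$, the black and white faces of $T$, with disjoint interiors, which cover $S$; (2) $E$ is a set of geodesic segments in $(S,g)$, the edges of $T$, such that each edge of any black or white polygon is contained in some $e\in E$. It is required that for each oriented edge $e\in E$: $e$ is the union of the edges (in the usual sense) of one black and one white face on its right side, and similarly on its left side; the black polygon is forward on the right-hand side of $e$ and backward on the left-hand side; the lengths of the intersections with $e$ of the two black faces (resp. of the two white faces) are equal. These conditions do not depend on the orientation chosen on $e$. A left flippable tiling is defined in the same way, except that the black polygon is forward on the left-hand side of $e$ and backward on the right-hand side. On the sphere, a convex polygon is a compact set with non-empty interior which is a finite intersection of closed hemispheres and is contained in an open hemisphere; faces of tilings of $S^2$ are also allowed to be digons, i.e. intersections of two closed hemispheres, with two (antipodal) vertices and two edges of length $\pi$ making an angle $<\pi$. Flipping. Let $T_r$ be a right flippable tiling of $(S,g_r)$, and $T_l$ a left flippable tiling of $(S,g_l)$, where $g_l$ has the same curvature as $g_r$. $T_l$ is obtained by flipping $T_r$ if: there is a one-to-one orientation-preserving map $\phi$ between the faces of $T_r$ and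 the faces of $T_l$, sending each black (resp. white) face $f$ of $T_r$ to a black (resp. white) face of $T_l$ isometric to $f$ (by an orientation-preserving isometry); there is a one-to-one map $\psi$ between the edges of $T_r$ and the edges of $T_l$; and if an edge $e$ of a face $f$ of $T_r$ is adjacent to (lies on) an edge $E$ of $T_r$, then the corresponding edge of $\phi(f)$ is adjacent to $\psi(E)$, and conversely. Flipping of a left flippable tiling (to a right one) is defined similarly. Tilings of $S^2$ are identified when they differ by an orientation-preserving isometry.
   Formalization: Distinct edges of a tiling are additionally required not to cross (disjoint relative interiors), for the tiling and its flip alike; without this, some right flippable tilings with crossing edges have no flip. *)

theory Defs
  imports "HOL-Analysis.Analysis"
begin

section \<open>Oriented geodesic segments of the unit sphere\<close>

abbreviation S2 :: "(real^3) set" where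
  "S2 \<equiv> sphere 0 1"

text \<open>
  \<open>Seg p v L\<close> is the segment of length \<open>L\<close> that leaves \<open>p\<close> in the unit tangent direction \<open>v\<close>.
  Segments are recorded with their parametrisation, and not as point sets, because a segment of
  length \<open>2 * pi\<close> (a black digon edge followed by a white one) is a whole great circle, and its
  endpoint cannot be recovered from the set of its points.
\<close>
datatype seg = Seg (start: "real^3") (dir: "real^3") (len: real)

definition geodesic_segment :: "seg \<Rightarrow> bool" where
  "geodesic_segment e \<longleftrightarrow>
     norm (start e) = 1 \<and> norm (dir e) = 1 \<and> start e \<bullet> dir e = 0 \<and> 0 < len e \<and> len e \<le> 2 * pi"

definition seg_point :: "seg \<Rightarrow> real \<Rightarrow> real^3" where
  "seg_point e t = cos t *\<^sub>R start e + sin t *\<^sub>R dir e"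

definition seg_arc :: "seg \<Rightarrow> real \<Rightarrow> real \<Rightarrow> (real^3) set" where
  "seg_arc e s t = seg_point e ` {s..t}"

definition seg_set :: "seg \<Rightarrow> (real^3) set" where
  "seg_set e = seg_arc e 0 (len e)"

definition seg_interior :: "seg \<Rightarrow> (real^3) set" where
  "seg_interior e = seg_point e ` {0<..<len e}"

definition seg_rev :: "seg \<Rightarrow> seg" where
  "seg_rev e = Seg (seg_point e (len e))
                   (sin (len e) *\<^sub>R start e - cos (len e) *\<^sub>R dir e)
                   (len e)"

text \<open>
  The sphere is seen from outside, so at a point \<open>p\<close> the direction to the left of \<open>v\<close> is the cross
  product of \<open>p\<close> and \<open>v\<close>.  A convex polygon with an edge on \<open>e\<close> lies on one side of the great circle
  of \<open>e\<close>.
\<close>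
definition left_of :: "seg \<Rightarrow> (real^3) set \<Rightarrow> bool" where
  "left_of e f \<longleftrightarrow> (\<forall>x\<in>f. 0 \<le> cross3 (start e) (dir e) \<bullet> x)"

definition right_of :: "seg \<Rightarrow> (real^3) set \<Rightarrow> bool" where
  "right_of e f \<longleftrightarrow> (\<forall>x\<in>f. cross3 (start e) (dir e) \<bullet> x \<le> 0)"


section \<open>Spherical polygons\<close>

definition closed_hemisphere :: "real^3 \<Rightarrow> (real^3) set" where
  "closed_hemisphere n = {x \<in> S2. 0 \<le> n \<bullet> x}"

definition open_hemisphere :: "real^3 \<Rightarrow> (real^3) set" where
  "open_hemisphere n = {x \<in> S2. 0 < n \<bullet> x}"

definition S2_interior :: "(real^3) set \<Rightarrow> (real^3) set" where
  "S2_interior f = top_of_set S2 interior_of f"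

definition convex_polygon :: "(real^3) set \<Rightarrow> bool" where
  "convex_polygon f \<longleftrightarrow>
     compact f \<and> S2_interior f \<noteq> {} \<and>
     (\<exists>N. finite N \<and> N \<noteq> {} \<and> N \<subseteq> S2 \<and> f = (\<Inter>n\<in>N. closed_hemisphere n)) \<and>
     (\<exists>m\<in>S2. f \<subseteq> open_hemisphere m)"

definition digon :: "(real^3) set \<Rightarrow> bool" where
  "digon f \<longleftrightarrow>
     (\<exists>m\<in>S2. \<exists>n\<in>S2. m \<noteq> n \<and> m \<noteq> - n \<and> f = closed_hemisphere m \<inter> closed_hemisphere n)"

text \<open>
  A supporting great circle meets a convex polygon or a digon in the empty set, in a vertex, in the
  two vertices of a digon, or in an edge; only the last of these is infinite.
\<close>
definition polygon_edges :: "(real^3) set \<Rightarrow> (real^3) set set" where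
  "polygon_edges f =
     {f \<inter> {x. n \<bullet> x = 0} | n. n \<in> S2 \<and> f \<subseteq> closed_hemisphere n \<and> infinite (f \<inter> {x. n \<bullet> x = 0})}"


section \<open>Flippable tilings\<close>

text \<open>
  The third component contains every edge with both of its orientations.
\<close>
datatype tiling =
  Tiling (black: "(real^3) set set") (white: "(real^3) set set") (edges: "seg set")

definition faces :: "tiling \<Rightarrow> (real^3) set set" where
  "faces T = black T \<union> white T"

text \<open>
  The last clause says that distinct edges do not cross.  Without it there are tilings, satisfying
  all the other conditions, in which edges cross at their midpoints, and some of these cannot be
  flipped.
\<close>
definition tiling_of_S2 :: "tiling \<Rightarrow> bool" where
  "tiling_of_S2 T \<longleftrightarrow>
     (\<forall>f\<in>faces T. convex_polygon f \<or> digon f) \<and>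
     black T \<inter> white T = {} \<and>
     (\<forall>f\<in>faces T. \<forall>g\<in>faces T. f \<noteq> g \<longrightarrow> S2_interior f \<inter> S2_interior g = {}) \<and>
     \<Union> (faces T) = S2 \<and>
     (\<forall>e\<in>edges T. geodesic_segment e \<and> seg_rev e \<in> edges T) \<and>
     (\<forall>f\<in>faces T. \<forall>a\<in>polygon_edges f. \<exists>e\<in>edges T. a \<subseteq> seg_set e) \<and>
     (\<forall>e\<in>edges T. \<forall>e'\<in>edges T.
        e' \<noteq> e \<and> e' \<noteq> seg_rev e \<longrightarrow> seg_interior e \<inter> seg_interior e' = {})"

text \<open>
  Black is forward on the side \<open>A\<close> of \<open>e\<close> and backward on the side \<open>B\<close>; \<open>l\<close> and \<open>w\<close> are the common
  lengths of the two black and of the two white polygon edges that lie on \<open>e\<close>.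
\<close>
definition edge_pattern ::
  "(seg \<Rightarrow> (real^3) set \<Rightarrow> bool) \<Rightarrow> (seg \<Rightarrow> (real^3) set \<Rightarrow> bool) \<Rightarrow> tiling \<Rightarrow> seg \<Rightarrow> bool" where
  "edge_pattern A B T e \<longleftrightarrow>
     (\<exists>l w. 0 < l \<and> 0 < w \<and> len e = l + w \<and>
        (\<exists>f\<in>white T. A e f \<and> seg_arc e 0 w \<in> polygon_edges f) \<and>
        (\<exists>f\<in>black T. A e f \<and> seg_arc e w (len e) \<in> polygon_edges f) \<and>
        (\<exists>f\<in>black T. B e f \<and> seg_arc e 0 l \<in> polygon_edges f) \<and>
        (\<exists>f\<in>white T. B e f \<and> seg_arc e l (len e) \<in> polygon_edges f))"

definition right_flippable :: "tiling \<Rightarrow> bool" where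
  "right_flippable T \<longleftrightarrow> tiling_of_S2 T \<and> (\<forall>e\<in>edges T. edge_pattern right_of left_of T e)"

definition left_flippable :: "tiling \<Rightarrow> bool" where
  "left_flippable T \<longleftrightarrow> tiling_of_S2 T \<and> (\<forall>e\<in>edges T. edge_pattern left_of right_of T e)"


section \<open>Flipping and congruence\<close>

text \<open>
  The rotation \<open>R f\<close> induces the orientation-preserving isometry from the face \<open>f\<close> to the face \<open>\<phi> f\<close>.
  It is part of the data, because it determines which edge of \<open>\<phi> f\<close> corresponds to a given edge of \<open>f\<close>.
\<close>
definition flips_to :: "tiling \<Rightarrow> tiling \<Rightarrow> bool" where
  "flips_to T T' \<longleftrightarrow>
     (\<exists>(\<phi> :: (real^3) set \<Rightarrow> (real^3) set) (R :: (real^3) set \<Rightarrow> real^3^3) (\<psi> :: seg \<Rightarrow> seg).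
        bij_betw \<phi> (black T) (black T') \<and>
        bij_betw \<phi> (white T) (white T') \<and>
        (\<forall>f\<in>faces T. rotation_matrix (R f) \<and> \<phi> f = (*v) (R f) ` f) \<and>
        bij_betw \<psi> (edges T) (edges T') \<and>
        (\<forall>e\<in>edges T. \<psi> (seg_rev e) = seg_rev (\<psi> e)) \<and>
        (\<forall>f\<in>faces T. \<forall>a\<in>polygon_edges f. \<forall>e\<in>edges T.
           a \<subseteq> seg_set e \<longleftrightarrow> (*v) (R f) ` a \<subseteq> seg_set (\<psi> e)))"

definition rotate_seg :: "real^3^3 \<Rightarrow> seg \<Rightarrow> seg" where
  "rotate_seg A e = Seg (A *v start e) (A *v dir e) (len e)"

definition rotate_tiling :: "real^3^3 \<Rightarrow> tiling \<Rightarrow> tiling" where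
  "rotate_tiling A T =
     Tiling ((`) ((*v) A) ` black T) ((`) ((*v) A) ` white T) (rotate_seg A ` edges T)"

definition congruent_tilings :: "tiling \<Rightarrow> tiling \<Rightarrow> bool" where
  "congruent_tilings T T' \<longleftrightarrow> (\<exists>A. rotation_matrix A \<and> T' = rotate_tiling A T)"

end

theory Submission
  imports Defs
begin

text \<open>
  A flip is given by a rotation of every face.  Across an edge, the black faces slide along it and the
  white faces change sides, so that the rotations of a black and a white face with a common vertex \<open>x\<close>
  have to differ by the half turn about \<open>x\<close>.  As edges do not cross, every vertex lies in the interior of
  exactly one edge, and these conditions can be solved around that edge.  The local solutions are unique
  up to a rotation of the sphere; since the sphere is simply connected, they can be glued together, and
  the global solution is again unique up to a rotation.

  The rotated faces fill a neighbourhood of every point that they contain, so they cover the sphere.  Their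
  total area is that of the sphere, so they do not overlap, and they form a tiling with the opposite
  handedness.

  Conversely, an arbitrary flip solves these conditions unless some white face stays on its side of an
  edge.  In that case all faces are lunes cut out by two great circles, and the images of the two white
  lunes can be exchanged.
\<close>

subsection \<open>Segments\<close>

text \<open>Why the conditions around one edge are solvable: its four faces form a cycle of
  alternating colours, and going round once composes half turns about the points of parameter
  \<open>lb e\<close>, \<open>len e\<close>, \<open>lw e\<close> and 0 of one great circle. Two such
  half turns compose to a shift along the circle by twice the parameter difference, so the cycle
  closes because \<open>lb e - len e + lw e - 0 = 0\<close>. This is the requirement that the two
  black lengths agree and the two white lengths agree. The obstacle to uniqueness: a flip records
  only which polygon edges lie on which edge, neither their position on it nor the side, and an edge
  may be a full great circle, whose ends are not visible in its point set. Faces are replaced by the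
  cones in R^3 cut out by their inner edge normals, so that neighbourhoods are those of R^3 and
  areas become volumes. Only right flippable tilings are analysed: exchanging the colours exchanges
  the handedness, so the target of a flip falls under the same analysis.\<close>

definition nrm :: "seg \<Rightarrow> real^3" where
  "nrm e = cross3 (start e) (dir e)"

definition seg_tan :: "seg \<Rightarrow> real \<Rightarrow> real^3" where
  "seg_tan e t = cos t *\<^sub>R dir e - sin t *\<^sub>R start e"

lemma norm_1_inner: "norm (x::real^3) = 1 \<longleftrightarrow> x \<bullet> x = 1"
  by (simp add: norm_eq_sqrt_inner)

lemma geodesic_segmentD:
  assumes "geodesic_segment e"
  shows "start e \<bullet> start e = 1" "dir e \<bullet> dir e = 1" "start e \<bullet> dir e = 0" "dir e \<bullet> start e = 0"
    "nrm e \<bullet> nrm e = 1" "nrm e \<bullet> start e = 0" "nrm e \<bullet> dir e = 0" "0 < len e" "len e \<le> 2 * pi"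
  using assms unfolding geodesic_segment_def norm_1_inner nrm_def
  by (auto simp: inner_commute dot_cross dot_cross_self)

lemma seg_point_0 [simp]: "seg_point e 0 = start e"
  by (simp add: seg_point_def)

lemma seg_tan_0 [simp]: "seg_tan e 0 = dir e"
  by (simp add: seg_tan_def)

lemma seg_point_add: "seg_point e (s + t) = cos t *\<^sub>R seg_point e s + sin t *\<^sub>R seg_tan e s"
  by (simp add: seg_point_def seg_tan_def cos_add sin_add algebra_simps)

lemma seg_tan_add: "seg_tan e (s + t) = cos t *\<^sub>R seg_tan e s - sin t *\<^sub>R seg_point e s"
  by (simp add: seg_point_def seg_tan_def cos_add sin_add algebra_simps)

lemma seg_point_periodic [simp]: "seg_point e (t + 2 * pi) = seg_point e t" "seg_point e (t - 2 * pi) = seg_point e t"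
  by (simp_all add: seg_point_def cos_diff sin_diff)

lemma seg_point_pi [simp]: "seg_point e (t + pi) = - seg_point e t" "seg_point e (t - pi) = - seg_point e t"
  by (simp_all add: seg_point_def cos_diff sin_diff)

lemma seg_frame:
  assumes "geodesic_segment e"
  shows "seg_point e t \<bullet> seg_point e t = 1" "seg_tan e t \<bullet> seg_tan e t = 1"
    "seg_point e t \<bullet> seg_tan e t = 0" "nrm e \<bullet> seg_point e t = 0" "nrm e \<bullet> seg_tan e t = 0"
    "cross3 (seg_point e t) (seg_tan e t) = nrm e" "norm (seg_point e t) = 1"
    "seg_point e t \<in> S2" "norm (nrm e) = 1" "nrm e \<in> S2"
proof -
  note g = geodesic_segmentD[OF assms]
  have sc: "sin t * sin t = 1 - cos t * cos t"
    using sin_cos_squared_add[of t] by (simp add: power2_eq_square algebra_simps)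
  show p: "seg_point e t \<bullet> seg_point e t = 1"
    using g sc by (simp add: seg_point_def algebra_simps)
  show "seg_tan e t \<bullet> seg_tan e t = 1"
    using g sc by (simp add: seg_tan_def algebra_simps)
  show "seg_point e t \<bullet> seg_tan e t = 0"
    using g by (simp add: seg_tan_def seg_point_def algebra_simps)
  show "nrm e \<bullet> seg_point e t = 0" "nrm e \<bullet> seg_tan e t = 0"
    using g by (simp_all add: seg_tan_def seg_point_def algebra_simps)
  have "cross3 (seg_point e t) (seg_tan e t)
      = (cos t * cos t) *\<^sub>R cross3 (start e) (dir e) - (sin t * sin t) *\<^sub>R cross3 (dir e) (start e)"
    by (simp add: seg_point_def seg_tan_def cross_add_left cross_mult_left cross_mult_right
        Cross3.right_diff_distrib)
  also have "\<dots> = nrm e"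
    unfolding nrm_def using sc by (simp add: cross_skew[of "dir e"] scaleR_add_left[symmetric])
  finally show "cross3 (seg_point e t) (seg_tan e t) = nrm e" .
  show "norm (seg_point e t) = 1" using p by (simp add: norm_1_inner)
  then show "seg_point e t \<in> S2" by simp
  show "norm (nrm e) = 1" using g by (simp add: norm_1_inner)
  then show "nrm e \<in> S2" by simp
qed

lemma orthonormal_expand:
  fixes p v x :: "real^3"
  assumes "p \<bullet> p = 1" "v \<bullet> v = 1" "p \<bullet> v = 0"
  shows "x = (x \<bullet> p) *\<^sub>R p + (x \<bullet> v) *\<^sub>R v + (x \<bullet> cross3 p v) *\<^sub>R cross3 p v"
proof -
  define n where "n = cross3 p v"
  define y where "y = x - ((x \<bullet> p) *\<^sub>R p + (x \<bullet> v) *\<^sub>R v + (x \<bullet> n) *\<^sub>R n)"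
  have n: "n \<bullet> n = 1" "n \<bullet> p = 0" "n \<bullet> v = 0" "p \<bullet> n = 0" "v \<bullet> n = 0" "v \<bullet> p = 0"
    unfolding n_def using assms by (auto simp: dot_cross dot_cross_self inner_commute)
  have y: "y \<bullet> p = 0" "y \<bullet> v = 0" "y \<bullet> n = 0"
    unfolding y_def using assms n by (simp_all add: algebra_simps)
  have "cross3 y n = 0" unfolding n_def Lagrange using y by simp
  then have "y = 0 \<or> n = 0" using y norm_and_cross_eq_0 by blast
  then have "y = 0" using n by auto
  then show ?thesis unfolding y_def n_def by simp
qed

lemma seg_expand:
  assumes "geodesic_segment e"
  shows "x = (x \<bullet> seg_point e t) *\<^sub>R seg_point e t + (x \<bullet> seg_tan e t) *\<^sub>R seg_tan e t + (x \<bullet> nrm e) *\<^sub>R nrm e"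
  using orthonormal_expand[where p="seg_point e t" and v="seg_tan e t" and x=x]
  by (simp only: seg_frame[OF assms])

lemma on_circle:
  assumes e: "geodesic_segment e" and x: "x \<in> S2" "nrm e \<bullet> x = 0"
  obtains t where "0 \<le> t" "t < 2 * pi" "x = seg_point e t"
proof -
  have ex: "x = (x \<bullet> start e) *\<^sub>R start e + (x \<bullet> dir e) *\<^sub>R dir e"
    using seg_expand[OF e, of x 0] x by (simp add: inner_commute)
  have "x \<bullet> x = 1" using x by (simp add: norm_1_inner)
  moreover have "x \<bullet> x = (x \<bullet> start e)^2 + (x \<bullet> dir e)^2"
    by (subst (2) ex) (simp add: algebra_simps power2_eq_square)
  ultimately have "(x \<bullet> start e)^2 + (x \<bullet> dir e)^2 = 1" by simp
  then obtain t where "0 \<le> t" "t < 2*pi" "x \<bullet> start e = cos t" "x \<bullet> dir e = sin t"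
    using sincos_total_2pi by metis
  with ex show ?thesis using that by (simp add: seg_point_def)
qed

text \<open>Rebasing the segment at parameter \<open>a\<close> moves the window of parameters;
  \<open>near_circle\<close> needs a window centred at a given point.\<close>

lemma on_circle_from:
  assumes e: "geodesic_segment e" and x: "x \<in> S2" "nrm e \<bullet> x = 0"
  obtains t where "a \<le> t" "t < a + 2 * pi" "x = seg_point e t"
proof -
  let ?e = "Seg (seg_point e a) (seg_tan e a) (len e)"
  have "geodesic_segment ?e"
    using seg_frame[OF e] geodesic_segmentD[OF e] by (simp add: geodesic_segment_def norm_1_inner)
  moreover have "nrm ?e = nrm e" using seg_frame[OF e] by (simp add: nrm_def)
  ultimately obtain t where "0 \<le> t" "t < 2*pi" "x = seg_point ?e t"
    using on_circle x by metis
  moreover have "seg_point ?e t = seg_point e (a + t)"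
    by (simp add: seg_point_add) (simp add: seg_point_def)
  ultimately show ?thesis using that[of "a + t"] by simp
qed

text \<open>The inner product of the two points is the cosine of \<open>s - t\<close>. The bound is
  strict because an edge may be a full great circle, on which the parameters 0 and 2 pi give the
  same point.\<close>

lemma seg_point_inj:
  assumes e: "geodesic_segment e" and eq: "seg_point e s = seg_point e t" and d: "\<bar>s - t\<bar> < 2 * pi"
  shows "s = t"
proof -
  have "cos (s - t) = seg_point e s \<bullet> seg_point e t"
    using geodesic_segmentD[OF e] by (simp add: seg_point_def cos_diff algebra_simps)
  also have "\<dots> = 1" using eq seg_frame[OF e] by simp
  finally have c: "cos (s - t) = 1" .
  then obtain n::int where n: "s - t = 2 * pi * n"
    by (subst (asm) cos_one_2pi_int) auto
  from d n have "\<bar>real_of_int n\<bar> < 1" by (simp add: abs_mult)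
  then have "n = 0" by linarith
  then show ?thesis using n by simp
qed

lemma seg_rev_simps [simp]:
  "start (seg_rev e) = seg_point e (len e)" "len (seg_rev e) = len e"
  "dir (seg_rev e) = - seg_tan e (len e)"
  by (simp_all add: seg_rev_def seg_tan_def)

lemma seg_point_rev: "seg_point (seg_rev e) t = seg_point e (len e - t)"
  using seg_point_add[of e "len e" "-t"] by (simp add: seg_point_def)

lemma seg_tan_rev: "seg_tan (seg_rev e) t = - seg_tan e (len e - t)"
  by (simp add: seg_tan_def seg_point_def cos_diff sin_diff algebra_simps)

lemma nrm_rev [simp]:
  assumes "geodesic_segment e" shows "nrm (seg_rev e) = - nrm e"
  using seg_frame[OF assms] by (simp add: nrm_def)

lemma geodesic_rev [simp]:
  assumes "geodesic_segment e" shows "geodesic_segment (seg_rev e)"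
  using seg_frame[OF assms] geodesic_segmentD[OF assms] by (simp add: geodesic_segment_def norm_1_inner)

lemma seg_rev_rev [simp]:
  assumes "geodesic_segment e" shows "seg_rev (seg_rev e) = e"
proof (rule seg.expand)
  show "start (seg_rev (seg_rev e)) = start e \<and> dir (seg_rev (seg_rev e)) = dir e \<and> len (seg_rev (seg_rev e)) = len e"
    by (simp add: seg_point_rev seg_tan_rev)
qed

lemma seg_arc_rev: "seg_arc (seg_rev e) s t = seg_arc e (len e - t) (len e - s)"
proof -
  have "{len e - t..len e - s} = (\<lambda>u. len e - u) ` {s..t}"
    by simp
  then show ?thesis unfolding seg_arc_def by (simp only: image_image) (simp add: seg_point_rev)
qed

lemma seg_set_rev [simp]: "seg_set (seg_rev e) = seg_set e"
  by (simp add: seg_set_def seg_arc_rev)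

lemma seg_interior_rev [simp]: "seg_interior (seg_rev e) = seg_interior e"
proof -
  have "{0<..<len e} = (\<lambda>u. len e - u) ` {0<..<len e}"
    by (auto simp: image_iff intro!: bexI[of _ "len e - _"])
  then show ?thesis unfolding seg_interior_def seg_rev_simps seg_point_rev by (metis image_image)
qed

lemma left_of_nrm: "left_of e f \<longleftrightarrow> (\<forall>x\<in>f. 0 \<le> nrm e \<bullet> x)"
  by (simp add: left_of_def nrm_def)

lemma right_of_rev: "geodesic_segment e \<Longrightarrow> right_of e f \<longleftrightarrow> left_of (seg_rev e) f"
  by (simp add: right_of_def left_of_nrm) (simp add: nrm_def)

lemma seg_eqI:
  assumes "geodesic_segment e" "geodesic_segment e'" "start e = start e'" "nrm e = nrm e'" "len e = len e'"
  shows "e = e'"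
proof (rule seg.expand)
  have "dir u = cross3 (nrm u) (start u)" if "geodesic_segment u" for u
    using geodesic_segmentD[OF that] by (simp add: nrm_def cross_skew[of "cross3 _ _"] Lagrange inner_commute)
  then have "dir e = dir e'" using assms by metis
  then show "start e = start e' \<and> dir e = dir e' \<and> len e = len e'" using assms by simp
qed

lemma parallel_unit:
  fixes m n :: "real^3"
  assumes "m \<in> S2" "n \<in> S2" "p \<bullet> p = 1" "v \<bullet> v = 1" "p \<bullet> v = 0"
    "m \<bullet> p = 0" "m \<bullet> v = 0" "n \<bullet> p = 0" "n \<bullet> v = 0"
  shows "m = n \<or> m = - n"
proof -
  have "m = (m \<bullet> cross3 p v) *\<^sub>R cross3 p v" "n = (n \<bullet> cross3 p v) *\<^sub>R cross3 p v"
    using orthonormal_expand[OF assms(3,4,5)] assms(6-) by (metis add.left_neutral scale_zero_left)+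
  moreover have "norm (cross3 p v) = 1"
    using norm_cross[of p v] assms by (simp add: norm_1_inner dot_cross inner_commute)
  ultimately have "\<bar>m \<bullet> cross3 p v\<bar> = 1" "\<bar>n \<bullet> cross3 p v\<bar> = 1"
    using assms(1,2) by (metis mem_sphere_0 norm_scaleR mult.right_neutral)+
  then have "m \<bullet> cross3 p v = n \<bullet> cross3 p v \<or> m \<bullet> cross3 p v = - (n \<bullet> cross3 p v)" by linarith
  then show ?thesis using \<open>m = _\<close> \<open>n = _\<close> by (metis scaleR_minus_left)
qed

text \<open>Distinct great circles meet only in the two points on the line of
  \<open>cross3 m n\<close>. Polygon edges are recognised by being infinite, so this is what ties a
  polygon edge to the great circle of an edge of the tiling.\<close>

lemma infinite_circle_inter:
  fixes m n :: "real^3"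
  assumes "m \<in> S2" "n \<in> S2" "infinite (S2 \<inter> {x. m \<bullet> x = 0} \<inter> {x. n \<bullet> x = 0})"
  shows "m = n \<or> m = - n"
proof (rule ccontr)
  assume ne: "\<not> ?thesis"
  define c where "c = cross3 m n"
  have mm: "m \<bullet> m = 1" "n \<bullet> n = 1" using assms by (auto simp: norm_1_inner)
  have c0: "c \<noteq> 0"
  proof
    assume "c = 0"
    then have "cross3 m c = 0" by simp
    then have "(m \<bullet> n) *\<^sub>R m = n" using mm by (simp add: c_def Lagrange)
    then have "\<bar>m \<bullet> n\<bar> = 1" "n = (m \<bullet> n) *\<^sub>R m"
      using assms by (metis mem_sphere_0 norm_scaleR mult.right_neutral, simp)
    then have "m \<bullet> n = 1 \<or> m \<bullet> n = -1" by linarith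
    then show False using \<open>(m \<bullet> n) *\<^sub>R m = n\<close> ne by auto
  qed
  have "x \<in> {c /\<^sub>R norm c, - (c /\<^sub>R norm c)}" if x: "x \<in> S2" "m \<bullet> x = 0" "n \<bullet> x = 0" for x
  proof -
    have "cross3 x c = 0" using x by (simp add: c_def Lagrange inner_commute)
    then have "cross3 c (cross3 x c) = 0" by simp
    then have "(c \<bullet> c) *\<^sub>R x = (c \<bullet> x) *\<^sub>R c" by (simp add: Lagrange)
    then have "x = ((c \<bullet> x) / (c \<bullet> c)) *\<^sub>R c" using c0
      by (metis (no_types, lifting) divide_inverse_commute inner_eq_zero_iff scaleR_scaleR left_inverse scaleR_one)
    then obtain k where k: "x = k *\<^sub>R c" by blast
    then have "\<bar>k\<bar> * norm c = 1" using x by auto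
    then have "\<bar>k\<bar> = inverse (norm c)" using c0 by (simp add: field_simps)
    then have "k = inverse (norm c) \<or> k = - inverse (norm c)" by linarith
    then show ?thesis using k by auto
  qed
  then have "S2 \<inter> {x. m \<bullet> x = 0} \<inter> {x. n \<bullet> x = 0} \<subseteq> {c /\<^sub>R norm c, - (c /\<^sub>R norm c)}" by blast
  then show False using assms(3) finite_subset by blast
qed

lemma infinite_arc:
  assumes "geodesic_segment e" "a < b" shows "infinite (seg_point e ` {a<..<b})"
proof
  assume fin: "finite (seg_point e ` {a<..<b})"
  define b' where "b' = min b (a + pi)"
  have "inj_on (seg_point e) {a<..<b'}"
    using pi_gt_zero by (intro inj_onI seg_point_inj[OF assms(1)]) (auto simp: b'_def)
  moreover have "finite (seg_point e ` {a<..<b'})"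
    by (rule finite_subset[OF _ fin]) (auto simp: b'_def)
  ultimately have "finite {a<..<b'}" by (metis finite_imageD)
  moreover have "a < b'" using assms pi_gt_zero by (auto simp: b'_def)
  ultimately show False using infinite_Ioo by blast
qed

lemma continuous_seg_point: "continuous_on A (seg_point e)"
  unfolding seg_point_def by (intro continuous_intros)

lemma isCont_seg_point: "isCont (seg_point e) t"
  using continuous_seg_point continuous_on_eq_continuous_at open_UNIV by blast

subsection \<open>Faces\<close>

text \<open>The inner unit normals of the edges. A face is handled through this set, which is finite
  and cuts out the face by \<open>face_min\<close>.\<close>

definition nrms :: "(real^3) set \<Rightarrow> (real^3) set" where
  "nrms f = {n \<in> S2. f \<subseteq> closed_hemisphere n \<and> infinite (f \<inter> {x. n \<bullet> x = 0})}"

definition face :: "(real^3) set \<Rightarrow> bool" where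
  "face f \<longleftrightarrow> convex_polygon f \<or> digon f"

text \<open>With cones, neighbourhoods can be taken in R^3 instead of the subspace topology of the
  sphere, and convexity is the ordinary one.\<close>

definition fcone :: "(real^3) set \<Rightarrow> (real^3) set" where
  "fcone f = {x. \<forall>n\<in>nrms f. 0 \<le> n \<bullet> x}"

definition fint :: "(real^3) set \<Rightarrow> (real^3) set" where
  "fint f = {x. \<forall>n\<in>nrms f. 0 < n \<bullet> x}"

lemma polygon_edges_nrms: "polygon_edges f = (\<lambda>n. f \<inter> {x. n \<bullet> x = 0}) ` nrms f"
  unfolding polygon_edges_def nrms_def by blast

lemma S2_interior_iff:
  "x \<in> S2_interior f \<longleftrightarrow> (\<exists>U. open U \<and> x \<in> U \<and> x \<in> S2 \<and> U \<inter> S2 \<subseteq> f)"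
proof
  assume "x \<in> S2_interior f"
  then obtain T where T: "openin (top_of_set S2) T" "x \<in> T" "T \<subseteq> f"
    unfolding S2_interior_def interior_of_def by blast
  then obtain U where "open U" "T = S2 \<inter> U" by (auto simp: openin_open)
  with T show "\<exists>U. open U \<and> x \<in> U \<and> x \<in> S2 \<and> U \<inter> S2 \<subseteq> f" by blast
next
  assume "\<exists>U. open U \<and> x \<in> U \<and> x \<in> S2 \<and> U \<inter> S2 \<subseteq> f"
  then obtain U where U: "open U" "x \<in> U" "x \<in> S2" "U \<inter> S2 \<subseteq> f" by blast
  then have "openin (top_of_set S2) (S2 \<inter> U)" by blast
  with U show "x \<in> S2_interior f" unfolding S2_interior_def interior_of_def by blast
qed

lemma tendsto_unit:
  fixes y z :: "real^3"
  assumes "y \<in> S2"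
  shows "((\<lambda>s. (y + s *\<^sub>R z) /\<^sub>R norm (y + s *\<^sub>R z)) \<longlongrightarrow> y) (at_right 0)"
    "\<forall>\<^sub>F s in at_right 0. y + s *\<^sub>R z \<noteq> 0"
proof -
  have t: "((\<lambda>s. y + s *\<^sub>R z) \<longlongrightarrow> y + 0 *\<^sub>R z) (at_right 0)" by (intro tendsto_intros)
  then have "((\<lambda>s. (y + s *\<^sub>R z) /\<^sub>R norm (y + s *\<^sub>R z)) \<longlongrightarrow> (y + 0 *\<^sub>R z) /\<^sub>R norm (y + 0 *\<^sub>R z)) (at_right 0)"
    using assms by (intro tendsto_intros) auto
  then show "((\<lambda>s. (y + s *\<^sub>R z) /\<^sub>R norm (y + s *\<^sub>R z)) \<longlongrightarrow> y) (at_right 0)" using assms by simp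
  have "y + 0 *\<^sub>R z \<noteq> 0" using assms by auto
  with t show "\<forall>\<^sub>F s in at_right 0. y + s *\<^sub>R z \<noteq> 0" by (rule tendsto_imp_eventually_ne)
qed

text \<open>If \<open>n \<bullet> x\<close> were 0, a small move from \<open>x\<close> in the
  direction \<open>-n\<close>, normalised back to the sphere, would stay in \<open>f\<close> but
  leave the hemisphere of \<open>n\<close>.\<close>

lemma S2_interior_strict:
  assumes x: "x \<in> S2_interior f" and n: "n \<in> S2" "f \<subseteq> closed_hemisphere n"
  shows "0 < n \<bullet> x"
proof -
  obtain U where U: "open U" "x \<in> U" "x \<in> S2" "U \<inter> S2 \<subseteq> f" using x S2_interior_iff by blast
  then have ge: "0 \<le> n \<bullet> x" using n by (auto simp: closed_hemisphere_def)
  have "n \<bullet> x \<noteq> 0"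
  proof
    assume 0: "n \<bullet> x = 0"
    have "\<forall>\<^sub>F s in at_right 0. (x + s *\<^sub>R (-n)) /\<^sub>R norm (x + s *\<^sub>R (-n)) \<in> U"
      using tendsto_unit(1)[OF U(3)] U(1,2) by (rule topological_tendstoD)
    moreover note tendsto_unit(2)[OF U(3), of "-n"]
    moreover have "\<forall>\<^sub>F s in at_right (0::real). s > 0" by (simp add: eventually_at_right_less)
    ultimately have "\<forall>\<^sub>F s in at_right (0::real). s > 0 \<and> x + s *\<^sub>R (-n) \<noteq> 0 \<and> (x + s *\<^sub>R (-n)) /\<^sub>R norm (x + s *\<^sub>R (-n)) \<in> U"
      by eventually_elim auto
    then obtain s where s: "s > 0" "x + s *\<^sub>R (-n) \<noteq> 0" "(x + s *\<^sub>R (-n)) /\<^sub>R norm (x + s *\<^sub>R (-n)) \<in> U"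
      using eventually_happens trivial_limit_at_right_real by blast
    have "(x + s *\<^sub>R (-n)) /\<^sub>R norm (x + s *\<^sub>R (-n)) \<in> f"
      using s U(4) by (auto simp: inverse_eq_divide)
    then have "0 \<le> n \<bullet> ((x + s *\<^sub>R (-n)) /\<^sub>R norm (x + s *\<^sub>R (-n)))"
      using n(2) unfolding closed_hemisphere_def by blast
    then have "0 \<le> inverse (norm (x + s *\<^sub>R (-n))) * (n \<bullet> x - s * (n \<bullet> n))"
      by (simp add: inner_right_distrib inner_diff_right)
    then have "0 \<le> n \<bullet> x - s * (n \<bullet> n)"
      using s(2) by (metis norm_eq_zero norm_ge_zero inverse_positive_iff_positive order_le_less zero_le_mult_iff not_less inverse_nonzero_iff_nonzero inverse_nonnegative_iff_nonnegative)
    then show False using 0 s(1) n(1) by (simp add: norm_1_inner)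
  qed
  with ge show ?thesis by simp
qed

lemma face_hemispheres:
  assumes "face f"
  obtains N where "finite N" "N \<noteq> {}" "N \<subseteq> S2" "f = {x \<in> S2. \<forall>n\<in>N. 0 \<le> n \<bullet> x}" "S2_interior f \<noteq> {}"
  using assms unfolding face_def
proof
  assume "convex_polygon f"
  then obtain N where "finite N" "N \<noteq> {}" "N \<subseteq> S2" "f = (\<Inter>n\<in>N. closed_hemisphere n)" "S2_interior f \<noteq> {}"
    unfolding convex_polygon_def by blast
  then show thesis by (intro that[of N]) (auto simp: closed_hemisphere_def)
next
  assume "digon f"
  then obtain m n where mn: "m \<in> S2" "n \<in> S2" "m \<noteq> n" "m \<noteq> - n" "f = closed_hemisphere m \<inter> closed_hemisphere n"
    unfolding digon_def by blast
  let ?c = "(m + n) /\<^sub>R norm (m + n)"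
  have ne: "m + n \<noteq> 0" using mn(4) by (simp add: add_eq_0_iff2)
  have mm: "m \<bullet> m = 1" "n \<bullet> n = 1" using mn by (auto simp: norm_1_inner)
  have "0 < (m + n) \<bullet> (m + n)" using ne by simp
  then have "0 < 1 + m \<bullet> n" using mm by (simp add: algebra_simps inner_commute)
  then have "0 < m \<bullet> ?c" "0 < n \<bullet> ?c" "?c \<in> S2"
    using ne mm by (simp_all add: inner_right_distrib inner_commute add.commute)
  moreover have "open {x. 0 < m \<bullet> x \<and> 0 < n \<bullet> x}"
    by (simp add: open_Collect_conj open_halfspace_gt[unfolded])
  ultimately have "?c \<in> S2_interior f"
    unfolding S2_interior_iff by (intro exI[of _ "{x. 0 < m \<bullet> x \<and> 0 < n \<bullet> x}"]) (auto simp: mn(5) closed_hemisphere_def)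
  then show thesis using mn by (intro that[of "{m,n}"]) (auto simp: closed_hemisphere_def)
qed

lemma eventually_pos:
  fixes n y :: "real^3"
  assumes "0 < n \<bullet> y" shows "\<forall>\<^sub>F x in nhds y. 0 < n \<bullet> x"
proof -
  have "((\<lambda>x. n \<bullet> x) \<longlongrightarrow> n \<bullet> y) (nhds y)"
    by (intro tendsto_intros filterlim_ident)
  then show ?thesis using assms order_tendstoD(1) by blast
qed

lemma eventually_all_pos:
  fixes y :: "real^3"
  assumes "finite N" "\<And>n. n \<in> N \<Longrightarrow> 0 < n \<bullet> y"
  shows "\<forall>\<^sub>F x in nhds y. \<forall>n\<in>N. 0 < n \<bullet> x"
  using assms by (simp add: eventually_ball_finite_distrib eventually_pos)

lemma eventually_seg_point:
  assumes "\<forall>\<^sub>F x in nhds (seg_point e t). P x"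
  shows "\<forall>\<^sub>F s in nhds t. P (seg_point e s)"
proof -
  have "filterlim (seg_point e) (nhds (seg_point e t)) (nhds t)"
    using isCont_seg_point[of t e] by (simp add: isCont_def tendsto_at_iff_tendsto_nhds)
  then show ?thesis using assms eventually_compose_filterlim[of P "nhds (seg_point e t)" "seg_point e" "nhds t"] by simp
qed

text \<open>A family of hemispheres of least size that cuts out \<open>f\<close> is exactly
  \<open>nrms f\<close>. Dropping a member would enlarge the face, and this produces an arc of its
  circle inside \<open>f\<close>; conversely, an infinite contact set with a supporting circle
  shares infinitely many points with one circle of the family.\<close>

lemma face_min:
  assumes "face f"
  shows "finite (nrms f)" "nrms f \<noteq> {}" "f = {x \<in> S2. \<forall>n\<in>nrms f. 0 \<le> n \<bullet> x}"
    "S2_interior f \<noteq> {}"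
proof -
  define P where "P N \<longleftrightarrow> finite N \<and> N \<noteq> {} \<and> N \<subseteq> S2 \<and> f = {x \<in> S2. \<forall>n\<in>N. 0 \<le> n \<bullet> x}" for N
  obtain N0 where "finite N0" "N0 \<noteq> {}" "N0 \<subseteq> S2" "f = {x \<in> S2. \<forall>n\<in>N0. 0 \<le> n \<bullet> x}"
    and "S2_interior f \<noteq> {}" by (rule face_hemispheres[OF assms])
  then have "P N0" by (simp add: P_def)
  obtain c where c: "c \<in> S2_interior f" using \<open>S2_interior f \<noteq> {}\<close> by blast
  obtain N where N: "P N" and mini: "\<And>M. P M \<Longrightarrow> card N \<le> card M"
    using ex_has_least_nat[of P N0 card, OF \<open>P N0\<close>] by blast
  have N': "finite N" "N \<noteq> {}" "N \<subseteq> S2" and f: "f = {x \<in> S2. \<forall>n\<in>N. 0 \<le> n \<bullet> x}" using N by (auto simp: P_def)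
  have hemi: "f \<subseteq> closed_hemisphere n" if "n \<in> N" for n using f that by (auto simp: closed_hemisphere_def)
  have cpos: "0 < n \<bullet> c" if "n \<in> N" for n
    using S2_interior_strict[OF c _ hemi[OF that]] N'(3) that by blast
  have "c \<in> f" using c by (auto simp: S2_interior_iff)
  have 1: "n \<in> nrms f" if n: "n \<in> N" for n
  proof -
    have nn: "n \<bullet> n = 1" "n \<noteq> 0" using n N' by (auto simp: norm_1_inner)
    have "\<exists>z. z \<noteq> 0 \<and> n \<bullet> z = 0 \<and> (\<forall>m\<in>N-{n}. 0 < m \<bullet> z)"
    proof (cases "N = {n}")
      case True
      obtain z :: "real^3" where "z \<noteq> 0" "orthogonal n z" using orthogonal_to_vector_exists[of n] by auto
      with True show ?thesis by (auto simp: orthogonal_def)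
    next
      case False
      then have "N - {n} \<noteq> {}" using n by blast
      moreover have "\<not> P (N - {n})" using mini[of "N - {n}"] n N'(1)
        by (metis card_Diff1_less not_le)
      ultimately have "f \<noteq> {x \<in> S2. \<forall>m\<in>N-{n}. 0 \<le> m \<bullet> x}" using N' by (auto simp: P_def)
      then obtain x where x: "x \<in> S2" "\<forall>m\<in>N-{n}. 0 \<le> m \<bullet> x" "\<not> 0 \<le> n \<bullet> x" using f by blast
      \<comment> \<open>The positive combination of \<open>x\<close>, which violates only
        \<open>n\<close>, and the inner point \<open>c\<close> that lies on the plane of
        \<open>n\<close>; all other constraints are strict there.\<close>
      define z where "z = x + (- (n \<bullet> x) / (n \<bullet> c)) *\<^sub>R c"
      have "n \<bullet> z = 0" using cpos[OF n] by (simp add: z_def inner_diff_right)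
      moreover have "0 < m \<bullet> z" if "m \<in> N - {n}" for m
      proof -
        have "0 \<le> m \<bullet> x" "0 < m \<bullet> c" using x cpos that by auto
        moreover have "0 < - (n \<bullet> x) / (n \<bullet> c)" using x cpos[OF n] by (simp add: divide_neg_pos)
        ultimately have "0 < m \<bullet> x + (- (n \<bullet> x) / (n \<bullet> c)) * (m \<bullet> c)"
          by (intro add_nonneg_pos mult_pos_pos)
        then show ?thesis by (simp add: z_def inner_diff_right)
      qed
      ultimately show ?thesis using \<open>N - {n} \<noteq> {}\<close> by (metis ex_in_conv inner_zero_right less_irrefl)
    qed
    then obtain z where z: "z \<noteq> 0" "n \<bullet> z = 0" "\<forall>m\<in>N-{n}. 0 < m \<bullet> z" by blast
    define u where "u = z /\<^sub>R norm z"
    have u: "u \<bullet> u = 1" "n \<bullet> u = 0" "\<And>m. m \<in> N - {n} \<Longrightarrow> 0 < m \<bullet> u"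
      using z by (auto simp: u_def dot_square_norm power2_eq_square)
    \<comment> \<open>A segment from \<open>u\<close> along the circle of \<open>n\<close>: on it
      \<open>n\<close> vanishes, and near \<open>u\<close> the other constraints stay strict, so an
      arc of it belongs to \<open>f\<close>.\<close>
    let ?e = "Seg u (cross3 n u) 1"
    have e: "geodesic_segment ?e" using u nn pi_gt3
      by (auto simp: geodesic_segment_def norm_1_inner dot_cross dot_cross_self inner_commute)
    have ne: "nrm ?e = n" using u by (simp add: nrm_def Lagrange inner_commute)
    have "\<forall>\<^sub>F x in nhds u. \<forall>m\<in>N-{n}. 0 < m \<bullet> x"
      using N' u by (intro eventually_all_pos) auto
    then have "\<forall>\<^sub>F s in nhds 0. \<forall>m\<in>N-{n}. 0 < m \<bullet> seg_point ?e s"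
      by (intro eventually_seg_point) simp
    then obtain d where d: "d > 0" "\<And>s. \<bar>s\<bar> < d \<Longrightarrow> \<forall>m\<in>N-{n}. 0 < m \<bullet> seg_point ?e s"
      by (auto simp: eventually_nhds_metric dist_real_def)
    have "seg_point ?e ` {0<..<d} \<subseteq> f \<inter> {x. n \<bullet> x = 0}"
    proof
      fix x assume "x \<in> seg_point ?e ` {0<..<d}"
      then obtain s where s: "0 < s" "s < d" "x = seg_point ?e s" by auto
      have "n \<bullet> x = 0" using seg_frame(4)[OF e, of s] s ne by simp
      moreover have "x \<in> S2" using seg_frame(8)[OF e] s by simp
      moreover have "0 \<le> m \<bullet> x" if "m \<in> N" for m
        using d(2)[of s] s that \<open>n \<bullet> x = 0\<close> by (cases "m = n") (auto intro: less_imp_le)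
      ultimately show "x \<in> f \<inter> {x. n \<bullet> x = 0}" using f by blast
    qed
    then have "infinite (f \<inter> {x. n \<bullet> x = 0})" using infinite_arc[OF e d(1)] infinite_super by blast
    then show ?thesis using n N' hemi by (auto simp: nrms_def)
  qed
  have 2: "n' \<in> N" if n': "n' \<in> nrms f" for n'
  proof -
    have n'S: "n' \<in> S2" "f \<subseteq> closed_hemisphere n'" and inf: "infinite (f \<inter> {x. n' \<bullet> x = 0})"
      using n' by (auto simp: nrms_def)
    \<comment> \<open>Otherwise all constraints are strict at \<open>z\<close>, which would be an
      interior point of \<open>f\<close> on a supporting circle.\<close>
    have "\<exists>n\<in>N. n \<bullet> z = 0" if z: "z \<in> f" "n' \<bullet> z = 0" for z
    proof (rule ccontr)
      assume "\<not> ?thesis"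
      then have "\<forall>n\<in>N. 0 < n \<bullet> z" using z f by (auto simp: order_less_le)
      then have "\<forall>\<^sub>F x in nhds z. \<forall>n\<in>N. 0 < n \<bullet> x" using N' by (intro eventually_all_pos) auto
      then obtain U where U: "open U" "z \<in> U" "\<forall>x\<in>U. \<forall>n\<in>N. 0 < n \<bullet> x" by (auto simp: eventually_nhds)
      have "x \<in> f" if "x \<in> U" "x \<in> S2" for x
        unfolding f using U(3) that by (auto intro: less_imp_le)
      then have "U \<inter> S2 \<subseteq> f" by blast
      then have "z \<in> S2_interior f" using U z f by (auto simp: S2_interior_iff)
      then show False using S2_interior_strict n'S z by force
    qed
    then have "f \<inter> {x. n' \<bullet> x = 0} \<subseteq> (\<Union>n\<in>N. S2 \<inter> {x. n' \<bullet> x = 0} \<inter> {x. n \<bullet> x = 0})" using f by blast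
    then have "infinite (\<Union>n\<in>N. S2 \<inter> {x. n' \<bullet> x = 0} \<inter> {x. n \<bullet> x = 0})" using inf infinite_super by blast
    then obtain n where n: "n \<in> N" "infinite (S2 \<inter> {x. n' \<bullet> x = 0} \<inter> {x. n \<bullet> x = 0})" using N'(1) by blast
    then have "n' = n \<or> n' = - n" using infinite_circle_inter n'S N' by blast
    moreover have "0 \<le> n' \<bullet> c" using \<open>c \<in> f\<close> n'S by (auto simp: closed_hemisphere_def)
    ultimately show ?thesis using cpos[OF n(1)] n(1) by auto
  qed
  have "nrms f = N" using 1 2 by blast
  then show "finite (nrms f)" "nrms f \<noteq> {}" "f = {x \<in> S2. \<forall>n\<in>nrms f. 0 \<le> n \<bullet> x}" "S2_interior f \<noteq> {}"
    using N' f c by auto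
qed

lemma nrms_S2: "n \<in> nrms f \<Longrightarrow> n \<in> S2" "n \<in> nrms f \<Longrightarrow> n \<bullet> n = 1" "n \<in> nrms f \<Longrightarrow> norm n = 1"
  by (auto simp: nrms_def norm_1_inner)

lemma face_cone: "face f \<Longrightarrow> f = S2 \<inter> fcone f"
  using face_min(3)[of f] by (auto simp: fcone_def)

lemma face_mem: "face f \<Longrightarrow> x \<in> S2 \<Longrightarrow> x \<in> f \<longleftrightarrow> x \<in> fcone f"
  using face_cone by blast

lemma fint_sub_fcone: "fint f \<subseteq> fcone f"
  by (auto simp: fint_def fcone_def intro: less_imp_le)

lemma open_fint: assumes "face f" shows "open (fint f)"
proof -
  have "fint f = (\<Inter>n\<in>nrms f. {x. 0 < n \<bullet> x})" by (auto simp: fint_def)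
  also have "open \<dots>" using face_min(1)[OF assms] by (intro open_INT) (auto simp: open_halfspace_gt)
  finally show ?thesis .
qed

lemma closed_fcone: "closed (fcone f)"
proof -
  have "fcone f = (\<Inter>n\<in>nrms f. {x. 0 \<le> n \<bullet> x})" by (auto simp: fcone_def)
  also have "closed \<dots>" by (intro closed_INT) (auto simp: closed_halfspace_ge)
  finally show ?thesis .
qed

lemma closed_face: "face f \<Longrightarrow> closed f"
  using face_cone closed_fcone by (metis closed_Int closed_sphere)

lemma face_subset_S2: "face f \<Longrightarrow> f \<subseteq> S2"
  using face_cone by blast

lemma S2_interior_fint: assumes "face f" shows "S2_interior f = S2 \<inter> fint f"
proof
  show "S2_interior f \<subseteq> S2 \<inter> fint f"
    using S2_interior_strict by (auto simp: fint_def nrms_def S2_interior_iff)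
  show "S2 \<inter> fint f \<subseteq> S2_interior f"
    using open_fint[OF assms] fint_sub_fcone[of f] face_cone[OF assms] by (fastforce simp: S2_interior_iff)
qed

lemma fint_nonempty: assumes "face f" obtains c where "c \<in> S2" "c \<in> fint f"
  using face_min(4)[OF assms] S2_interior_fint[OF assms] by auto

lemma zero_notin_fint: "face f \<Longrightarrow> 0 \<notin> fint f"
  using face_min(2)[of f] by (auto simp: fint_def)

lemma fint_scale: "0 < c \<Longrightarrow> c *\<^sub>R x \<in> fint f \<longleftrightarrow> x \<in> fint f"
  by (simp add: fint_def zero_less_mult_iff)

lemma fint_add: "x \<in> fcone f \<Longrightarrow> c \<in> fint f \<Longrightarrow> 0 < s \<Longrightarrow> x + s *\<^sub>R c \<in> fint f"
  by (auto simp: fint_def fcone_def inner_right_distrib add_nonneg_pos)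

lemma opposite_notin_nrms: "face f \<Longrightarrow> n \<in> nrms f \<Longrightarrow> - n \<notin> nrms f"
  using fint_nonempty[of f] unfolding fint_def by (metis (mono_tags, lifting) inner_minus_left mem_Collect_eq neg_0_less_iff_less not_less_iff_gr_or_eq)

lemma nonempty_avoid:
  fixes U :: "(real^3) set"
  assumes "open U" "U \<noteq> {}" "finite N" "0 \<notin> N"
  shows "\<exists>x\<in>U. \<forall>n\<in>N. n \<bullet> x \<noteq> 0"
  using assms(3,4,1,2)
proof (induction N arbitrary: U rule: finite_induct)
  case (insert n N)
  have "n \<noteq> 0" using insert by auto
  then have "interior {x. n \<bullet> x = 0} = {}" by (rule interior_hyperplane)
  then have "\<not> U \<subseteq> {x. n \<bullet> x = 0}" using insert.prems interior_maximal by blast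
  moreover have "open (U \<inter> {x. n \<bullet> x \<noteq> 0})"
    using insert.prems by (intro open_Int) (auto simp: open_Collect_neq continuous_on_inner continuous_on_const continuous_on_id)
  ultimately obtain x where "x \<in> U \<inter> {x. n \<bullet> x \<noteq> 0}" "\<forall>n\<in>N. n \<bullet> x \<noteq> 0"
    using insert.IH[of "U \<inter> {x. n \<bullet> x \<noteq> 0}"] insert.prems by blast
  then show ?case by auto
qed auto

text \<open>Adding small multiples of an interior point to \<open>y\<close> gives interior points
  arbitrarily close to \<open>y\<close>, and finitely many planes can be removed from an open set.
  The lemma turns a statement about a neighbourhood into a witness inside a face, usually to show
  that two faces overlap.\<close>

lemma face_accum:
  assumes f: "face f" and y: "y \<in> fcone f" and P: "\<forall>\<^sub>F x in nhds y. P x" and N: "finite N" "0 \<notin> N"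
  obtains x where "x \<in> fint f" "P x" "\<forall>n\<in>N. n \<bullet> x \<noteq> 0"
proof -
  obtain U where U: "open U" "y \<in> U" "\<forall>x\<in>U. P x" using P by (auto simp: eventually_nhds)
  obtain c where c: "c \<in> fint f" using fint_nonempty[OF f] by blast
  have "((\<lambda>s. y + s *\<^sub>R c) \<longlongrightarrow> y + 0 *\<^sub>R c) (at_right 0)" by (intro tendsto_intros)
  then have "\<forall>\<^sub>F s in at_right 0. y + s *\<^sub>R c \<in> U" using U by (intro topological_tendstoD) auto
  moreover have "\<forall>\<^sub>F s in at_right (0::real). s > 0" by (simp add: eventually_at_right_less)
  ultimately have "\<forall>\<^sub>F s in at_right (0::real). s > 0 \<and> y + s *\<^sub>R c \<in> U" by eventually_elim auto
  then obtain s where "s > 0" "y + s *\<^sub>R c \<in> U"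
    using eventually_happens trivial_limit_at_right_real by blast
  then have "U \<inter> fint f \<noteq> {}" using fint_add y c by blast
  then obtain x where "x \<in> U \<inter> fint f" "\<forall>n\<in>N. n \<bullet> x \<noteq> 0"
    using nonempty_avoid[OF open_Int[OF U(1) open_fint[OF f]] _ N] by blast
  then show ?thesis using that U by blast
qed

text \<open>Constraints that are strict at \<open>y\<close> stay strict nearby, so only those with
  equality at \<open>y\<close> count.\<close>

lemma face_local:
  assumes f: "face f" and y: "y \<in> fcone f"
  shows "\<forall>\<^sub>F x in nhds y. (x \<in> fcone f \<longleftrightarrow> (\<forall>n\<in>nrms f. n \<bullet> y = 0 \<longrightarrow> 0 \<le> n \<bullet> x)) \<and>
     (x \<in> fint f \<longleftrightarrow> (\<forall>n\<in>nrms f. n \<bullet> y = 0 \<longrightarrow> 0 < n \<bullet> x))"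
proof -
  have "\<forall>\<^sub>F x in nhds y. \<forall>n\<in>{n\<in>nrms f. n \<bullet> y \<noteq> 0}. 0 < n \<bullet> x"
    using f y face_min(1) by (intro eventually_all_pos) (auto simp: fcone_def order_less_le)
  then show ?thesis
    by eventually_elim (auto simp: fcone_def fint_def intro: less_imp_le)
qed

text \<open>Radial projection carries the convex set \<open>fint f\<close> to a connected dense
  subset of \<open>f\<close>, and a set between a connected set and its closure is
  connected.\<close>

lemma connected_face: assumes f: "face f" shows "connected f"
proof -
  let ?g = "\<lambda>x::real^3. x /\<^sub>R norm x"
  have fi: "fint f = (\<Inter>n\<in>nrms f. {x. 0 < n \<bullet> x})" by (auto simp: fint_def)
  have "convex (fint f)" unfolding fi by (intro convex_INT) (auto simp: convex_halfspace_gt)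
  moreover have "continuous_on (fint f) ?g"
    using zero_notin_fint[OF f] by (intro continuous_intros) auto
  ultimately have "connected (?g ` fint f)" using connected_continuous_image convex_connected by blast
  moreover have "?g ` fint f \<subseteq> f"
  proof
    fix x assume "x \<in> ?g ` fint f"
    then obtain z where z: "z \<in> fint f" "x = ?g z" by blast
    then have "z \<noteq> 0" using zero_notin_fint[OF f] by auto
    then have "x \<in> fint f" "x \<in> S2" using z by (auto simp: fint_scale)
    then show "x \<in> f" using face_mem[OF f] fint_sub_fcone by blast
  qed
  moreover have "f \<subseteq> closure (?g ` fint f)"
  proof
    fix x assume x: "x \<in> f"
    then have x': "x \<in> S2" "x \<in> fcone f" using face_cone[OF f] by auto
    show "x \<in> closure (?g ` fint f)"
    proof (rule closure_approachable[THEN iffD2], intro allI impI)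
      fix e :: real assume e: "e > 0"
      have "isCont ?g x" using x' by (intro continuous_intros) auto
      then have "(?g \<longlongrightarrow> ?g x) (nhds x)" unfolding isCont_def using tendsto_at_iff_tendsto_nhds[of ?g x] by blast
      then have "\<forall>\<^sub>F z in nhds x. dist (?g z) (?g x) < e" using e by (rule tendstoD)
      then obtain z where "z \<in> fint f" "dist (?g z) (?g x) < e"
        using face_accum[OF f x'(2), of _ "{}"] by auto
      then show "\<exists>y\<in>?g ` fint f. dist y x < e" using x' by auto
    qed
  qed
  ultimately show ?thesis by (rule connected_intermediate_closure)
qed

text \<open>The arc determines the normal only up to sign; an interior point of \<open>f\<close>,
  being on the left of \<open>e\<close>, fixes the sign.\<close>

lemma arc_edge_normal:
  assumes e: "geodesic_segment e" and f: "face f" and ab: "a < b"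
    and arc: "seg_arc e a b \<in> polygon_edges f" and l: "left_of e f"
  shows "nrm e \<in> nrms f" "f \<inter> {x. nrm e \<bullet> x = 0} = seg_arc e a b"
proof -
  obtain n where n: "n \<in> nrms f" "seg_arc e a b = f \<inter> {x. n \<bullet> x = 0}"
    using arc by (auto simp: polygon_edges_nrms)
  have "seg_point e ` {a<..<b} \<subseteq> S2 \<inter> {x. nrm e \<bullet> x = 0} \<inter> {x. n \<bullet> x = 0}"
  proof -
    have "seg_point e ` {a<..<b} \<subseteq> seg_arc e a b" by (auto simp: seg_arc_def)
    then show ?thesis using n(2) seg_frame(4,8)[OF e] by blast
  qed
  then have "infinite (S2 \<inter> {x. nrm e \<bullet> x = 0} \<inter> {x. n \<bullet> x = 0})" using infinite_arc[OF e ab] infinite_super by blast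
  then have "nrm e = n \<or> nrm e = - n" using infinite_circle_inter seg_frame(10)[OF e] nrms_S2(1)[OF n(1)] by blast
  moreover obtain c where c: "c \<in> S2" "c \<in> fint f" using fint_nonempty[OF f] .
  then have "c \<in> f" using face_mem[OF f] fint_sub_fcone by blast
  then have "0 \<le> nrm e \<bullet> c" "0 < n \<bullet> c" using l c n by (auto simp: left_of_nrm fint_def)
  ultimately have "nrm e = n" by auto
  then show "nrm e \<in> nrms f" "f \<inter> {x. nrm e \<bullet> x = 0} = seg_arc e a b" using n by auto
qed

text \<open>Along the edge the product with \<open>m\<close> is a constant times the sine of the
  distance from \<open>t\<close>. It is nonnegative on both sides of \<open>t\<close>, so the
  constant is 0 and \<open>m\<close> is parallel to \<open>nrm e\<close>.\<close>

lemma edge_relint: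
  assumes e: "geodesic_segment e" and f: "face f" and ne: "nrm e \<in> nrms f"
    and arc: "seg_arc e a b \<subseteq> f" and t: "a < t" "t < b" and m: "m \<in> nrms f" "m \<bullet> seg_point e t = 0"
  shows "m = nrm e"
proof -
  have ge: "0 \<le> m \<bullet> seg_point e s" if "a \<le> s" "s \<le> b" for s
  proof -
    have "seg_point e s \<in> f" using arc that by (auto simp: seg_arc_def)
    then show ?thesis using m by (auto simp: nrms_def closed_hemisphere_def)
  qed
  have eq: "m \<bullet> seg_point e (t + s) = sin s * (m \<bullet> seg_tan e t)" for s
    using m by (simp add: seg_point_add inner_right_distrib)
  define d where "d = min (min (t - a) (b - t)) 1"
  have d: "0 < d" "d \<le> t - a" "d \<le> b - t" "d < pi" using t pi_gt3 by (auto simp: d_def)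
  have "0 < sin d" using d by (simp add: sin_gt_zero)
  have "0 \<le> sin d * (m \<bullet> seg_tan e t)" "0 \<le> sin (-d) * (m \<bullet> seg_tan e t)"
    using ge[of "t + d"] ge[of "t - d"] d eq[of d] eq[of "-d"] t by auto
  then have "m \<bullet> seg_tan e t = 0" using \<open>0 < sin d\<close> by (simp add: zero_le_mult_iff mult_le_0_iff)
  then have "m = nrm e \<or> m = - nrm e"
    using seg_frame[OF e] m nrms_S2(1)[OF m(1)] by (intro parallel_unit[of _ _ "seg_point e t" "seg_tan e t"]) auto
  then show ?thesis using opposite_notin_nrms[OF f ne] m by auto
qed

text \<open>If only \<open>nrm e\<close> vanished at the end, the face would contain a longer arc of
  the circle. The bound \<open>b < a + 2 * pi\<close> makes the continuation new, instead of the
  other end of the same arc.\<close>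

lemma edge_end:
  assumes e: "geodesic_segment e" and f: "face f" and ne: "nrm e \<in> nrms f"
    and arc: "f \<inter> {x. nrm e \<bullet> x = 0} = seg_arc e a b" and ab: "a < b" "b < a + 2 * pi"
    and t: "t = a \<or> t = b"
  shows "\<exists>m\<in>nrms f. m \<noteq> nrm e \<and> m \<bullet> seg_point e t = 0"
proof (rule ccontr)
  assume con: "\<not> ?thesis"
  have "seg_point e t \<in> f" using arc t ab by (auto simp: seg_arc_def)
  then have y: "seg_point e t \<in> fcone f" using face_cone[OF f] by blast
  have "\<forall>\<^sub>F x in nhds (seg_point e t). nrm e \<bullet> x = 0 \<longrightarrow> x \<in> fcone f"
    using face_local[OF f y] by eventually_elim (use con in auto)
  then have "\<forall>\<^sub>F s in nhds t. nrm e \<bullet> seg_point e s = 0 \<longrightarrow> seg_point e s \<in> fcone f"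
    by (rule eventually_seg_point)
  then have "\<forall>\<^sub>F s in nhds t. seg_point e s \<in> f"
    by eventually_elim (use seg_frame[OF e] face_mem[OF f] in auto)
  then obtain d where d: "d > 0" "\<And>s. \<bar>s - t\<bar> < d \<Longrightarrow> seg_point e s \<in> f"
    by (auto simp: eventually_nhds_metric dist_real_def)
  define h where "h = min (d/2) ((2 * pi - (b - a)) / 2)"
  have h: "0 < h" "h < d" "h < 2 * pi - (b - a)" using d ab by (auto simp: h_def min_def)
  define s where "s = (if t = a then a - h else b + h)"
  have "seg_point e s \<in> f" using d(2)[of s] h t by (auto simp: s_def)
  then have "seg_point e s \<in> seg_arc e a b" using arc seg_frame(4)[OF e] by auto
  then obtain r where r: "a \<le> r" "r \<le> b" "seg_point e s = seg_point e r" by (auto simp: seg_arc_def)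
  have "s = r" by (rule seg_point_inj[OF e r(3)]) (use r h ab in \<open>auto simp: s_def\<close>)
  then show False using r h t by (auto simp: s_def split: if_splits)
qed

lemma finite_other_circles:
  assumes f: "face f" and n: "n \<in> nrms f"
  shows "finite (\<Union>m\<in>nrms f - {n}. S2 \<inter> {x. n \<bullet> x = 0} \<inter> {x. m \<bullet> x = 0})"
proof (intro finite_UN_I)
  show "finite (nrms f - {n})" using face_min[OF f] by simp
  fix m assume m: "m \<in> nrms f - {n}"
  show "finite (S2 \<inter> {x. n \<bullet> x = 0} \<inter> {x. m \<bullet> x = 0})"
  proof (rule ccontr)
    assume "infinite (S2 \<inter> {x. n \<bullet> x = 0} \<inter> {x. m \<bullet> x = 0})"
    then have "n = m \<or> n = - m" using infinite_circle_inter nrms_S2(1) n m by blast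
    then show False using m n opposite_notin_nrms[OF f, of m] by auto
  qed
qed

subsection \<open>Rotations\<close>

definition rinv :: "real^3^3 \<Rightarrow> real^3^3" where
  "rinv A = transpose A"

lemma rotation_inner:
  fixes A :: "real^3^3"
  assumes "rotation_matrix A" shows "(A *v x) \<bullet> (A *v y) = x \<bullet> y"
proof -
  have "orthogonal_transformation ((*v) A)"
    using assms by (simp add: orthogonal_transformation_matrix rotation_matrix_def matrix_of_matrix_vector_mul)
  then show ?thesis by (simp add: orthogonal_transformation_def)
qed

lemma matrix_vector_mult_minus: "A *v (- x) = - (A *v x)" for A :: "real^3^3"
  using matrix_vector_mult_scaleR[of A "-1" x] by simp

lemma rotation_norm [simp]: "rotation_matrix A \<Longrightarrow> norm (A *v x) = norm x" for A :: "real^3^3"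
  using rotation_inner[of A x x] by (simp add: norm_eq_sqrt_inner)

lemma rotation_transpose:
  assumes "rotation_matrix A"
  shows "rotation_matrix (rinv A)" "rinv A ** A = mat 1" "A ** rinv A = mat 1"
    "rinv A *v (A *v x) = x" "A *v (rinv A *v x) = x"
proof -
  show r: "rotation_matrix (rinv A)" "rinv A ** A = mat 1" "A ** rinv A = mat 1"
    using assms by (auto simp: rotation_matrix_def orthogonal_matrix_def rinv_def)
  show "rinv A *v (A *v x) = x" "A *v (rinv A *v x) = x"
    by (simp_all add: matrix_vector_mul_assoc r)
qed

lemma rotation_mult: "rotation_matrix A \<Longrightarrow> rotation_matrix B \<Longrightarrow> rotation_matrix (A ** B)" for A B :: "real^3^3"
  using orthogonal_matrix_mul[of A B] by (simp add: rotation_matrix_def det_mul)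

lemma rotation_1 [simp]: "rotation_matrix (mat 1 :: real^3^3)"
  by (simp add: rotation_matrix_def orthogonal_matrix_def transpose_mat)

lemma rotation_inj: "rotation_matrix A \<Longrightarrow> A *v x = A *v y \<Longrightarrow> x = y" for A :: "real^3^3"
  by (metis rotation_transpose(4))

lemma rotation_image_iff: "rotation_matrix A \<Longrightarrow> x \<in> (*v) A ` f \<longleftrightarrow> rinv A *v x \<in> f"
  by (metis (no_types, lifting) image_iff rotation_transpose(4,5))

lemma rotation_inner_transpose: "rotation_matrix A \<Longrightarrow> (A *v n) \<bullet> x = n \<bullet> (rinv A *v x)"
  by (metis rotation_inner rotation_transpose(5))

lemma rotation_hemisphere:
  assumes A: "rotation_matrix A"
  shows "(*v) A ` closed_hemisphere n = closed_hemisphere (A *v n)"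
    "(*v) A ` open_hemisphere n = open_hemisphere (A *v n)"
  by (rule set_eqI, simp add: rotation_image_iff[OF A] closed_hemisphere_def open_hemisphere_def
      rotation_inner_transpose[OF A] rotation_norm[OF rotation_transpose(1)[OF A]])+

lemma rotation_inter: "rotation_matrix A \<Longrightarrow> (*v) A ` (f \<inter> g) = (*v) A ` f \<inter> (*v) A ` g" for A :: "real^3^3"
  by (rule set_eqI) (simp add: rotation_image_iff)

lemma rotation_plane: "rotation_matrix A \<Longrightarrow> (*v) A ` {x. n \<bullet> x = 0} = {x. (A *v n) \<bullet> x = 0}" for A :: "real^3^3"
  by (rule set_eqI) (simp add: rotation_image_iff rotation_inner_transpose)

lemma rotation_nrms:
  assumes A: "rotation_matrix A" shows "nrms ((*v) A ` f) = (*v) A ` nrms f"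
proof -
  have 1: "A *v n \<in> nrms ((*v) A ` f)" if A: "rotation_matrix A" and n: "n \<in> nrms f" for A f n
  proof -
    have "(*v) A ` f \<subseteq> closed_hemisphere (A *v n)" using n rotation_hemisphere(1)[OF A, of n] by (auto simp: nrms_def)
    moreover have "(*v) A ` f \<inter> {x. (A *v n) \<bullet> x = 0} = (*v) A ` (f \<inter> {x. n \<bullet> x = 0})"
      using rotation_inter[OF A] rotation_plane[OF A] by metis
    moreover have "infinite ((*v) A ` (f \<inter> {x. n \<bullet> x = 0}))"
      using n rotation_inj[OF A] by (subst finite_image_iff) (auto simp: nrms_def inj_on_def)
    ultimately show ?thesis using n A by (auto simp: nrms_def)
  qed
  have "n \<in> (*v) A ` nrms f" if "n \<in> nrms ((*v) A ` f)" for n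
  proof -
    have "(*v) (rinv A) ` (*v) A ` f = f" using rotation_transpose(4)[OF A] by (simp add: image_image)
    then have "rinv A *v n \<in> nrms f" using 1[OF rotation_transpose(1)[OF A] that] by metis
    then show ?thesis using rotation_image_iff[OF A] by blast
  qed
  then show ?thesis using 1[OF A] by blast
qed

lemma rotation_polygon_edges:
  assumes A: "rotation_matrix A" shows "polygon_edges ((*v) A ` f) = (`) ((*v) A) ` polygon_edges f"
  using rotation_inter[OF A] rotation_plane[OF A]
  by (simp add: polygon_edges_nrms rotation_nrms[OF A] image_image)

lemma rotation_fcone: "rotation_matrix A \<Longrightarrow> fcone ((*v) A ` f) = (*v) A ` fcone f"
  by (rule set_eqI) (simp add: fcone_def rotation_nrms rotation_image_iff rotation_inner_transpose)

lemma rotation_fint: "rotation_matrix A \<Longrightarrow> fint ((*v) A ` f) = (*v) A ` fint f"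
  by (rule set_eqI) (simp add: fint_def rotation_nrms rotation_image_iff rotation_inner_transpose)

lemma rotation_tendsto: "isCont ((*v) A) x" for A :: "real^3^3"
  by (intro continuous_intros linear_continuous_at matrix_vector_mul_bounded_linear)

lemma rotation_S2_interior:
  assumes A: "rotation_matrix A" shows "S2_interior ((*v) A ` f) = (*v) A ` S2_interior f"
proof -
  have 1: "A *v x \<in> S2_interior ((*v) A ` f)" if A: "rotation_matrix A" and x: "x \<in> S2_interior f" for A f x
  proof -
    obtain U where U: "open U" "x \<in> U" "x \<in> S2" "U \<inter> S2 \<subseteq> f" using x S2_interior_iff by blast
    have "(*v) A ` U = (*v) (rinv A) -` U" using rotation_image_iff[OF A] by blast
    then have "open ((*v) A ` U)" using continuous_open_vimage[OF U(1), of "(*v) (rinv A)"] rotation_tendsto by auto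
    moreover have "(*v) A ` U \<inter> S2 \<subseteq> (*v) A ` f"
      using U(4) A by auto
    ultimately show ?thesis using U(2,3) A unfolding S2_interior_iff by (intro exI[of _ "(*v) A ` U"]) auto
  qed
  have "x \<in> (*v) A ` S2_interior f" if "x \<in> S2_interior ((*v) A ` f)" for x
  proof -
    have "(*v) (rinv A) ` (*v) A ` f = f" using rotation_transpose(4)[OF A] by (simp add: image_image)
    then have "rinv A *v x \<in> S2_interior f" using 1[OF rotation_transpose(1)[OF A] that] by metis
    then show ?thesis using rotation_image_iff[OF A] by blast
  qed
  then show ?thesis using 1[OF A] by blast
qed

lemma rotation_convex_polygon:
  assumes A: "rotation_matrix A" and f: "convex_polygon f" shows "convex_polygon ((*v) A ` f)"
proof -
  obtain N m where N: "compact f" "S2_interior f \<noteq> {}" "finite N" "N \<noteq> {}" "N \<subseteq> S2" "f = (\<Inter>n\<in>N. closed_hemisphere n)"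
     "m \<in> S2" "f \<subseteq> open_hemisphere m" using f unfolding convex_polygon_def by blast
  have "compact ((*v) A ` f)" using N(1) rotation_tendsto
    by (intro compact_continuous_image continuous_at_imp_continuous_on) auto
  moreover have "(*v) A ` f = (\<Inter>n\<in>(*v) A ` N. closed_hemisphere n)"
  proof -
    obtain n where "n \<in> N" using N(4) by blast
    moreover have "inj ((*v) A)" using rotation_inj[OF A] by (auto simp: inj_on_def)
    ultimately have "(*v) A ` (\<Inter>n\<in>N. closed_hemisphere n) = (\<Inter>n\<in>N. (*v) A ` closed_hemisphere n)"
      by (intro image_INT[of _ UNIV]) auto
    then show ?thesis unfolding N(6) by (simp add: rotation_hemisphere[OF A])
  qed
  moreover have "(*v) A ` f \<subseteq> open_hemisphere (A *v m)" using N(8) rotation_hemisphere[OF A] by blast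
  ultimately show ?thesis unfolding convex_polygon_def using N A rotation_S2_interior[OF A, of f]
    by (intro conjI exI[of _ "(*v) A ` N"] bexI[of _ "A *v m"]) auto
qed

lemma rotation_digon:
  assumes A: "rotation_matrix A" and f: "digon f" shows "digon ((*v) A ` f)"
proof -
  obtain m n where mn: "m \<in> S2" "n \<in> S2" "m \<noteq> n" "m \<noteq> - n" "f = closed_hemisphere m \<inter> closed_hemisphere n"
    using f unfolding digon_def by blast
  have "A *v m \<noteq> A *v n" "A *v m \<noteq> - (A *v n)"
    using mn rotation_inj[OF A, of m n] rotation_inj[OF A, of m "- n"] by (auto simp: matrix_vector_mult_minus)
  then show ?thesis unfolding digon_def using mn A
    by (intro bexI[of _ "A *v m"] bexI[of _ "A *v n"]) (auto simp: rotation_inter[OF A] rotation_hemisphere[OF A])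
qed

lemma rotation_face: "rotation_matrix A \<Longrightarrow> face f \<Longrightarrow> face ((*v) A ` f)"
  unfolding face_def using rotation_digon rotation_convex_polygon by blast

subsection \<open>The combinatorics of a right flippable tiling\<close>

locale rtiling =
  fixes T :: tiling
  assumes right_flippable: "right_flippable T"
begin

lemma tiling: "tiling_of_S2 T"
  using right_flippable by (simp add: right_flippable_def)

lemma faces_face: "f \<in> faces T \<Longrightarrow> face f"
  using tiling by (simp add: tiling_of_S2_def face_def)

lemma black_face: "f \<in> black T \<Longrightarrow> f \<in> faces T" and white_face: "f \<in> white T \<Longrightarrow> f \<in> faces T"
  by (simp_all add: faces_def)

lemma black_white: "f \<in> black T \<Longrightarrow> f \<notin> white T"
  using tiling by (auto simp: tiling_of_S2_def)

lemma edges_geodesic: "e \<in> edges T \<Longrightarrow> geodesic_segment e" and edges_rev: "e \<in> edges T \<Longrightarrow> seg_rev e \<in> edges T"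
  using tiling by (auto simp: tiling_of_S2_def)

lemma edges_len: "e \<in> edges T \<Longrightarrow> len e \<le> 2 * pi" "e \<in> edges T \<Longrightarrow> 0 < len e"
  using edges_geodesic geodesic_segmentD by auto

lemma edges_cross:
  "\<lbrakk>e \<in> edges T; e' \<in> edges T; x \<in> seg_interior e; x \<in> seg_interior e'\<rbrakk> \<Longrightarrow> e' = e \<or> e' = seg_rev e"
  using tiling unfolding tiling_of_S2_def by (metis disjoint_iff)

lemma polygon_edge_in_edge: "\<lbrakk>f \<in> faces T; a \<in> polygon_edges f\<rbrakk> \<Longrightarrow> \<exists>e\<in>edges T. a \<subseteq> seg_set e"
  using tiling by (simp add: tiling_of_S2_def)

lemma faces_cover: "\<Union> (faces T) = S2"
  using tiling by (simp add: tiling_of_S2_def)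

lemma fint_disjoint:
  assumes "f \<in> faces T" "g \<in> faces T" "x \<in> fint f" "x \<in> fint g" shows "f = g"
proof (rule ccontr)
  assume "f \<noteq> g"
  then have dis: "S2_interior f \<inter> S2_interior g = {}" using assms tiling by (auto simp: tiling_of_S2_def)
  have "x \<noteq> 0" using assms zero_notin_fint faces_face by blast
  then have "x /\<^sub>R norm x \<in> S2" "x /\<^sub>R norm x \<in> fint f" "x /\<^sub>R norm x \<in> fint g"
    using assms by (auto simp: fint_scale)
  then show False using dis S2_interior_fint faces_face assms by blast
qed

section \<open>The four faces around an edge\<close>

definition left_black :: "seg \<Rightarrow> (real^3) set \<Rightarrow> real \<Rightarrow> bool" where
  "left_black e f l \<longleftrightarrow> f \<in> black T \<and> nrm e \<in> nrms f \<and> f \<inter> {x. nrm e \<bullet> x = 0} = seg_arc e 0 l \<and> 0 < l \<and> l < len e"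

definition left_white :: "seg \<Rightarrow> (real^3) set \<Rightarrow> real \<Rightarrow> bool" where
  "left_white e f l \<longleftrightarrow> f \<in> white T \<and> nrm e \<in> nrms f \<and> f \<inter> {x. nrm e \<bullet> x = 0} = seg_arc e l (len e) \<and> 0 < l \<and> l < len e"

text \<open>Reversing \<open>e\<close> carries the pattern to itself with the same \<open>l\<close>,
  so the right side can be described as the left side of \<open>seg_rev e\<close>.\<close>

lemma edge_pattern_ex:
  assumes e: "e \<in> edges T"
  shows "\<exists>l f g f' g'. left_black e f l \<and> left_white e g l \<and> left_black (seg_rev e) f' l \<and> left_white (seg_rev e) g' l"
proof -
  have g: "geodesic_segment e" "geodesic_segment (seg_rev e)" using e edges_geodesic by auto
  obtain l w where lw: "0 < l" "0 < w" "len e = l + w"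
    and 1: "\<exists>f\<in>white T. right_of e f \<and> seg_arc e 0 w \<in> polygon_edges f"
    and 2: "\<exists>f\<in>black T. right_of e f \<and> seg_arc e w (len e) \<in> polygon_edges f"
    and 3: "\<exists>f\<in>black T. left_of e f \<and> seg_arc e 0 l \<in> polygon_edges f"
    and 4: "\<exists>f\<in>white T. left_of e f \<and> seg_arc e l (len e) \<in> polygon_edges f"
    using right_flippable e unfolding right_flippable_def edge_pattern_def by blast
  have r: "right_of e f \<longleftrightarrow> left_of (seg_rev e) f" for f using right_of_rev[OF g(1)] .
  have a: "seg_arc e 0 w = seg_arc (seg_rev e) l (len e)" "seg_arc e w (len e) = seg_arc (seg_rev e) 0 l"
    using lw by (simp_all add: seg_arc_rev)
  obtain f where "left_black e f l"
    using 3 arc_edge_normal[OF g(1) faces_face[OF black_face], of _ 0 l] lw by (auto simp: left_black_def)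
  moreover obtain f where "left_white e f l"
    using 4 arc_edge_normal[OF g(1) faces_face[OF white_face], of _ l "len e"] lw by (auto simp: left_white_def)
  moreover obtain f where "left_black (seg_rev e) f l"
    using 2 arc_edge_normal[OF g(2) faces_face[OF black_face], of _ 0 l] lw unfolding a r by (auto simp: left_black_def)
  moreover obtain f where "left_white (seg_rev e) f l"
    using 1 arc_edge_normal[OF g(2) faces_face[OF white_face], of _ l "len e"] lw unfolding a r by (auto simp: left_white_def)
  ultimately show ?thesis by blast
qed

text \<open>At \<open>z\<close> both faces have \<open>n\<close> as their only active normal, so
  both fill the same half of a neighbourhood of \<open>z\<close> and their interiors meet.\<close>

lemma same_side_eq:
  assumes f: "f \<in> faces T" "n \<in> nrms f" and g: "g \<in> faces T" "n \<in> nrms g"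
    and z: "z \<in> f" "z \<in> g" and n: "n \<bullet> z = 0" "\<And>m. m \<in> nrms f \<Longrightarrow> m \<bullet> z = 0 \<Longrightarrow> m = n" "\<And>m. m \<in> nrms g \<Longrightarrow> m \<bullet> z = 0 \<Longrightarrow> m = n"
  shows "f = g"
proof -
  have zc: "z \<in> fcone f" "z \<in> fcone g" using z face_cone faces_face f g by blast+
  have "\<forall>\<^sub>F x in nhds z. 0 < n \<bullet> x \<longrightarrow> x \<in> fint g"
    using face_local[OF faces_face[OF g(1)] zc(2)] by eventually_elim (use n in auto)
  then obtain x where "x \<in> fint f" "0 < n \<bullet> x \<longrightarrow> x \<in> fint g"
    using face_accum[OF faces_face[OF f(1)] zc(1), of _ "{}"] by auto
  then show ?thesis using fint_disjoint f g by (auto simp: fint_def)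
qed

text \<open>A point of the polygon edge of \<open>f\<close>, chosen off the other circles of
  \<open>f\<close> and off the ends of the two polygon edges on \<open>e\<close>, is inside the edge
  of \<open>b\<close> or of \<open>w\<close>; there \<open>same_side_eq\<close> applies.\<close>

lemma incident_left:
  assumes e: "e \<in> edges T" and b: "left_black e b l" and w: "left_white e w l"
    and f: "f \<in> faces T" "nrm e \<in> nrms f" and sub: "f \<inter> {x. nrm e \<bullet> x = 0} \<subseteq> seg_set e"
  shows "f = b \<or> f = w"
proof -
  have g: "geodesic_segment e" using e edges_geodesic by auto
  have ff: "face f" using f faces_face by auto
  define B where "B = (\<Union>m\<in>nrms f - {nrm e}. S2 \<inter> {x. nrm e \<bullet> x = 0} \<inter> {x. m \<bullet> x = 0})"
  have "infinite (f \<inter> {x. nrm e \<bullet> x = 0})" using f by (auto simp: nrms_def)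
  moreover have "finite (B \<union> seg_point e ` {0, l, len e})"
    using finite_other_circles[OF ff f(2)] by (auto simp: B_def)
  ultimately have "infinite ((f \<inter> {x. nrm e \<bullet> x = 0}) - (B \<union> seg_point e ` {0, l, len e}))" by (rule Diff_infinite_finite[rotated])
  then have "(f \<inter> {x. nrm e \<bullet> x = 0}) - (B \<union> seg_point e ` {0, l, len e}) \<noteq> {}" by (rule infinite_imp_nonempty)
  then obtain z where z: "z \<in> f" "nrm e \<bullet> z = 0" "z \<notin> B" "z \<notin> seg_point e ` {0, l, len e}" by blast
  then have "z \<in> seg_set e" using sub by blast
  then obtain t where t: "0 \<le> t" "t \<le> len e" "z = seg_point e t" by (auto simp: seg_set_def seg_arc_def)
  then have t': "0 < t" "t < len e" "t \<noteq> l" using z(4) by (force simp: order_less_le)+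
  have 1: "m = nrm e" if "m \<in> nrms f" "m \<bullet> z = 0" for m
    using z that face_subset_S2[OF ff] by (auto simp: B_def)
  have b': "b \<in> black T" "nrm e \<in> nrms b" "b \<inter> {x. nrm e \<bullet> x = 0} = seg_arc e 0 l" "face b"
    and w': "w \<in> white T" "nrm e \<in> nrms w" "w \<inter> {x. nrm e \<bullet> x = 0} = seg_arc e l (len e)" "face w"
    using b w faces_face[OF black_face, of b] faces_face[OF white_face, of w] by (simp_all add: left_black_def left_white_def)
  show ?thesis
  proof (cases "t < l")
    case True
    have sub: "seg_arc e 0 l \<subseteq> b" using b' by blast
    have 2: "m = nrm e" if "m \<in> nrms b" "m \<bullet> z = 0" for m
      using edge_relint[OF g b'(4,2) sub t'(1) True, of m] that t by simp
    have "z \<in> b" using sub t True by (auto simp: seg_arc_def)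
    then have "f = b"
      by (rule same_side_eq[OF f black_face[OF b'(1)] b'(2) z(1) _ z(2)]) (erule (1) 1, erule (1) 2)
    then show ?thesis by simp
  next
    case False
    then have tl: "l < t" using t' by simp
    have sub: "seg_arc e l (len e) \<subseteq> w" using w' by blast
    have 2: "m = nrm e" if "m \<in> nrms w" "m \<bullet> z = 0" for m
      using edge_relint[OF g w'(4,2) sub tl t'(2), of m] that t by simp
    have "z \<in> w" using sub t tl by (auto simp: seg_arc_def)
    then have "f = w"
      by (rule same_side_eq[OF f white_face[OF w'(1)] w'(2) z(1) _ z(2)]) (erule (1) 1, erule (1) 2)
    then show ?thesis by simp
  qed
qed

text \<open>The black and the white face on the left of \<open>e\<close>, and the length of the black polygon edge; all
  three are determined by \<open>e\<close>, see \<open>incident_left\<close>.\<close>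
definition bl :: "seg \<Rightarrow> (real^3) set" where "bl e = (SOME f. \<exists>l. left_black e f l)"
definition wl :: "seg \<Rightarrow> (real^3) set" where "wl e = (SOME f. \<exists>l. left_white e f l)"
definition lb :: "seg \<Rightarrow> real" where "lb e = (SOME l. \<exists>f. left_black e f l)"

lemma arc_length_unique:
  assumes g: "geodesic_segment e" and l: "0 < l" "l < 2 * pi" "0 < l'" "l' < 2 * pi" and eq: "seg_arc e 0 l = seg_arc e 0 l'"
  shows "l = l'"
proof -
  have "l \<le> l'" if l: "0 < l" "l < 2 * pi" "0 < l'" "l' < 2 * pi" and eq: "seg_arc e 0 l = seg_arc e 0 l'" for l l'
  proof -
    have "seg_point e l \<in> seg_arc e 0 l'" unfolding eq[symmetric] using l by (auto simp: seg_arc_def)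
    then obtain s where "0 \<le> s" "s \<le> l'" "seg_point e l = seg_point e s" by (auto simp: seg_arc_def)
    then show ?thesis using seg_point_inj[OF g, of l s] l by fastforce
  qed
  then show ?thesis using assms by (metis order_antisym)
qed

lemma bl_wl_lb:
  assumes e: "e \<in> edges T"
  shows "left_black e (bl e) (lb e)" "left_white e (wl e) (lb e)" "lb (seg_rev e) = lb e"
proof -
  obtain l f g f' g' where l: "left_black e f l" "left_white e g l" "left_black (seg_rev e) f' l" "left_white (seg_rev e) g' l"
    using edge_pattern_ex[OF e] by blast
  have b: "h = f \<and> k = l" if e: "e \<in> edges T" and l: "left_black e f l" "left_white e g l" and h: "left_black e h k" for e h k f g l
  proof -
    have "seg_arc e 0 k \<subseteq> seg_set e" using h by (auto simp: left_black_def seg_set_def seg_arc_def)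
    then have "h = f \<or> h = g" using incident_left[OF e l, of h] h black_face by (auto simp: left_black_def)
    then have "h = f" using h l black_white by (auto simp: left_black_def left_white_def)
    moreover have "l = k" by (rule arc_length_unique[OF edges_geodesic[OF e]])
        (use h l edges_len[OF e] \<open>h = f\<close> in \<open>auto simp: left_black_def\<close>)
    ultimately show ?thesis by simp
  qed
  have w: "h = g" if h: "left_white e h k" for h k
  proof -
    have "seg_arc e k (len e) \<subseteq> seg_set e" using h by (auto simp: left_white_def seg_set_def seg_arc_def)
    then have "h = f \<or> h = g" using incident_left[OF e l(1,2), of h] h white_face by (auto simp: left_white_def)
    then show "h = g" using h l black_white by (auto simp: left_black_def left_white_def)
  qed
  have "bl e = f" unfolding bl_def by (rule some1_equality) (use b[OF e l(1,2)] l in blast)+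
  moreover have lb: "lb e = l" unfolding lb_def by (rule some1_equality) (use b[OF e l(1,2)] l in blast)+
  moreover have "wl e = g" unfolding wl_def by (rule some1_equality) (use w l in blast)+
  moreover have "lb (seg_rev e) = l" unfolding lb_def
    by (rule some1_equality) (use b[OF edges_rev[OF e] l(3,4)] l in blast)+
  ultimately show "left_black e (bl e) (lb e)" "left_white e (wl e) (lb e)" "lb (seg_rev e) = lb e"
    using l by auto
qed

definition lw :: "seg \<Rightarrow> real" where "lw e = len e - lb e"
definition br :: "seg \<Rightarrow> (real^3) set" where "br e = bl (seg_rev e)"
definition wr :: "seg \<Rightarrow> (real^3) set" where "wr e = wl (seg_rev e)"

lemma lw_rev: "e \<in> edges T \<Longrightarrow> lw (seg_rev e) = lw e"
  by (simp add: lw_def bl_wl_lb)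

lemma br_rev: "e \<in> edges T \<Longrightarrow> br (seg_rev e) = bl e" and wr_rev: "e \<in> edges T \<Longrightarrow> wr (seg_rev e) = wl e"
  by (simp_all add: br_def wr_def edges_geodesic)

lemma edge_facts:
  assumes e: "e \<in> edges T"
  shows "0 < lb e" "lb e < len e" "0 < lw e" "lw e < len e" "len e = lb e + lw e"
    "bl e \<in> black T" "wl e \<in> white T" "br e \<in> black T" "wr e \<in> white T"
    "bl e \<in> faces T" "wl e \<in> faces T" "br e \<in> faces T" "wr e \<in> faces T"
    "face (bl e)" "face (wl e)" "face (br e)" "face (wr e)"
    "nrm e \<in> nrms (bl e)" "nrm e \<in> nrms (wl e)" "- nrm e \<in> nrms (br e)" "- nrm e \<in> nrms (wr e)"
    "bl e \<inter> {x. nrm e \<bullet> x = 0} = seg_arc e 0 (lb e)"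
    "wl e \<inter> {x. nrm e \<bullet> x = 0} = seg_arc e (lb e) (len e)"
    "br e \<inter> {x. nrm e \<bullet> x = 0} = seg_arc e (lw e) (len e)"
    "wr e \<inter> {x. nrm e \<bullet> x = 0} = seg_arc e 0 (lw e)"
proof -
  note e' = edges_rev[OF e]
  note g = edges_geodesic[OF e]
  note l = bl_wl_lb[OF e]
  note r = bl_wl_lb(1,2)[OF e', unfolded l(3)]
  show "0 < lb e" "lb e < len e" "0 < lw e" "lw e < len e" "len e = lb e + lw e"
    "bl e \<in> black T" "wl e \<in> white T" "br e \<in> black T" "wr e \<in> white T"
    "bl e \<in> faces T" "wl e \<in> faces T" "br e \<in> faces T" "wr e \<in> faces T"
    "face (bl e)" "face (wl e)" "face (br e)" "face (wr e)"
    using l r black_face white_face faces_face by (auto simp: left_black_def left_white_def lw_def br_def wr_def)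
  show "nrm e \<in> nrms (bl e)" "nrm e \<in> nrms (wl e)" "- nrm e \<in> nrms (br e)" "- nrm e \<in> nrms (wr e)"
    using l r nrm_rev[OF g] by (auto simp: left_black_def left_white_def br_def wr_def)
  show "bl e \<inter> {x. nrm e \<bullet> x = 0} = seg_arc e 0 (lb e)"
    "wl e \<inter> {x. nrm e \<bullet> x = 0} = seg_arc e (lb e) (len e)"
    "br e \<inter> {x. nrm e \<bullet> x = 0} = seg_arc e (lw e) (len e)"
    "wr e \<inter> {x. nrm e \<bullet> x = 0} = seg_arc e 0 (lw e)"
    using l r nrm_rev[OF g] by (auto simp: left_black_def left_white_def br_def wr_def lw_def seg_arc_rev)
qed

lemma edge_points:
  assumes e: "e \<in> edges T"
  shows "0 \<le> t \<Longrightarrow> t \<le> lb e \<Longrightarrow> seg_point e t \<in> bl e" "lb e \<le> t \<Longrightarrow> t \<le> len e \<Longrightarrow> seg_point e t \<in> wl e"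
   "0 \<le> t \<Longrightarrow> t \<le> lw e \<Longrightarrow> seg_point e t \<in> wr e" "lw e \<le> t \<Longrightarrow> t \<le> len e \<Longrightarrow> seg_point e t \<in> br e"
  using edge_facts(22-25)[OF e] by (auto simp: seg_arc_def)

lemma seg_interiorI: "0 < t \<Longrightarrow> t < len e \<Longrightarrow> seg_point e t \<in> seg_interior e"
  by (auto simp: seg_interior_def)

lemma face_edge:
  assumes f: "f \<in> faces T" "m \<in> nrms f"
  shows "\<exists>e\<in>edges T. m = nrm e \<and> (f = bl e \<or> f = wl e)"
proof -
  have "f \<inter> {x. m \<bullet> x = 0} \<in> polygon_edges f" using f by (auto simp: polygon_edges_nrms)
  then obtain e where e: "e \<in> edges T" "f \<inter> {x. m \<bullet> x = 0} \<subseteq> seg_set e"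
    using polygon_edge_in_edge f(1) by metis
  note g = edges_geodesic[OF e(1)]
  have "f \<inter> {x. m \<bullet> x = 0} \<subseteq> S2 \<inter> {x. m \<bullet> x = 0} \<inter> {x. nrm e \<bullet> x = 0}"
    using e(2) seg_frame(4,8)[OF g] by (auto simp: seg_set_def seg_arc_def)
  moreover have "infinite (f \<inter> {x. m \<bullet> x = 0})" using f by (auto simp: nrms_def)
  ultimately have "infinite (S2 \<inter> {x. m \<bullet> x = 0} \<inter> {x. nrm e \<bullet> x = 0})" using infinite_super by blast
  then have "m = nrm e \<or> m = - nrm e" using infinite_circle_inter nrms_S2(1)[OF f(2)] seg_frame(10)[OF g] by blast
  then show ?thesis
  proof
    assume m: "m = nrm e"
    then have "f = bl e \<or> f = wl e" using incident_left[OF e(1) bl_wl_lb(1,2)[OF e(1)] f(1)] f e by auto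
    then show ?thesis using e m by blast
  next
    assume m: "m = - nrm e"
    then have m': "m = nrm (seg_rev e)" using g by simp
    then have "f = bl (seg_rev e) \<or> f = wl (seg_rev e)"
      using incident_left[OF edges_rev[OF e(1)] bl_wl_lb(1,2)[OF edges_rev[OF e(1)]] f(1)] f e by auto
    then show ?thesis using edges_rev[OF e(1)] m' by blast
  qed
qed

lemma black_edge:
  assumes "f \<in> black T" "m \<in> nrms f"
  obtains e where "e \<in> edges T" "m = nrm e" "f = bl e"
  using face_edge[OF black_face[OF assms(1)] assms(2)] assms edge_facts(7) black_white by blast

text \<open>The white face is placed on the right of the edge, so that its polygon edge, like that
  of \<open>bl e\<close>, begins at \<open>start e\<close>.\<close>

lemma white_edge:
  assumes f: "f \<in> white T" "m \<in> nrms f"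
  obtains e where "e \<in> edges T" "m = - nrm e" "f = wr e"
proof -
  obtain e where e: "e \<in> edges T" "m = nrm e" "f = wl e"
    using face_edge[OF white_face[OF f(1)] f(2)] f(1) edge_facts(6) black_white by blast
  then show thesis using that[of "seg_rev e"] edges_rev edges_geodesic by (auto simp: wr_rev)
qed

lemma black_edge_at:
  assumes "f \<in> black T" "m \<in> nrms f" "y \<in> f" "m \<bullet> y = 0"
  obtains e t where "e \<in> edges T" "m = nrm e" "f = bl e" "y = seg_point e t" "0 \<le> t" "t \<le> lb e"
proof -
  obtain e where e: "e \<in> edges T" "m = nrm e" "f = bl e" using black_edge assms by blast
  then have "y \<in> seg_arc e 0 (lb e)" using edge_facts(22)[OF e(1)] assms by auto
  then show thesis using that e by (auto simp: seg_arc_def)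
qed

lemma white_edge_at:
  assumes "f \<in> white T" "m \<in> nrms f" "y \<in> f" "m \<bullet> y = 0"
  obtains e t where "e \<in> edges T" "m = - nrm e" "f = wr e" "y = seg_point e t" "0 \<le> t" "t \<le> lw e"
proof -
  obtain e where e: "e \<in> edges T" "m = - nrm e" "f = wr e" using white_edge assms by blast
  then have "y \<in> seg_arc e 0 (lw e)" using edge_facts(25)[OF e(1)] assms by auto
  then show thesis using that e by (auto simp: seg_arc_def)
qed

section \<open>The vertices of the tiling\<close>

lemma overlap_same:
  assumes e: "e \<in> edges T" "e' \<in> edges T" "nrm e = nrm e'" and a: "0 \<le> a" "a < b" "b \<le> len e"
    and sub: "seg_arc e a b \<subseteq> seg_set e'"
  shows "e = e'"
proof -
  have "infinite (seg_point e ` {a<..<b} - seg_point e' ` {0, len e'})"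
    using infinite_arc[OF edges_geodesic[OF e(1)] a(2)] by (intro Diff_infinite_finite) auto
  then have "seg_point e ` {a<..<b} - seg_point e' ` {0, len e'} \<noteq> {}" by (rule infinite_imp_nonempty)
  then obtain z where z: "z \<in> seg_point e ` {a<..<b}" "z \<notin> seg_point e' ` {0, len e'}" by blast
  from z(1) obtain s where s: "a < s" "s < b" "z = seg_point e s" by auto
  have z': "z \<noteq> seg_point e' 0" "z \<noteq> seg_point e' (len e')" using z(2) by auto
  have "seg_point e s \<in> seg_set e'" using s sub by (auto simp: seg_arc_def)
  then obtain r where r: "0 \<le> r" "r \<le> len e'" "z = seg_point e' r" using s by (auto simp: seg_set_def seg_arc_def)
  then have "r \<noteq> 0" "r \<noteq> len e'" using z' by blast+
  then have "seg_point e s \<in> seg_interior e'" using r s seg_interiorI[of r e'] by simp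
  moreover have "seg_point e s \<in> seg_interior e" using s a by (intro seg_interiorI) auto
  ultimately have "e' = e \<or> e' = seg_rev e" using edges_cross e by blast
  moreover have "nrm e \<noteq> - nrm e"
  proof
    assume "nrm e = - nrm e"
    then have "nrm e \<bullet> nrm e = - (nrm e \<bullet> nrm e)" by (metis inner_minus_left)
    then show False using geodesic_segmentD(5)[OF edges_geodesic[OF e(1)]] by simp
  qed
  ultimately show ?thesis using e(3) nrm_rev[OF edges_geodesic[OF e(1)]] by metis
qed

lemma same_normal:
  assumes e: "e \<in> edges T" "e' \<in> edges T" "nrm e = nrm e'" and f: "bl e = bl e' \<or> wr e = wr e' \<or> wl e = wl e'"
  shows "e = e'"
  using f
proof (elim disjE)
  assume "bl e = bl e'"
  then have "seg_arc e 0 (lb e) = seg_arc e' 0 (lb e')" using e edge_facts(22) by metis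
  then have "seg_arc e 0 (lb e) \<subseteq> seg_set e'" using edge_facts[OF e(2)] by (auto simp: seg_set_def seg_arc_def)
  then show ?thesis using overlap_same[OF e, of 0 "lb e"] edge_facts[OF e(1)] by auto
next
  assume "wr e = wr e'"
  then have "seg_arc e 0 (lw e) = seg_arc e' 0 (lw e')" using e edge_facts(25) by metis
  then have "seg_arc e 0 (lw e) \<subseteq> seg_set e'" using edge_facts[OF e(2)] by (auto simp: seg_set_def seg_arc_def)
  then show ?thesis using overlap_same[OF e, of 0 "lw e"] edge_facts[OF e(1)] by auto
next
  assume "wl e = wl e'"
  then have "seg_arc e (lb e) (len e) = seg_arc e' (lb e') (len e')" using e edge_facts(23) by metis
  then have "seg_arc e (lb e) (len e) \<subseteq> seg_set e'" using edge_facts[OF e(2)] by (auto simp: seg_set_def seg_arc_def)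
  then show ?thesis using overlap_same[OF e, of "lb e" "len e"] edge_facts[OF e(1)] by auto
qed

text \<open>The sign \<open>c\<close> tells on which side of the two edges \<open>f\<close> lies. By
  convexity each edge points into the half space of the other, but the two products involved are
  negatives of each other, so both vanish.\<close>

lemma same_start_normal:
  assumes e: "e \<in> edges T" "e' \<in> edges T" "start e = start e'" and f: "face f"
    and c: "c = 1 \<or> c = -1" "c *\<^sub>R nrm e \<in> nrms f" "c *\<^sub>R nrm e' \<in> nrms f"
    and s: "0 < s" "seg_arc e 0 s \<subseteq> f" "0 < s'" "seg_arc e' 0 s' \<subseteq> f"
  shows "nrm e = nrm e'"
proof -
  note g = edges_geodesic[OF e(1)] edges_geodesic[OF e(2)]
  have *: "0 \<le> c * (nrm e' \<bullet> dir e)" if e: "e \<in> edges T" "start e = start e'" "geodesic_segment e'"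
    and c: "c *\<^sub>R nrm e' \<in> nrms f" and s: "0 < s" "seg_arc e 0 s \<subseteq> f" for e e' s
  proof -
    define h where "h = min s 1"
    have h: "0 < h" "h \<le> s" "h < pi" using s pi_gt3 by (auto simp: h_def)
    then have "seg_point e h \<in> f" using s by (auto simp: seg_arc_def)
    then have "0 \<le> (c *\<^sub>R nrm e') \<bullet> seg_point e h" using c by (auto simp: nrms_def closed_hemisphere_def)
    also have "\<dots> = sin h * (c * (nrm e' \<bullet> dir e))"
      using e geodesic_segmentD(6)[OF e(3)] by (simp add: seg_point_def inner_right_distrib)
    finally show ?thesis using h sin_gt_zero[of h] by (simp add: zero_le_mult_iff)
  qed
  have 1: "0 \<le> c * (nrm e' \<bullet> dir e)" using *[OF e(1) e(3) g(2) c(3) s(1,2)] .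
  have 2: "0 \<le> c * (nrm e \<bullet> dir e')" using *[OF e(2) e(3)[symmetric] g(1) c(2) s(3,4)] .
  have "nrm e' \<bullet> dir e = - (nrm e \<bullet> dir e')"
    using e(3) cross_triple[of "start e" "dir e'" "dir e"] cross_skew[of "dir e'" "dir e"] cross_triple[of "start e" "dir e" "dir e'"]
    by (simp add: nrm_def)
  then have "nrm e' \<bullet> dir e = 0" using 1 2 c(1) by auto
  then have "nrm e' = nrm e \<or> nrm e' = - nrm e"
    using geodesic_segmentD[OF g(1)] geodesic_segmentD[OF g(2)] seg_frame(10) g e
    by (intro parallel_unit[of _ _ "start e" "dir e"]) auto
  moreover have "nrm e' \<noteq> - nrm e"
    using opposite_notin_nrms[OF f c(2)] c(3) by auto
  ultimately show ?thesis by simp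
qed

lemma same_start:
  assumes e: "e \<in> edges T" "e' \<in> edges T" "start e = start e'" and f: "bl e = bl e' \<or> wr e = wr e'"
  shows "e = e'"
proof -
  note E = edge_facts[OF e(1)] and E' = edge_facts[OF e(2)]
  have "nrm e = nrm e'" using f
  proof
    assume b: "bl e = bl e'"
    show ?thesis
      by (rule same_start_normal[OF e, of "bl e" 1 "lb e" "lb e'"]) (use b E(1,14,18,22) E'(1,18,22) in auto)
  next
    assume w: "wr e = wr e'"
    show ?thesis
      by (rule same_start_normal[OF e, of "wr e" "-1" "lw e" "lw e'"]) (use w E(3,17,21,25) E'(3,21,25) in auto)
  qed
  then show ?thesis using same_normal e f by blast
qed

text \<open>\<open>start e\<close> is a vertex of \<open>bl e\<close>, so a second side of this face
  contains it. That side cannot start there by \<open>same_start\<close>, nor have the vertex inside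
  by \<open>edge_relint\<close>; so it ends there.\<close>

lemma corner_exists_black:
  assumes e: "e \<in> edges T"
  shows "\<exists>e0\<in>edges T. start e = seg_point e0 (lb e0) \<and> bl e0 = bl e"
proof -
  note E = edge_facts[OF e] and g = edges_geodesic[OF e]
  obtain m where m: "m \<in> nrms (bl e)" "m \<noteq> nrm e" "m \<bullet> start e = 0"
    using edge_end[OF g E(14) E(18) E(22), of 0] E edges_len[OF e] by auto
  have "start e \<in> bl e" using edge_points(1)[OF e, of 0] E by simp
  then obtain e0 t where e0: "e0 \<in> edges T" "m = nrm e0" "bl e = bl e0" "start e = seg_point e0 t" "0 \<le> t" "t \<le> lb e0"
    using black_edge_at[OF E(6) m(1)] m(3) by metis
  have "t \<noteq> 0" using same_start[OF e e0(1)] e0 m by auto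
  moreover have "\<not> t < lb e0"
  proof
    assume "t < lb e0"
    then have "nrm e = nrm e0" using edge_relint[OF edges_geodesic[OF e0(1)] E(14), of 0 "lb e0" t "nrm e"] e0
      edge_facts[OF e0(1)] E \<open>t \<noteq> 0\<close> geodesic_segmentD(6)[OF g] by auto
    then show False using m e0 by simp
  qed
  ultimately show ?thesis using e0 by (intro bexI[of _ e0]) auto
qed

text \<open>The point \<open>y\<close> where the left side of \<open>e0\<close> turns white is
  inside \<open>e0\<close>, hence inside no other edge. The second side of the black face at
  \<open>y\<close> therefore begins there, on an edge \<open>e\<close>. The second side at
  \<open>y\<close> of the white face on the right of \<open>e\<close> does not begin there, so it
  lies on \<open>e0\<close>, and this white face is \<open>wl e0\<close>.\<close>

lemma corner_next:
  assumes e0: "e0 \<in> edges T"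
  shows "\<exists>e\<in>edges T. start e = seg_point e0 (lb e0) \<and> bl e = bl e0 \<and> wr e = wl e0"
proof -
  note E0 = edge_facts[OF e0] and g0 = edges_geodesic[OF e0]
  define y where "y = seg_point e0 (lb e0)"
  have yint: "y \<in> seg_interior e0" unfolding y_def using E0 by (intro seg_interiorI) auto
  obtain m where m: "m \<in> nrms (bl e0)" "m \<noteq> nrm e0" "m \<bullet> y = 0"
    using edge_end[OF g0 E0(14) E0(18) E0(22), of "lb e0"] E0 edges_len[OF e0] by (auto simp: y_def)
  have "y \<in> bl e0" using edge_points(1)[OF e0] E0 by (simp add: y_def)
  then obtain e t where e: "e \<in> edges T" "m = nrm e" "bl e0 = bl e" "y = seg_point e t" "0 \<le> t" "t \<le> lb e"
    using black_edge_at[OF E0(6) m(1)] m(3) by metis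
  note E = edge_facts[OF e(1)] and g = edges_geodesic[OF e(1)]
  have ne: "nrm e \<noteq> nrm e0" "nrm e \<noteq> - nrm e0" using m e opposite_notin_nrms[OF E0(14) E0(18)] by auto
  have "t = 0"
  proof (rule ccontr)
    assume "t \<noteq> 0"
    then have "y \<in> seg_interior e" using e E by (auto intro: seg_interiorI)
    then have "e = e0 \<or> e = seg_rev e0" using edges_cross[OF e0 e(1) yint] by auto
    then show False using ne g0 by auto
  qed
  then have st: "start e = y" using e by simp
  have neg: "- nrm e \<in> nrms (wr e)" "wr e \<inter> {x. nrm e \<bullet> x = 0} = seg_arc e 0 (lw e)" by (fact E)+
  have "\<exists>m'\<in>nrms (wr e). m' \<noteq> - nrm e \<and> m' \<bullet> start e = 0"
  proof -
    have a: "wr e \<inter> {x. nrm (seg_rev e) \<bullet> x = 0} = seg_arc (seg_rev e) (lb e) (len e)"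
      using neg(2) by (simp add: nrm_rev[OF g] seg_arc_rev lw_def)
    have "lb e < len e" "len e < lb e + 2 * pi" using E(1,2) edges_len[OF e(1)] by linarith+
    then have "\<exists>m'\<in>nrms (wr e). m' \<noteq> nrm (seg_rev e) \<and> m' \<bullet> seg_point (seg_rev e) (len e) = 0"
      using edge_end[OF geodesic_rev[OF g] E(17) _ a] neg(1) nrm_rev[OF g] by simp
    then show ?thesis by (simp add: nrm_rev[OF g] seg_point_rev)
  qed
  then obtain m' where m': "m' \<in> nrms (wr e)" "m' \<noteq> - nrm e" "m' \<bullet> start e = 0" by blast
  have "start e \<in> wr e" using edge_points(3)[OF e(1), of 0] E by simp
  then obtain e4 s where e4: "e4 \<in> edges T" "m' = - nrm e4" "wr e = wr e4" "start e = seg_point e4 s" "0 \<le> s" "s \<le> lw e4"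
    using white_edge_at[OF E(9) m'(1)] m'(3) by metis
  have "s \<noteq> 0" using same_start[OF e(1) e4(1)] e4 m' by auto
  then have "y \<in> seg_interior e4" using e4 st edge_facts[OF e4(1)] by (auto intro: seg_interiorI)
  then have "e4 = e0 \<or> e4 = seg_rev e0" using edges_cross[OF e0 e4(1) yint] by auto
  \<comment> \<open>Otherwise the initial piece of \<open>e\<close> would lie both in a face on the
    left and in a face on the right of \<open>e0\<close>, hence on the circle of
    \<open>e0\<close>.\<close>
  moreover have "e4 \<noteq> e0"
  proof
    assume "e4 = e0"
    define h where "h = min (min (lb e) (lw e)) 1"
    have h: "0 < h" "h \<le> lb e" "h \<le> lw e" "h < pi" using E pi_gt3 by (auto simp: h_def)
    then have "seg_point e h \<in> bl e0" "seg_point e h \<in> wr e0"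
      using edge_points(1,3)[OF e(1), of h] e e4 \<open>e4 = e0\<close> by auto
    then have "0 \<le> nrm e0 \<bullet> seg_point e h" "0 \<le> - nrm e0 \<bullet> seg_point e h"
      using E0(18,21) by (auto simp: nrms_def closed_hemisphere_def)
    then have "nrm e0 \<bullet> seg_point e h = 0" by simp
    moreover have "nrm e0 \<bullet> seg_point e h = sin h * (nrm e0 \<bullet> dir e)"
      using seg_frame(4)[OF g0, of "lb e0"] st by (simp add: seg_point_def[of e] inner_right_distrib y_def)
    ultimately have "nrm e0 \<bullet> dir e = 0" using h sin_gt_zero[of h] by simp
    then have "nrm e = nrm e0 \<or> nrm e = - nrm e0"
      using geodesic_segmentD[OF g] seg_frame[OF g0] seg_frame(10)[OF g] st
      by (intro parallel_unit[of _ _ "start e" "dir e"]) (auto simp: y_def)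
    then show False using ne by auto
  qed
  ultimately have "e4 = seg_rev e0" by simp
  then have "wr e = wl e0" using e4 e0 wr_rev by simp
  then show ?thesis using e st by (auto simp: y_def)
qed

text \<open>At the point where the left side of \<open>e0\<close> changes from black to white, an edge \<open>e\<close> leaves to the left.\<close>
definition corner :: "seg \<Rightarrow> seg \<Rightarrow> bool" where
  "corner e0 e \<longleftrightarrow> e0 \<in> edges T \<and> e \<in> edges T \<and> start e = seg_point e0 (lb e0) \<and> bl e0 = bl e \<and> wl e0 = wr e"

lemma corner_from: "e0 \<in> edges T \<Longrightarrow> \<exists>e. corner e0 e"
  using corner_next[of e0] unfolding corner_def by auto

text \<open>The preceding side of \<open>bl e\<close> ends at \<open>start e\<close>; the edge that
  leaves at its corner has the same start and the same black face as \<open>e\<close>, so it is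
  \<open>e\<close>. In particular every vertex is inside some edge.\<close>

lemma corner_to:
  assumes e: "e \<in> edges T" shows "\<exists>e0. corner e0 e"
proof -
  obtain e0 where e0: "e0 \<in> edges T" "start e = seg_point e0 (lb e0)" "bl e0 = bl e"
    using corner_exists_black[OF e] by blast
  obtain e' where "corner e0 e'" using corner_from e0 by blast
  then have "e' \<in> edges T" "start e' = start e" "bl e' = bl e" using e0 by (simp_all add: corner_def)
  then have "e' = e" using same_start[of e' e] e by blast
  then show ?thesis using \<open>corner e0 e'\<close> by blast
qed

lemma corner_interior: "corner e0 e \<Longrightarrow> start e \<in> seg_interior e0"
  using edge_facts by (auto simp: corner_def intro: seg_interiorI)

lemma corner_neq:
  assumes c: "corner e0 e" shows "nrm e \<noteq> nrm e0" "nrm e \<noteq> - nrm e0"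
proof -
  have e: "e0 \<in> edges T" "e \<in> edges T" "start e = seg_point e0 (lb e0)" "bl e0 = bl e" using c by (auto simp: corner_def)
  show "nrm e \<noteq> nrm e0"
  proof
    assume "nrm e = nrm e0"
    then have "e = e0" using same_normal e by blast
    then have "seg_point e 0 = seg_point e (lb e)" using e by simp
    then have "0 = lb e" by (rule seg_point_inj[OF edges_geodesic[OF e(2)]])
      (use edge_facts[OF e(2)] edges_len[OF e(2)] in auto)
    then show False using edge_facts[OF e(2)] by simp
  qed
  show "nrm e \<noteq> - nrm e0" using opposite_notin_nrms edge_facts(14,18) e by metis
qed

text \<open>An active normal at the vertex comes from an edge that starts there, which is
  \<open>e\<close> by \<open>same_start\<close>, or that has the vertex inside, which is
  \<open>e0\<close> because edges do not cross.\<close>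

lemma corner_nrms_black:
  assumes c: "corner e0 e" and m: "m \<in> nrms (bl e)" "m \<bullet> start e = 0"
  shows "m = nrm e \<or> m = nrm e0"
proof -
  have e: "e0 \<in> edges T" "e \<in> edges T" "start e = seg_point e0 (lb e0)" "bl e0 = bl e" using c by (auto simp: corner_def)
  note E = edge_facts[OF e(2)] and E0 = edge_facts[OF e(1)]
  have "start e \<in> bl e" using edge_points(1)[OF e(2), of 0] E by simp
  then obtain e5 t where e5: "e5 \<in> edges T" "m = nrm e5" "bl e = bl e5" "start e = seg_point e5 t" "0 \<le> t" "t \<le> lb e5"
    using black_edge_at[OF E(6) m(1)] m(2) by metis
  show ?thesis
  proof (cases "t = 0")
    case True
    then show ?thesis using same_start[OF e(2) e5(1)] e5 by auto
  next
    case False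
    then have "start e \<in> seg_interior e5" using e5 edge_facts[OF e5(1)] by (auto intro: seg_interiorI)
    then have "e5 = e0 \<or> e5 = seg_rev e0" using edges_cross[OF e(1) e5(1) corner_interior[OF c]] by auto
    moreover have "nrm e5 \<noteq> - nrm e0" using opposite_notin_nrms[OF E0(14) E0(18)] e5 m e by auto
    ultimately show ?thesis using e5 e edges_geodesic by auto
  qed
qed

lemma corner_nrms_white:
  assumes c: "corner e0 e" and m: "m \<in> nrms (wr e)" "m \<bullet> start e = 0"
  shows "m = - nrm e \<or> m = nrm e0"
proof -
  have e: "e0 \<in> edges T" "e \<in> edges T" "start e = seg_point e0 (lb e0)" "wl e0 = wr e" using c by (auto simp: corner_def)
  note E = edge_facts[OF e(2)] and E0 = edge_facts[OF e(1)]
  have "start e \<in> wr e" using edge_points(3)[OF e(2), of 0] E by simp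
  then obtain e5 t where e5: "e5 \<in> edges T" "m = - nrm e5" "wr e = wr e5" "start e = seg_point e5 t" "0 \<le> t" "t \<le> lw e5"
    using white_edge_at[OF E(9) m(1)] m(2) by metis
  show ?thesis
  proof (cases "t = 0")
    case True
    then show ?thesis using same_start[OF e(2) e5(1)] e5 by auto
  next
    case False
    then have "start e \<in> seg_interior e5" using e5 edge_facts[OF e5(1)] by (auto intro: seg_interiorI)
    then have "e5 = e0 \<or> e5 = seg_rev e0" using edges_cross[OF e(1) e5(1) corner_interior[OF c]] by auto
    moreover have "- nrm e5 \<noteq> - nrm e0" using opposite_notin_nrms[OF E0(15) E0(19)] e5 m e by auto
    ultimately show ?thesis using e5 e edges_geodesic by auto
  qed
qed

lemma corner_local:
  assumes c: "corner e0 e"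
  shows "\<forall>\<^sub>F x in nhds (start e).
     (x \<in> fcone (bl e) \<longleftrightarrow> 0 \<le> nrm e0 \<bullet> x \<and> 0 \<le> nrm e \<bullet> x) \<and> (x \<in> fint (bl e) \<longleftrightarrow> 0 < nrm e0 \<bullet> x \<and> 0 < nrm e \<bullet> x) \<and>
     (x \<in> fcone (wr e) \<longleftrightarrow> 0 \<le> nrm e0 \<bullet> x \<and> nrm e \<bullet> x \<le> 0) \<and> (x \<in> fint (wr e) \<longleftrightarrow> 0 < nrm e0 \<bullet> x \<and> nrm e \<bullet> x < 0)"
proof -
  have e: "e0 \<in> edges T" "e \<in> edges T" "start e = seg_point e0 (lb e0)" "bl e0 = bl e" "wl e0 = wr e" using c by (auto simp: corner_def)
  note E = edge_facts[OF e(2)] and E0 = edge_facts[OF e(1)]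
  have z: "nrm e0 \<bullet> start e = 0" "nrm e \<bullet> start e = 0"
    using seg_frame(4)[OF edges_geodesic[OF e(1)], of "lb e0"] geodesic_segmentD(6)[OF edges_geodesic[OF e(2)]] e by simp_all
  have "start e \<in> bl e" "start e \<in> wr e" using edge_points(1,3)[OF e(2), of 0] E by simp_all
  then have y: "start e \<in> fcone (bl e)" "start e \<in> fcone (wr e)" using face_cone E by blast+
  have b: "m \<in> nrms (bl e) \<and> m \<bullet> start e = 0 \<longleftrightarrow> m = nrm e \<or> m = nrm e0" for m
    using corner_nrms_black[OF c, of m] E E0 e z by auto
  have w: "m \<in> nrms (wr e) \<and> m \<bullet> start e = 0 \<longleftrightarrow> m = - nrm e \<or> m = nrm e0" for m
    using corner_nrms_white[OF c, of m] E E0 e z by auto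
  from face_local[OF E(14) y(1)] face_local[OF E(17) y(2)] show ?thesis
  proof eventually_elim
    case (elim x)
    have "(\<forall>m\<in>nrms (bl e). m \<bullet> start e = 0 \<longrightarrow> Q m) \<longleftrightarrow> Q (nrm e0) \<and> Q (nrm e)"
      "(\<forall>m\<in>nrms (wr e). m \<bullet> start e = 0 \<longrightarrow> Q m) \<longleftrightarrow> Q (nrm e0) \<and> Q (- nrm e)" for Q
      subgoal by (metis b)
      subgoal by (metis w)
      done
    then have "(\<forall>m\<in>nrms (bl e). m \<bullet> start e = 0 \<longrightarrow> 0 \<le> m \<bullet> x) \<longleftrightarrow> 0 \<le> nrm e0 \<bullet> x \<and> 0 \<le> nrm e \<bullet> x"
      "(\<forall>m\<in>nrms (bl e). m \<bullet> start e = 0 \<longrightarrow> 0 < m \<bullet> x) \<longleftrightarrow> 0 < nrm e0 \<bullet> x \<and> 0 < nrm e \<bullet> x"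
      "(\<forall>m\<in>nrms (wr e). m \<bullet> start e = 0 \<longrightarrow> 0 \<le> m \<bullet> x) \<longleftrightarrow> 0 \<le> nrm e0 \<bullet> x \<and> nrm e \<bullet> x \<le> 0"
      "(\<forall>m\<in>nrms (wr e). m \<bullet> start e = 0 \<longrightarrow> 0 < m \<bullet> x) \<longleftrightarrow> 0 < nrm e0 \<bullet> x \<and> nrm e \<bullet> x < 0"
      by simp_all
    then show ?case using elim by simp
  qed
qed

lemma edge_local:
  assumes e: "e \<in> edges T" and f: "f = bl e \<and> 0 < t \<and> t < lb e \<or> f = wl e \<and> lb e < t \<and> t < len e"
  shows "\<forall>\<^sub>F x in nhds (seg_point e t). (x \<in> fcone f \<longleftrightarrow> 0 \<le> nrm e \<bullet> x) \<and> (x \<in> fint f \<longleftrightarrow> 0 < nrm e \<bullet> x)"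
proof -
  note E = edge_facts[OF e] and g = edges_geodesic[OF e]
  have ff: "face f" "nrm e \<in> nrms f" "seg_point e t \<in> f" using f E edge_points(1,2)[OF e, of t] by auto
  then have c: "seg_point e t \<in> fcone f" using face_cone by blast
  have "m = nrm e" if "m \<in> nrms f" "m \<bullet> seg_point e t = 0" for m
    using f
  proof
    assume f: "f = bl e \<and> 0 < t \<and> t < lb e"
    show ?thesis using edge_relint[OF g E(14) E(18), of 0 "lb e" t m] f E that by auto
  next
    assume f: "f = wl e \<and> lb e < t \<and> t < len e"
    show ?thesis using edge_relint[OF g E(15) E(19), of "lb e" "len e" t m] f E that by auto
  qed
  then have *: "m \<in> nrms f \<and> m \<bullet> seg_point e t = 0 \<longleftrightarrow> m = nrm e" for m
    using seg_frame(4)[OF g] ff(2) by metis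
  from face_local[OF ff(1) c] show ?thesis
  proof eventually_elim
    case (elim x)
    have "(\<forall>m\<in>nrms f. m \<bullet> seg_point e t = 0 \<longrightarrow> Q m) \<longleftrightarrow> Q (nrm e)" for Q
      by (metis *)
    then show ?case using elim by simp
  qed
qed

end

subsection \<open>Gluing local data over the sphere\<close>

lemma rotation_cancel:
  assumes "rotation_matrix A"
  shows "B ** A ** rinv A = B" "B ** rinv A ** A = B" "A ** (rinv A ** B) = B" "rinv A ** (A ** B) = B"
  by (simp_all add: matrix_mul_assoc[symmetric] rotation_transpose[OF assms])
    (simp_all add: matrix_mul_assoc rotation_transpose[OF assms])

lemma rinv_mult: "rinv (A ** B) = rinv B ** rinv A"
  by (simp add: rinv_def matrix_transpose_mul)

lemma ratio_mult:
  fixes A :: "real^3^3"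
  assumes "rotation_matrix P"
  shows "A ** P ** rinv (B ** P) = A ** rinv B"
  using rotation_cancel(1)[OF assms, of A] by (simp add: rinv_mult matrix_mul_assoc)

text \<open>
  The matrices \<open>c y y'\<close> are transition functions from a small neighbourhood of \<open>y\<close> to \<open>y\<close>.  The
  sphere is simply connected, hence they are a coboundary.
\<close>
locale transition =
  fixes c :: "real^3 \<Rightarrow> real^3 \<Rightarrow> real^3^3"
  assumes c_rotation: "rotation_matrix (c y y')"
    and c_cocycle: "y \<in> S2 \<Longrightarrow>
      \<forall>\<^sub>F y' in nhds y. y' \<in> S2 \<longrightarrow> (\<forall>\<^sub>F y'' in nhds y'. y'' \<in> S2 \<longrightarrow> c y y'' = c y y' ** c y' y'')"
begin

text \<open>For nearby points of \<open>K\<close>, \<open>c y y'\<close> is the inverse of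
  \<open>X y\<close> times \<open>X y'\<close>; that is, \<open>c\<close> is the coboundary of
  \<open>X\<close> on \<open>K\<close>.\<close>

definition trivialises :: "(real^3) set \<Rightarrow> (real^3 \<Rightarrow> real^3^3) \<Rightarrow> bool" where
  "trivialises K X \<longleftrightarrow> (\<forall>y. rotation_matrix (X y)) \<and>
     (\<forall>y\<in>K. \<forall>\<^sub>F y' in nhds y. y' \<in> K \<longrightarrow> X y' = X y ** c y y')"

definition trivial :: "(real^3) set \<Rightarrow> bool" where
  "trivial K \<longleftrightarrow> (\<exists>X. trivialises K X)"

text \<open>The cocycle condition at \<open>y\<close> says that \<open>c y\<close> itself is a
  solution near \<open>y\<close>.\<close>

lemma trivial_local:
  assumes y: "y \<in> S2"
  shows "\<exists>U. open U \<and> y \<in> U \<and> (\<forall>K. K \<subseteq> U \<inter> S2 \<longrightarrow> trivial K)"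
proof -
  obtain U where U: "open U" "y \<in> U"
    "\<And>y'. y' \<in> U \<Longrightarrow> y' \<in> S2 \<longrightarrow> (\<forall>\<^sub>F y'' in nhds y'. y'' \<in> S2 \<longrightarrow> c y y'' = c y y' ** c y' y'')"
    using c_cocycle[OF y] by (auto simp: eventually_nhds)
  have "trivialises K (c y)" if K: "K \<subseteq> U \<inter> S2" for K
    unfolding trivialises_def
  proof (intro conjI allI ballI)
    fix y' assume "y' \<in> K"
    then have "\<forall>\<^sub>F y'' in nhds y'. y'' \<in> S2 \<longrightarrow> c y y'' = c y y' ** c y' y''" using U(3) K by blast
    then show "\<forall>\<^sub>F y'' in nhds y'. y'' \<in> K \<longrightarrow> c y y'' = c y y' ** c y' y''"
      by eventually_elim (use K in auto)
  qed (rule c_rotation)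
  then show ?thesis using U unfolding trivial_def by blast
qed

text \<open>On the overlap the factor \<open>c\<close> cancels in the ratio of the two solutions,
  which is thus locally constant and, by connectedness, constant; multiplying one solution by it
  makes the two agree. Closedness ensures that a point outside one of the sets has a neighbourhood
  outside it.\<close>

lemma trivial_glue:
  assumes A: "closed A" "trivial A" and B: "closed B" "trivial B" and con: "connected (A \<inter> B)"
  shows "trivial (A \<union> B)"
proof -
  obtain X Y where X: "trivialises A X" and Y: "trivialises B Y" using A B trivial_def by blast
  have rX: "rotation_matrix (X y)" and rY: "rotation_matrix (Y y)" for y using X Y by (auto simp: trivialises_def)
  define g where "g y = X y ** rinv (Y y)" for y
  have gc: "g y = g y'" if "y \<in> A \<inter> B" "y' \<in> A \<inter> B" for y y'
  proof (rule connected_local_const[OF con that], intro ballI)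
    fix a assume a: "a \<in> A \<inter> B"
    have "\<forall>\<^sub>F b in nhds a. b \<in> A \<longrightarrow> X b = X a ** c a b" "\<forall>\<^sub>F b in nhds a. b \<in> B \<longrightarrow> Y b = Y a ** c a b"
      using X Y a by (auto simp: trivialises_def)
    then have "\<forall>\<^sub>F b in nhds a. b \<in> A \<inter> B \<longrightarrow> g a = g b"
      by eventually_elim (auto simp: g_def ratio_mult[OF c_rotation])
    then show "\<forall>\<^sub>F b in at a within A \<inter> B. g a = g b"
      by (auto simp: eventually_at_filter elim: eventually_mono)
  qed
  obtain G where G: "rotation_matrix G" "\<And>y. y \<in> A \<inter> B \<Longrightarrow> g y = G"
  proof (cases "A \<inter> B = {}")
    case True
    then show ?thesis using that[of "mat 1"] by simp
  next
    case False
    then obtain y where y: "y \<in> A \<inter> B" by blast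
    show ?thesis
    proof (rule that[of "g y"])
      show "rotation_matrix (g y)" unfolding g_def using rX rY rotation_mult rotation_transpose(1) by blast
    qed (use gc y in blast)
  qed
  have XG: "X y = G ** Y y" if "y \<in> A \<inter> B" for y
    using G(2)[OF that] rotation_cancel(2)[OF rY, of "X y" y] by (simp add: g_def)
  define Z where "Z y = (if y \<in> A then X y else G ** Y y)" for y
  have ZB: "Z y = G ** Y y" if "y \<in> B" for y using XG that by (auto simp: Z_def)
  have ZA: "Z y = X y" if "y \<in> A" for y using that by (auto simp: Z_def)
  have "\<forall>\<^sub>F y' in nhds y. y' \<in> A \<union> B \<longrightarrow> Z y' = Z y ** c y y'" if y: "y \<in> A \<union> B" for y
  proof -
    have "\<forall>\<^sub>F y' in nhds y. y' \<in> A \<longrightarrow> Z y' = Z y ** c y y'"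
    proof (cases "y \<in> A")
      case True
      then have "\<forall>\<^sub>F y' in nhds y. y' \<in> A \<longrightarrow> X y' = X y ** c y y'" using X by (simp add: trivialises_def)
      then show ?thesis by eventually_elim (use ZA True in auto)
    next
      case False
      then have "\<forall>\<^sub>F y' in nhds y. y' \<in> - A" using A(1) by (intro eventually_nhds_in_open) auto
      then show ?thesis by eventually_elim auto
    qed
    moreover have "\<forall>\<^sub>F y' in nhds y. y' \<in> B \<longrightarrow> Z y' = Z y ** c y y'"
    proof (cases "y \<in> B")
      case True
      then have "\<forall>\<^sub>F y' in nhds y. y' \<in> B \<longrightarrow> Y y' = Y y ** c y y'" using Y by (simp add: trivialises_def)
      then show ?thesis by eventually_elim (use ZB True in \<open>auto simp: matrix_mul_assoc\<close>)
    next
      case False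
      then have "\<forall>\<^sub>F y' in nhds y. y' \<in> - B" using B(1) by (intro eventually_nhds_in_open) auto
      then show ?thesis by eventually_elim auto
    qed
    ultimately show ?thesis by eventually_elim auto
  qed
  moreover have "rotation_matrix (Z y)" for y
    using rX rY G(1) rotation_mult by (auto simp: Z_def)
  ultimately show ?thesis unfolding trivial_def trivialises_def by blast
qed

section \<open>Triviality over hemispheres, by subdivision of the disk below them\<close>

definition patch :: "real \<Rightarrow> real \<Rightarrow> real \<Rightarrow> real \<Rightarrow> real \<Rightarrow> (real^3) set" where
  "patch \<sigma> a b p q = {x \<in> S2. 0 \<le> \<sigma> * x$3 \<and> a \<le> x$1 \<and> x$1 \<le> b \<and> p \<le> x$2 \<and> x$2 \<le> q}"

text \<open>A hemisphere as a graph over the unit disk. Outside the disk the formula is still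
  continuous, with values off the sphere.\<close>

definition lift :: "real \<Rightarrow> real \<Rightarrow> real \<Rightarrow> real^3" where
  "lift \<sigma> s t = vector [s, t, \<sigma> * sqrt (1 - s\<^sup>2 - t\<^sup>2)]"

lemma S2_components: "x \<in> S2 \<longleftrightarrow> (x$1)\<^sup>2 + (x$2)\<^sup>2 + (x$3)\<^sup>2 = 1" for x :: "real^3"
  by (simp add: norm_1_inner inner_vec_def sum_3 power2_eq_square)

lemma lift_eq:
  assumes s: "\<sigma> = 1 \<or> \<sigma> = -1" and x: "x \<in> S2" "0 \<le> \<sigma> * x$3"
  shows "x = lift \<sigma> (x$1) (x$2)"
proof -
  have "1 - (x$1)\<^sup>2 - (x$2)\<^sup>2 = (\<sigma> * x$3)\<^sup>2" using x S2_components[of x] s by auto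
  then have "sqrt (1 - (x$1)\<^sup>2 - (x$2)\<^sup>2) = \<sigma> * x$3" using x by simp
  then have "x$3 = \<sigma> * sqrt (1 - (x$1)\<^sup>2 - (x$2)\<^sup>2)" using s by auto
  then show ?thesis by (simp add: lift_def vec_eq_iff forall_3)
qed

lemma lift_in:
  assumes s: "\<sigma> = 1 \<or> \<sigma> = -1" and le: "s\<^sup>2 + t\<^sup>2 \<le> 1"
  shows "lift \<sigma> s t \<in> S2" "0 \<le> \<sigma> * (lift \<sigma> s t)$3" "(lift \<sigma> s t)$1 = s" "(lift \<sigma> s t)$2 = t"
  using s le by (auto simp: S2_components[unfolded mem_sphere_0] lift_def power_mult_distrib)

lemma lift_continuous: "continuous_on A (\<lambda>z. lift \<sigma> (fst z) (snd z))"
proof -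
  have "lift \<sigma> s t = s *\<^sub>R axis 1 1 + t *\<^sub>R axis 2 1 + (\<sigma> * sqrt (1 - s\<^sup>2 - t\<^sup>2)) *\<^sub>R axis 3 1" for s t
    by (simp add: lift_def vec_eq_iff forall_3 axis_def)
  then show ?thesis by (simp only:) (intro continuous_intros)
qed

lemma closed_patch: "closed (patch \<sigma> a b p q)"
proof -
  have "patch \<sigma> a b p q = S2 \<inter> {x. 0 \<le> \<sigma> * x$3} \<inter> {x. a \<le> x$1} \<inter> {x. x$1 \<le> b} \<inter> {x. p \<le> x$2} \<inter> {x. x$2 \<le> q}"
    by (auto simp: patch_def)
  also have "closed \<dots>"
    by (intro closed_Int closed_sphere closed_Collect_le continuous_intros)
  finally show ?thesis .
qed

lemma convex_chord: "convex {t::real. p \<le> t \<and> t \<le> q \<and> s\<^sup>2 + t\<^sup>2 \<le> 1}"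
proof -
  have "{t::real. p \<le> t \<and> t \<le> q \<and> s\<^sup>2 + t\<^sup>2 \<le> 1} = {p..q} \<inter> {- sqrt (1 - s\<^sup>2)..sqrt (1 - s\<^sup>2)} \<inter> {t. s\<^sup>2 \<le> 1}"
  proof -
    have "s\<^sup>2 + t\<^sup>2 \<le> 1 \<longleftrightarrow> s\<^sup>2 \<le> 1 \<and> \<bar>t\<bar> \<le> sqrt (1 - s\<^sup>2)" for t
    proof
      assume h: "s\<^sup>2 + t\<^sup>2 \<le> 1"
      then have "sqrt (t\<^sup>2) \<le> sqrt (1 - s\<^sup>2)" by (intro real_sqrt_le_mono) simp
      moreover have "s\<^sup>2 \<le> 1" using h by (smt (verit) zero_le_power2)
      ultimately show "s\<^sup>2 \<le> 1 \<and> \<bar>t\<bar> \<le> sqrt (1 - s\<^sup>2)" by simp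
    next
      assume h: "s\<^sup>2 \<le> 1 \<and> \<bar>t\<bar> \<le> sqrt (1 - s\<^sup>2)"
      then have "\<bar>t\<bar>\<^sup>2 \<le> (sqrt (1 - s\<^sup>2))\<^sup>2" by (intro power_mono) auto
      then show "s\<^sup>2 + t\<^sup>2 \<le> 1" using h by simp
    qed
    then have *: "s\<^sup>2 + t\<^sup>2 \<le> 1 \<longleftrightarrow> s\<^sup>2 \<le> 1 \<and> - sqrt (1 - s\<^sup>2) \<le> t \<and> t \<le> sqrt (1 - s\<^sup>2)" for t
      using abs_le_iff[of t] by (metis minus_le_iff)
    show ?thesis unfolding * by (rule set_eqI) (simp add: conj_ac)
  qed
  moreover have "convex ({p..q} \<inter> {- sqrt (1 - s\<^sup>2)..sqrt (1 - s\<^sup>2)} \<inter> {t. s\<^sup>2 \<le> 1})"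
    by (intro convex_Int convex_real_interval) (simp add: convex_def)
  ultimately show ?thesis by simp
qed

text \<open>These are the common sides of neighbouring patches: graphs over chords of the disk,
  possibly empty.\<close>

lemma connected_patch_line:
  assumes s: "\<sigma> = 1 \<or> \<sigma> = -1"
  shows "connected (patch \<sigma> a a p q)" "connected (patch \<sigma> a b p p)"
proof -
  have eq: "patch \<sigma> a a p q = (\<lambda>z. lift \<sigma> (fst z) (snd z)) ` Pair a ` {t. p \<le> t \<and> t \<le> q \<and> a\<^sup>2 + t\<^sup>2 \<le> 1}"
  proof (intro set_eqI iffI)
    fix x assume x: "x \<in> patch \<sigma> a a p q"
    then have "x = lift \<sigma> a (x$2)" using lift_eq[OF s, of x] by (auto simp: patch_def)
    moreover have "p \<le> x$2 \<and> x$2 \<le> q \<and> a\<^sup>2 + (x$2)\<^sup>2 \<le> 1"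
      using x S2_components[of x] by (auto simp: patch_def) (smt (verit) zero_le_power2)
    ultimately show "x \<in> (\<lambda>z. lift \<sigma> (fst z) (snd z)) ` Pair a ` {t. p \<le> t \<and> t \<le> q \<and> a\<^sup>2 + t\<^sup>2 \<le> 1}"
      by (auto simp: image_image)
  qed (use lift_in[OF s] in \<open>auto simp: patch_def\<close>)
  have con: "connected (Pair a ` {t. p \<le> t \<and> t \<le> q \<and> a\<^sup>2 + t\<^sup>2 \<le> 1})"
    by (intro connected_continuous_image continuous_intros convex_connected convex_chord)
  show "connected (patch \<sigma> a a p q)"
    unfolding eq by (rule connected_continuous_image[OF lift_continuous con])
  have eq': "patch \<sigma> a b p p = (\<lambda>z. lift \<sigma> (fst z) (snd z)) ` (\<lambda>t. (t, p)) ` {t. a \<le> t \<and> t \<le> b \<and> p\<^sup>2 + t\<^sup>2 \<le> 1}"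
  proof (intro set_eqI iffI)
    fix x assume x: "x \<in> patch \<sigma> a b p p"
    then have "x = lift \<sigma> (x$1) p" using lift_eq[OF s, of x] by (auto simp: patch_def)
    moreover have "a \<le> x$1 \<and> x$1 \<le> b \<and> p\<^sup>2 + (x$1)\<^sup>2 \<le> 1"
      using x S2_components[of x] by (auto simp: patch_def) (smt (verit) zero_le_power2)
    ultimately show "x \<in> (\<lambda>z. lift \<sigma> (fst z) (snd z)) ` (\<lambda>t. (t, p)) ` {t. a \<le> t \<and> t \<le> b \<and> p\<^sup>2 + t\<^sup>2 \<le> 1}"
      by (auto simp: image_image)
  qed (use lift_in[OF s, of _ p] in \<open>auto simp: patch_def add.commute\<close>)
  have con': "connected ((\<lambda>t. (t, p)) ` {t. a \<le> t \<and> t \<le> b \<and> p\<^sup>2 + t\<^sup>2 \<le> 1})"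
    by (intro connected_continuous_image continuous_intros convex_connected convex_chord)
  show "connected (patch \<sigma> a b p p)"
    unfolding eq' by (rule connected_continuous_image[OF lift_continuous con'])
qed

lemma trivial_small_patch:
  assumes s: "\<sigma> = 1 \<or> \<sigma> = -1"
  shows "\<exists>d>0. \<forall>a b p q. a \<le> s \<and> s \<le> b \<and> b - a < d \<and> p \<le> t \<and> t \<le> q \<and> q - p < d \<longrightarrow> trivial (patch \<sigma> a b p q)"
proof -
  obtain U where U: "open U" "lift \<sigma> s t \<in> U" "\<forall>K. K \<subseteq> U \<inter> S2 \<longrightarrow> trivial K"
  proof (cases "lift \<sigma> s t \<in> S2")
    case True
    then show ?thesis using trivial_local that by blast
  next
    case False
    \<comment> \<open>Outside the disk the small patches are empty, and the complement of the sphere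
      serves as \<open>U\<close>.\<close>
    have "trivial {}" by (auto simp: trivial_def trivialises_def intro!: exI[of _ "\<lambda>_. mat 1"])
    moreover have "K \<subseteq> - S2 \<inter> S2 \<longrightarrow> K = {}" for K :: "(real^3) set" by blast
    moreover have "open (- S2)" using closed_sphere by blast
    ultimately show ?thesis using False that[of "- S2"] by simp
  qed
  have "open ((\<lambda>z. lift \<sigma> (fst z) (snd z)) -` U)"
    by (rule open_vimage[OF U(1) lift_continuous])
  moreover have "(s, t) \<in> (\<lambda>z. lift \<sigma> (fst z) (snd z)) -` U" using U(2) by simp
  ultimately obtain e where e: "e > 0" "ball (s, t) e \<subseteq> (\<lambda>z. lift \<sigma> (fst z) (snd z)) -` U"
    by (rule openE)
  show ?thesis
  proof (intro exI[of _ "e / 2"] conjI allI impI)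
    fix a b p q assume h: "a \<le> s \<and> s \<le> b \<and> b - a < e / 2 \<and> p \<le> t \<and> t \<le> q \<and> q - p < e / 2"
    have "patch \<sigma> a b p q \<subseteq> U \<inter> S2"
    proof
      fix x assume x: "x \<in> patch \<sigma> a b p q"
      then have "\<bar>x$1 - s\<bar> < e / 2" "\<bar>x$2 - t\<bar> < e / 2" using h unfolding patch_def mem_Collect_eq by linarith+
      then have "dist (x$1, x$2) (s, t) < e"
        using sqrt_sum_squares_le_sum_abs[of "x$1 - s" "x$2 - t"] by (simp add: dist_Pair_Pair dist_real_def)
      then have "(x$1, x$2) \<in> ball (s, t) e" by (simp add: dist_commute)
      then have "lift \<sigma> (x$1) (x$2) \<in> U" using e(2) by auto
      then show "x \<in> U \<inter> S2" using lift_eq[OF s, of x] x by (auto simp: patch_def)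
    qed
    then show "trivial (patch \<sigma> a b p q)" using U by blast
  qed (use e in auto)
qed

text \<open>Bisection in each coordinate takes the place of a Lebesgue number. Bisecting the second
  coordinate makes a narrow strip trivial, and bisecting the first then joins the strips. The width
  of the strip belongs to the bisected statement, because joining two pieces takes the smaller of
  their widths.\<close>

lemma trivial_hemisphere:
  assumes s: "\<sigma> = 1 \<or> \<sigma> = -1"
  shows "trivial {x \<in> S2. 0 \<le> \<sigma> * x$3}"
proof -
  have inner: "\<exists>d>0. \<forall>a b. a \<le> s \<and> s \<le> b \<and> b - a < d \<longrightarrow> trivial (patch \<sigma> a b (-1) 1)" for s
  proof (rule Bolzano[of "-1" 1 "\<lambda>p q. \<exists>d>0. \<forall>a b. a \<le> s \<and> s \<le> b \<and> b - a < d \<longrightarrow> trivial (patch \<sigma> a b p q)"])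
    fix p q r :: real
    assume "\<exists>d>0. \<forall>a b. a \<le> s \<and> s \<le> b \<and> b - a < d \<longrightarrow> trivial (patch \<sigma> a b p q)"
      "\<exists>d>0. \<forall>a b. a \<le> s \<and> s \<le> b \<and> b - a < d \<longrightarrow> trivial (patch \<sigma> a b q r)" and pqr: "p \<le> q" "q \<le> r"
    then obtain d d' where d: "d > 0" "\<And>a b. a \<le> s \<Longrightarrow> s \<le> b \<Longrightarrow> b - a < d \<Longrightarrow> trivial (patch \<sigma> a b p q)"
      "d' > 0" "\<And>a b. a \<le> s \<Longrightarrow> s \<le> b \<Longrightarrow> b - a < d' \<Longrightarrow> trivial (patch \<sigma> a b q r)" by blast
    show "\<exists>d>0. \<forall>a b. a \<le> s \<and> s \<le> b \<and> b - a < d \<longrightarrow> trivial (patch \<sigma> a b p r)"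
    proof (intro exI[of _ "min d d'"] conjI allI impI)
      fix a b assume h: "a \<le> s \<and> s \<le> b \<and> b - a < min d d'"
      have u: "patch \<sigma> a b p r = patch \<sigma> a b p q \<union> patch \<sigma> a b q r" using pqr by (auto simp: patch_def)
      have i: "patch \<sigma> a b p q \<inter> patch \<sigma> a b q r = patch \<sigma> a b q q" using pqr by (auto simp: patch_def)
      show "trivial (patch \<sigma> a b p r)" unfolding u
        by (rule trivial_glue) (use d h i connected_patch_line[OF s] closed_patch in auto)
    qed (use d in auto)
  next
    fix t :: real
    obtain d where "d > 0" "\<forall>a b p q. a \<le> s \<and> s \<le> b \<and> b - a < d \<and> p \<le> t \<and> t \<le> q \<and> q - p < d \<longrightarrow> trivial (patch \<sigma> a b p q)"
      using trivial_small_patch[OF s] by blast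
    then show "\<exists>d>0. \<forall>p q. p \<le> t \<and> t \<le> q \<and> q - p < d \<longrightarrow>
        (\<exists>d>0. \<forall>a b. a \<le> s \<and> s \<le> b \<and> b - a < d \<longrightarrow> trivial (patch \<sigma> a b p q))" by blast
  qed auto
  have "trivial (patch \<sigma> (-1) 1 (-1) 1)"
  proof (rule Bolzano[of "-1" 1 "\<lambda>a b. trivial (patch \<sigma> a b (-1) 1)"])
    fix a b d :: real
    assume h: "trivial (patch \<sigma> a b (-1) 1)" "trivial (patch \<sigma> b d (-1) 1)" "a \<le> b" "b \<le> d"
    have u: "patch \<sigma> a d (-1) 1 = patch \<sigma> a b (-1) 1 \<union> patch \<sigma> b d (-1) 1" using h by (auto simp: patch_def)
    have i: "patch \<sigma> a b (-1) 1 \<inter> patch \<sigma> b d (-1) 1 = patch \<sigma> b b (-1) 1" using h by (auto simp: patch_def)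
    show "trivial (patch \<sigma> a d (-1) 1)" unfolding u
      by (rule trivial_glue) (use h i connected_patch_line[OF s] closed_patch in auto)
  qed (use inner in auto)
  moreover have "patch \<sigma> (-1) 1 (-1) 1 = {x \<in> S2. 0 \<le> \<sigma> * x$3}"
  proof -
    have "\<bar>x$i\<bar> \<le> 1" if "x \<in> S2" for x :: "real^3" and i using component_le_norm_cart[of x i] that by simp
    then show ?thesis by (auto simp: patch_def abs_le_iff minus_le_iff)
  qed
  ultimately show ?thesis by simp
qed

lemma connected_equator: "connected {x \<in> S2. x$3 = (0::real)}"
proof -
  define e where "e = Seg (axis 1 1) (axis 2 1) 1"
  have e: "geodesic_segment e" using pi_gt3 by (simp add: geodesic_segment_def e_def inner_axis_axis)
  have n: "nrm e \<bullet> x = x$3" for x by (simp add: nrm_def e_def cross_basis inner_axis')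
  have "{x \<in> S2. x$3 = 0} = range (seg_point e)"
    using on_circle[OF e] seg_frame(4,8)[OF e] n by (auto simp: image_iff) metis
  then show ?thesis using connected_continuous_image[OF continuous_seg_point[of UNIV]] by simp
qed

text \<open>The two hemispheres meet in the equator, which is connected; this is where the simple
  connectivity of the sphere enters.\<close>

theorem trivial_S2: "trivial S2"
proof -
  have u: "{x \<in> S2. 0 \<le> 1 * x$3} \<union> {x \<in> S2. 0 \<le> -1 * x$3} = S2" by auto
  have i: "{x \<in> S2. 0 \<le> 1 * x$3} \<inter> {x \<in> S2. 0 \<le> -1 * x$3} = {x \<in> S2. x$3 = 0}" by auto
  have cl: "closed {x::real^3 \<in> S2. 0 \<le> \<sigma> * x$3}" for \<sigma>
  proof -
    have "{x::real^3 \<in> S2. 0 \<le> \<sigma> * x$3} = S2 \<inter> {x. 0 \<le> \<sigma> * x$3}" by auto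
    also have "closed \<dots>" by (intro closed_Int closed_sphere closed_Collect_le continuous_intros)
    finally show ?thesis .
  qed
  have "connected ({x \<in> S2. 0 \<le> 1 * x$3} \<inter> {x \<in> S2. 0 \<le> -1 * x$3})"
    unfolding i by (rule connected_equator)
  from trivial_glue[OF cl trivial_hemisphere cl trivial_hemisphere this] show ?thesis unfolding u by simp
qed

end

subsection \<open>Half turns\<close>

text \<open>The matrix \<open>2 x x^T - 1\<close>; for a unit vector \<open>x\<close> it is the
  rotation by pi about \<open>x\<close>.\<close>

definition half_turn :: "real^3 \<Rightarrow> real^3^3" where
  "half_turn x = (\<chi> i j. 2 * x$i * x$j - (if i = j then 1 else 0))"

lemma half_turn_apply: "half_turn x *v y = (2 * (x \<bullet> y)) *\<^sub>R x - y"
  by (simp add: half_turn_def matrix_vector_mult_def vec_eq_iff forall_3 sum_3 inner_vec_def algebra_simps)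

lemma rotation_half_turn: assumes "x \<in> S2" shows "rotation_matrix (half_turn x)"
proof -
  have x: "x \<bullet> x = 1" using assms by (simp add: norm_1_inner)
  have "transpose (half_turn x) = half_turn x" by (auto simp: half_turn_def transpose_def vec_eq_iff)
  moreover have "half_turn x ** half_turn x = mat 1"
    by (auto simp: matrix_eq matrix_vector_mul_assoc[symmetric] half_turn_apply inner_diff_right x)
  ultimately have "orthogonal_matrix (half_turn x)" by (simp add: orthogonal_matrix)
  moreover have "det (half_turn x) = 2 * (x \<bullet> x) - 1"
    by (simp add: det_3 half_turn_def inner_vec_def sum_3) algebra
  ultimately show ?thesis using x by (simp add: rotation_matrix_def)
qed

lemma half_turn_square: assumes "x \<in> S2" shows "half_turn x ** half_turn x = mat 1"
proof -
  have x: "x \<bullet> x = 1" using assms by (simp add: norm_1_inner)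
  show ?thesis by (auto simp: matrix_eq matrix_vector_mul_assoc[symmetric] half_turn_apply inner_diff_right x)
qed

lemma half_turn_cancel: "x \<in> S2 \<Longrightarrow> A ** half_turn x ** half_turn x = A"
  by (metis half_turn_square matrix_mul_assoc matrix_mul_rid)

lemma seg_tan_point: "seg_tan e t = seg_point e (t + pi / 2)"
  by (simp add: seg_tan_def seg_point_def cos_add sin_add)

lemma matrix_eq_on_frame:
  assumes e: "geodesic_segment e" and "\<And>t. A *v seg_point e t = B *v seg_point e t" "A *v nrm e = B *v nrm e"
  shows "A = (B::real^3^3)"
proof -
  have "A *v x = B *v x" for x
    by (subst (1 2) seg_expand[OF e, of x 0])
      (simp add: assms seg_tan_point matrix_vector_right_distrib matrix_vector_mult_scaleR del: seg_point_0)
  then show ?thesis by (simp add: matrix_eq)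
qed

lemma half_turn_seg:
  assumes e: "geodesic_segment e"
  shows "half_turn (seg_point e a) *v seg_point e b = seg_point e (2 * a - b)"
    "half_turn (seg_point e a) *v nrm e = - nrm e"
proof -
  have "seg_point e a \<bullet> seg_point e b = cos (b - a)"
    using geodesic_segmentD[OF e] by (simp add: seg_point_def cos_diff algebra_simps)
  moreover have "seg_point e b = cos (b - a) *\<^sub>R seg_point e a + sin (b - a) *\<^sub>R seg_tan e a"
    "seg_point e (2 * a - b) = cos (b - a) *\<^sub>R seg_point e a - sin (b - a) *\<^sub>R seg_tan e a"
    using seg_point_add[of e a "b - a"] seg_point_add[of e a "- (b - a)"] by (simp_all del: minus_diff_eq)
  ultimately show "half_turn (seg_point e a) *v seg_point e b = seg_point e (2 * a - b)"
    unfolding half_turn_apply by (simp only: mult_2 scaleR_left_distrib) simp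
  show "half_turn (seg_point e a) *v nrm e = - nrm e"
    using seg_frame(4)[OF e, of a] by (simp add: half_turn_apply inner_commute)
qed

text \<open>Two half turns about points of a great circle compose to a shift along it by twice the
  difference of the parameters, and \<open>a - b = d - c\<close>.\<close>

lemma half_turn_four:
  assumes e: "geodesic_segment e" and "a - b + c - d = 0"
  shows "half_turn (seg_point e a) ** half_turn (seg_point e b) = half_turn (seg_point e d) ** half_turn (seg_point e c)"
proof (rule matrix_eq_on_frame[OF e])
  have *: "2 * a - (2 * b - t) = 2 * d - (2 * c - t)" for t using assms by algebra
  show "half_turn (seg_point e a) ** half_turn (seg_point e b) *v seg_point e t =
         half_turn (seg_point e d) ** half_turn (seg_point e c) *v seg_point e t" for t
    by (simp only: matrix_vector_mul_assoc[symmetric] half_turn_seg[OF e] *)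
  show "half_turn (seg_point e a) ** half_turn (seg_point e b) *v nrm e =
         half_turn (seg_point e d) ** half_turn (seg_point e c) *v nrm e"
    by (simp add: matrix_vector_mul_assoc[symmetric] half_turn_seg[OF e] matrix_vector_mult_minus)
qed

text \<open>The inverse of \<open>B\<close> after \<open>A\<close> fixes
  \<open>seg_point e t\<close> and reverses the normal. The third axis is the cross product of these
  two, so it is reversed as well.\<close>

lemma half_turn_unique:
  assumes A: "rotation_matrix A" and B: "rotation_matrix B" and e: "geodesic_segment e"
    and p: "A *v seg_point e t = B *v seg_point e t" and n: "A *v nrm e = - (B *v nrm e)"
  shows "A = B ** half_turn (seg_point e t)"
proof -
  note F = seg_frame[OF e]
  have tan: "seg_tan e t = cross3 (nrm e) (seg_point e t)"
    using F(6)[of t] F(1,3)[of t] by (metis (no_types, lifting) Lagrange cross_skew inner_commute scaleR_one scale_zero_left diff_zero minus_diff_eq)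
  have "A *v seg_tan e t = - (B *v seg_tan e t)"
    unfolding tan cross_rotation_matrix[OF A, symmetric] cross_rotation_matrix[OF B, symmetric] p n by simp
  then have "A *v x = (B ** half_turn (seg_point e t)) *v x" for x
    unfolding matrix_vector_mul_assoc[symmetric] half_turn_apply
    apply (subst (1 3) seg_expand[OF e, of x t])
    using p n
    by (simp add: matrix_vector_right_distrib matrix_vector_mult_scaleR matrix_vector_mult_minus inner_commute matrix_vector_mult_diff_distrib)
      (simp only: mult_2 scaleR_left_distrib, simp)
  then show ?thesis by (simp add: matrix_eq)
qed

lemma seg_dot:
  assumes "geodesic_segment e" shows "seg_point e a \<bullet> seg_point e b = cos (a - b)"
  using geodesic_segmentD[OF assms] by (simp add: seg_point_def cos_diff algebra_simps)

text \<open>The inner product with \<open>seg_point e t\<close> is the cosine of the parameter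
  distance, which decreases on [0, pi]; so nearness in space gives nearness of the
  parameters.\<close>

lemma near_circle:
  assumes e: "geodesic_segment e" and h: "0 < h"
  shows "\<forall>\<^sub>F x in nhds (seg_point e t). x \<in> S2 \<and> nrm e \<bullet> x = 0 \<longrightarrow> (\<exists>s. \<bar>s - t\<bar> < h \<and> x = seg_point e s)"
proof -
  define k where "k = min h pi"
  have k: "0 < k" "k \<le> h" "k \<le> pi" using h by (auto simp: k_def)
  have "((\<lambda>x. x \<bullet> seg_point e t) \<longlongrightarrow> seg_point e t \<bullet> seg_point e t) (nhds (seg_point e t))"
    by (intro tendsto_intros filterlim_ident)
  moreover have "cos k < seg_point e t \<bullet> seg_point e t"
    using cos_monotone_0_pi[of 0 k] k seg_frame(1)[OF e] by simp
  ultimately have "\<forall>\<^sub>F x in nhds (seg_point e t). cos k < x \<bullet> seg_point e t"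
    by (rule order_tendstoD(1))
  then show ?thesis
  proof eventually_elim
    case (elim x)
    show ?case
    proof
      assume "x \<in> S2 \<and> nrm e \<bullet> x = 0"
      then obtain s where s: "t - pi \<le> s" "s < (t - pi) + 2 * pi" "x = seg_point e s"
        using on_circle_from[OF e, of x "t - pi"] by blast
      have "cos k < cos \<bar>s - t\<bar>" using elim s seg_dot[OF e, of s t] by simp
      then have "\<not> k \<le> \<bar>s - t\<bar>" using cos_monotone_0_pi_le[of k "\<bar>s - t\<bar>"] k s(1,2) by force
      then show "\<exists>s. \<bar>s - t\<bar> < h \<and> x = seg_point e s" using s k by (intro exI[of _ s]) auto
    qed
  qed
qed

section \<open>Neighbourhoods of the points of the sphere\<close>

context rtiling
begin

definition edge_faces :: "seg \<Rightarrow> (real^3) set set" where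
  "edge_faces e = {bl e, wl e, br e, wr e}"

lemma edge_faces_rev: "e \<in> edges T \<Longrightarrow> edge_faces (seg_rev e) = edge_faces e"
  using br_rev wr_rev by (auto simp: edge_faces_def br_def wr_def)

lemma edge_faces_faces: "e \<in> edges T \<Longrightarrow> edge_faces e \<subseteq> faces T"
  using edge_facts by (auto simp: edge_faces_def)

text \<open>At the point where the colour changes, \<open>m\<close> is the normal of the edge that
  leaves there, whose points are in no interior. At the other points nothing has to be excluded, and
  \<open>nrm e\<close> serves as \<open>m\<close>.\<close>

lemma left_cover:
  assumes e: "e \<in> edges T" and t: "0 < t" "t < len e"
  shows "\<exists>m. m \<noteq> 0 \<and> (\<forall>\<^sub>F x in nhds (seg_point e t). 0 < nrm e \<bullet> x \<and> m \<bullet> x \<noteq> 0 \<longrightarrow> x \<in> fint (bl e) \<or> x \<in> fint (wl e))"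
proof -
  have n0: "nrm u \<noteq> 0" if "u \<in> edges T" for u using seg_frame(9)[OF edges_geodesic[OF that]] by auto
  consider "t < lb e" | "lb e < t" | "t = lb e" by linarith
  then show ?thesis
  proof cases
    case 1
    have "\<forall>\<^sub>F x in nhds (seg_point e t). 0 < nrm e \<bullet> x \<and> nrm e \<bullet> x \<noteq> 0 \<longrightarrow> x \<in> fint (bl e) \<or> x \<in> fint (wl e)"
      using edge_local[OF e, of "bl e" t] 1 t by (auto elim: eventually_mono)
    then show ?thesis using n0[OF e] by blast
  next
    case 2
    have "\<forall>\<^sub>F x in nhds (seg_point e t). 0 < nrm e \<bullet> x \<and> nrm e \<bullet> x \<noteq> 0 \<longrightarrow> x \<in> fint (bl e) \<or> x \<in> fint (wl e)"
      using edge_local[OF e, of "wl e" t] 2 t by (auto elim: eventually_mono)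
    then show ?thesis using n0[OF e] by blast
  next
    case 3
    obtain e2 where c: "corner e e2" using corner_from[OF e] by blast
    then have st: "start e2 = seg_point e t" and b: "bl e2 = bl e" "wr e2 = wl e" and e2: "e2 \<in> edges T"
      using 3 by (auto simp: corner_def)
    have "\<forall>\<^sub>F x in nhds (seg_point e t). 0 < nrm e \<bullet> x \<and> nrm e2 \<bullet> x \<noteq> 0 \<longrightarrow> x \<in> fint (bl e) \<or> x \<in> fint (wl e)"
      using corner_local[OF c] unfolding st b by eventually_elim (auto simp: neq_iff)
    then show ?thesis using n0[OF e2] by blast
  qed
qed

text \<open>Off three planes, every point near the edge point is inside one of the four faces.
  Another face reaching there would have interior points off these planes and so would overlap one
  of the four.\<close>

lemma near_faces:
  assumes e: "e \<in> edges T" and t: "0 < t" "t < len e"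
  shows "\<forall>\<^sub>F x in nhds (seg_point e t). \<forall>f\<in>faces T. x \<in> fcone f \<longrightarrow> f \<in> edge_faces e"
proof -
  note g = edges_geodesic[OF e] and e' = edges_rev[OF e]
  obtain m where m: "m \<noteq> 0" "\<forall>\<^sub>F x in nhds (seg_point e t). 0 < nrm e \<bullet> x \<and> m \<bullet> x \<noteq> 0 \<longrightarrow> x \<in> fint (bl e) \<or> x \<in> fint (wl e)"
    using left_cover[OF e t] by blast
  have "0 < len e - t" "len e - t < len (seg_rev e)" using t by auto
  then obtain m' where m': "m' \<noteq> 0" "\<forall>\<^sub>F x in nhds (seg_point (seg_rev e) (len e - t)).
      0 < nrm (seg_rev e) \<bullet> x \<and> m' \<bullet> x \<noteq> 0 \<longrightarrow> x \<in> fint (bl (seg_rev e)) \<or> x \<in> fint (wl (seg_rev e))"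
    using left_cover[OF e'] by blast
  have m'': "\<forall>\<^sub>F x in nhds (seg_point e t). nrm e \<bullet> x < 0 \<and> m' \<bullet> x \<noteq> 0 \<longrightarrow> x \<in> fint (br e) \<or> x \<in> fint (wr e)"
    using m'(2) g by (simp add: seg_point_rev br_def wr_def)
  have n0: "nrm e \<noteq> 0" using seg_frame(9)[OF g] by auto
  have "\<forall>\<^sub>F x in nhds (seg_point e t). nrm e \<bullet> x \<noteq> 0 \<and> m \<bullet> x \<noteq> 0 \<and> m' \<bullet> x \<noteq> 0 \<longrightarrow> (\<exists>f\<in>edge_faces e. x \<in> fint f)"
    using m(2) m'' by eventually_elim (auto simp: edge_faces_def neq_iff)
  \<comment> \<open>The statement is passed on to neighbourhoods of all nearby points
    \<open>x\<close>, since \<open>face_accum\<close> will be applied at \<open>x\<close> and not at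
    the point of the edge.\<close>
  then have "\<forall>\<^sub>F x in nhds (seg_point e t). \<forall>\<^sub>F z in nhds x.
      nrm e \<bullet> z \<noteq> 0 \<and> m \<bullet> z \<noteq> 0 \<and> m' \<bullet> z \<noteq> 0 \<longrightarrow> (\<exists>f\<in>edge_faces e. z \<in> fint f)"
    by (simp add: eventually_eventually)
  then show ?thesis
  proof eventually_elim
    case (elim x)
    show ?case
    proof (intro ballI impI)
      fix f assume f: "f \<in> faces T" "x \<in> fcone f"
      have N: "finite {nrm e, m, m'}" "0 \<notin> {nrm e, m, m'}" using n0 m(1) m'(1) by auto
      obtain z where z: "z \<in> fint f"
          "nrm e \<bullet> z \<noteq> 0 \<and> m \<bullet> z \<noteq> 0 \<and> m' \<bullet> z \<noteq> 0 \<longrightarrow> (\<exists>f\<in>edge_faces e. z \<in> fint f)"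
          "\<forall>n\<in>{nrm e, m, m'}. n \<bullet> z \<noteq> 0"
        by (rule face_accum[OF faces_face[OF f(1)] f(2) elim N])
      then obtain h where h: "h \<in> edge_faces e" "z \<in> fint h" by auto
      have "h = f" using fint_disjoint[OF _ f(1) h(2) z(1)] edge_faces_faces[OF e] h(1) by blast
      then show "f \<in> edge_faces e" using h by simp
    qed
  qed
qed

lemma in_fint_unique:
  assumes "f \<in> faces T" "x \<in> fint f" "h \<in> faces T" "x \<in> fcone h" shows "h = f"
proof -
  have "\<forall>\<^sub>F z in nhds x. z \<in> fint f" using open_fint faces_face assms by (intro eventually_nhds_in_open) auto
  then obtain z where "z \<in> fint h" "z \<in> fint f" using face_accum[OF faces_face[OF assms(3)] assms(4), of _ "{}"] by auto
  then show ?thesis using fint_disjoint assms by blast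
qed

text \<open>A point inside no face lies on an edge, at a parameter less than its length; if the
  parameter is 0, the point is inside another edge by \<open>corner_to\<close>.\<close>

lemma point_cases:
  assumes y: "y \<in> S2"
  obtains f where "f \<in> faces T" "y \<in> fint f" | e t where "e \<in> edges T" "0 < t" "t < len e" "y = seg_point e t"
proof (cases "\<exists>f\<in>faces T. y \<in> fint f")
  case True then show thesis using that by blast
next
  note pt = that(2)
  case False
  obtain f where f: "f \<in> faces T" "y \<in> f" using faces_cover y by blast
  then have "y \<in> fcone f" using face_cone faces_face by blast
  then obtain m where m: "m \<in> nrms f" "m \<bullet> y = 0" using False f by (force simp: fint_def fcone_def order_less_le)
  have start: thesis if "e \<in> edges T" "y = start e" for e
  proof -
    obtain e0 where c: "corner e0 e" using corner_to \<open>e \<in> edges T\<close> by blast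
    then have "e0 \<in> edges T" "y = seg_point e0 (lb e0)" using that by (auto simp: corner_def)
    then show thesis using edge_facts(1,2)[of e0] pt[of e0 "lb e0"] by blast
  qed
  have "\<exists>e t. e \<in> edges T \<and> y = seg_point e t \<and> 0 \<le> t \<and> t < len e"
  proof (cases "f \<in> black T")
    case True
    then obtain e t where "e \<in> edges T" "y = seg_point e t" "0 \<le> t" "t \<le> lb e" using black_edge_at[OF True m(1) f(2) m(2)] by metis
    then show ?thesis using edge_facts[of e] by force
  next
    case False
    then have "f \<in> white T" using f by (auto simp: faces_def)
    then obtain e t where "e \<in> edges T" "y = seg_point e t" "0 \<le> t" "t \<le> lw e" using white_edge_at[OF _ m(1) f(2) m(2)] by metis
    then show ?thesis using edge_facts[of e] by force
  qed
  then obtain e t where e: "e \<in> edges T" "y = seg_point e t" "0 \<le> t" "t < len e" by blast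
  show thesis
  proof (cases "t = 0")
    case True then show thesis using start e by simp
  next
    case False then show thesis using e pt[of e t] by simp
  qed
qed

lemma local_faces:
  assumes y: "y \<in> S2"
  shows "\<exists>H. finite H \<and> H \<subseteq> faces T \<and> (\<forall>\<^sub>F x in nhds y. \<forall>f\<in>faces T. x \<in> fcone f \<longrightarrow> f \<in> H)"
  using y
proof (cases rule: point_cases)
  case (1 f)
  then have "\<forall>\<^sub>F x in nhds y. x \<in> fint f" using open_fint faces_face by (intro eventually_nhds_in_open) auto
  then have "\<forall>\<^sub>F x in nhds y. \<forall>h\<in>faces T. x \<in> fcone h \<longrightarrow> h \<in> {f}"
    by eventually_elim (use in_fint_unique 1 in blast)
  then show ?thesis using 1 by (intro exI[of _ "{f}"]) auto
next
  case (2 e t)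
  then show ?thesis using near_faces[OF 2(1-3)] edge_faces_faces[OF 2(1)] by (intro exI[of _ "edge_faces e"]) (auto simp: edge_faces_def)
qed

text \<open>Only finitely many faces come near \<open>y\<close>, and the closed cones of those that
  miss \<open>y\<close> can be avoided.\<close>

lemma faces_shrink:
  assumes y: "y \<in> S2"
  shows "\<forall>\<^sub>F x in nhds y. \<forall>f\<in>faces T. x \<in> fcone f \<longrightarrow> y \<in> f"
proof -
  obtain H where H: "finite H" "H \<subseteq> faces T" "\<forall>\<^sub>F x in nhds y. \<forall>f\<in>faces T. x \<in> fcone f \<longrightarrow> f \<in> H"
    using local_faces[OF y] by blast
  have "\<forall>\<^sub>F x in nhds y. \<forall>f\<in>{f\<in>H. y \<notin> f}. x \<in> - fcone f"
  proof (rule eventually_ball_finite, use H in simp, intro ballI)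
    fix f assume "f \<in> {f\<in>H. y \<notin> f}"
    then have "y \<in> - fcone f" using H face_mem[OF faces_face] y by blast
    then show "\<forall>\<^sub>F x in nhds y. x \<in> - fcone f" using closed_fcone by (intro eventually_nhds_in_open) auto
  qed
  with H(3) show ?thesis by eventually_elim auto
qed

text \<open>The definition of a tiling does not ask for finitely many faces; this follows from
  \<open>local_faces\<close> by compactness, and the comparison of areas relies on it.\<close>

lemma finite_faces: "finite (faces T)"
proof -
  define H where "H y = (SOME H. finite H \<and> H \<subseteq> faces T \<and> (\<forall>\<^sub>F x in nhds y. \<forall>f\<in>faces T. x \<in> fcone f \<longrightarrow> f \<in> H))" for y
  have H: "finite (H y)" "\<forall>\<^sub>F x in nhds y. \<forall>f\<in>faces T. x \<in> fcone f \<longrightarrow> f \<in> H y" if "y \<in> S2" for y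
    using someI_ex[OF local_faces[OF that]] unfolding H_def by blast+
  have "\<forall>y\<in>S2. \<exists>U. open U \<and> y \<in> U \<and> (\<forall>x\<in>U. \<forall>f\<in>faces T. x \<in> fcone f \<longrightarrow> f \<in> H y)"
    using H(2) by (simp add: eventually_nhds)
  then obtain U where U: "\<And>y. y \<in> S2 \<Longrightarrow> open (U y) \<and> y \<in> U y \<and> (\<forall>x\<in>U y. \<forall>f\<in>faces T. x \<in> fcone f \<longrightarrow> f \<in> H y)"
    by metis
  have "compact (S2 :: (real^3) set)" by simp
  then obtain D where D: "D \<subseteq> S2" "finite D" "S2 \<subseteq> (\<Union>y\<in>D. U y)"
    by (rule compactE_image[of S2 S2 U]) (use U in auto)
  have "faces T \<subseteq> (\<Union>y\<in>D. H y)"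
  proof
    fix f assume f: "f \<in> faces T"
    obtain x where x: "x \<in> S2" "x \<in> fint f" using fint_nonempty faces_face f by blast
    then obtain y where y: "y \<in> D" "x \<in> U y" using D by blast
    have "x \<in> fcone f" using x fint_sub_fcone by blast
    then have "f \<in> H y" using U[of y] y D(1) f by blast
    then show "f \<in> (\<Union>y\<in>D. H y)" using y by blast
  qed
  then show ?thesis using D H(1) by (meson finite_UN_I finite_subset subset_iff)
qed

lemma corner_dir_pos:
  assumes c: "corner e0 e" shows "0 < nrm e0 \<bullet> dir e"
proof -
  have e: "e0 \<in> edges T" "e \<in> edges T" "start e = seg_point e0 (lb e0)" "bl e0 = bl e" using c by (auto simp: corner_def)
  note E = edge_facts[OF e(2)] and E0 = edge_facts[OF e(1)]
  note g = edges_geodesic[OF e(2)] and g0 = edges_geodesic[OF e(1)]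
  have z: "nrm e0 \<bullet> start e = 0" using seg_frame(4)[OF g0] e by simp
  define h where "h = min (lb e) 1"
  have h: "0 < h" "h \<le> lb e" "h < pi" using E pi_gt3 by (auto simp: h_def)
  then have "seg_point e h \<in> bl e0" using edge_points(1)[OF e(2), of h] e by auto
  then have "0 \<le> nrm e0 \<bullet> seg_point e h" using E0(18) by (auto simp: nrms_def closed_hemisphere_def)
  also have "\<dots> = sin h * (nrm e0 \<bullet> dir e)" using z by (simp add: seg_point_def inner_right_distrib)
  finally have "0 \<le> nrm e0 \<bullet> dir e" using h sin_gt_zero[of h] by (simp add: zero_le_mult_iff)
  moreover have "nrm e0 \<bullet> dir e \<noteq> 0"
  proof
    assume "nrm e0 \<bullet> dir e = 0"
    then have "nrm e = nrm e0 \<or> nrm e = - nrm e0"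
      using geodesic_segmentD[OF g] seg_frame(10)[OF g] seg_frame(10)[OF g0] z
      by (intro parallel_unit[of _ _ "start e" "dir e"]) auto
    then show False using corner_neq[OF c] by auto
  qed
  ultimately show ?thesis by simp
qed

text \<open>On the circle of \<open>e\<close> near its start, being on the left of \<open>e0\<close>
  singles out the edge from its backward continuation.\<close>

lemma near_corner_ray:
  assumes c: "corner e0 e" and h: "0 < h"
  shows "\<forall>\<^sub>F x in nhds (start e). x \<in> S2 \<and> nrm e \<bullet> x = 0 \<and> 0 < nrm e0 \<bullet> x \<longrightarrow> (\<exists>s. 0 < s \<and> s < h \<and> x = seg_point e s)"
proof -
  have e: "e0 \<in> edges T" "e \<in> edges T" "start e = seg_point e0 (lb e0)" using c by (auto simp: corner_def)
  note g = edges_geodesic[OF e(2)] and g0 = edges_geodesic[OF e(1)]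
  have z: "nrm e0 \<bullet> start e = 0" using seg_frame(4)[OF g0] e by simp
  have "0 < min h pi" using h by simp
  from near_circle[OF g this, of 0] show ?thesis unfolding seg_point_0
  proof eventually_elim
    case (elim x)
    show ?case
    proof
      assume x: "x \<in> S2 \<and> nrm e \<bullet> x = 0 \<and> 0 < nrm e0 \<bullet> x"
      then obtain s where s: "\<bar>s - 0\<bar> < min h pi" "x = seg_point e s" using elim by blast
      have "nrm e0 \<bullet> x = sin s * (nrm e0 \<bullet> dir e)" using z s by (simp add: seg_point_def inner_right_distrib)
      then have "0 < sin s" using x corner_dir_pos[OF c] by (simp add: zero_less_mult_iff)
      then have "0 < s" using sin_ge_zero[of "-s"] s by (cases "0 < s") auto
      then show "\<exists>s. 0 < s \<and> s < h \<and> x = seg_point e s" using s by (intro exI[of _ s]) auto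
    qed
  qed
qed

lemma left_structure:
  assumes e: "e \<in> edges T" and t: "0 < t" "t < len e"
  shows "\<forall>\<^sub>F x in nhds (seg_point e t). x \<in> S2 \<and> 0 < nrm e \<bullet> x \<longrightarrow>
     (\<exists>f\<in>faces T. x \<in> fint f) \<or> (\<exists>e2. corner e e2 \<and> x \<in> seg_interior e2 \<and> (\<forall>f\<in>faces T. x \<in> f \<longrightarrow> f = bl e2 \<or> f = wr e2))"
proof -
  note E = edge_facts[OF e]
  consider "t < lb e" | "lb e < t" | "t = lb e" by linarith
  then show ?thesis
  proof cases
    case 1
    then show ?thesis using edge_local[OF e, of "bl e" t] t E(10) by (auto elim: eventually_mono)
  next
    case 2
    then show ?thesis using edge_local[OF e, of "wl e" t] t E(11) by (auto elim: eventually_mono)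
  next
    case 3
    obtain e2 where c: "corner e e2" using corner_from[OF e] by blast
    then have st: "start e2 = seg_point e t" and b: "bl e2 = bl e" "wr e2 = wl e" and e2: "e2 \<in> edges T"
      using 3 by (auto simp: corner_def)
    have "0 < len e2" using edges_len e2 by blast
    from near_corner_ray[OF c this] corner_local[OF c] near_faces[OF e t] show ?thesis unfolding st b
    proof eventually_elim
      case (elim x)
      show ?case
      proof
        assume x: "x \<in> S2 \<and> 0 < nrm e \<bullet> x"
        show "(\<exists>f\<in>faces T. x \<in> fint f) \<or> (\<exists>e2. corner e e2 \<and> x \<in> seg_interior e2 \<and> (\<forall>f\<in>faces T. x \<in> f \<longrightarrow> f = bl e2 \<or> f = wr e2))"
        proof (cases "nrm e2 \<bullet> x = 0")
          case False
          then have "x \<in> fint (bl e) \<or> x \<in> fint (wl e)" using elim(2) x by linarith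
          then show ?thesis using E(10,11) by blast
        next
          case True
          then have "x \<in> seg_interior e2" using elim(1) x by (auto simp: seg_interior_def)
          moreover have "f = bl e2 \<or> f = wr e2" if f: "f \<in> faces T" "x \<in> f" for f
          proof -
            have "f \<in> edge_faces e" using elim(3) f face_cone faces_face by blast
            moreover have "f \<noteq> br e" "f \<noteq> wr e" using E(20,21) f x by (auto simp: nrms_def closed_hemisphere_def)
            ultimately show ?thesis using b by (auto simp: edge_faces_def)
          qed
          ultimately show ?thesis using c by blast
        qed
      qed
    qed
  qed
qed

text \<open>In the last case \<open>x\<close> is on an edge that leaves \<open>e\<close>, to the
  left or to the right. The two faces meeting there also meet at the corner, so their relation is
  among the conditions of \<open>e\<close>; this makes a local solution at the edge point usable at
  \<open>x\<close>.\<close>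

lemma near_structure:
  assumes e: "e \<in> edges T" and t: "0 < t" "t < len e"
  shows "\<forall>\<^sub>F x in nhds (seg_point e t). x \<in> S2 \<longrightarrow>
     (\<exists>f\<in>faces T. x \<in> fint f) \<or> (x \<in> seg_interior e \<and> (\<forall>f\<in>faces T. x \<in> f \<longrightarrow> f \<in> edge_faces e)) \<or>
     (\<exists>e1 e2. e1 \<in> {e, seg_rev e} \<and> corner e1 e2 \<and> x \<in> seg_interior e2 \<and> (\<forall>f\<in>faces T. x \<in> f \<longrightarrow> f = bl e2 \<or> f = wr e2))"
proof -
  note g = edges_geodesic[OF e]
  have t': "0 < len e - t" "len e - t < len (seg_rev e)" using t by auto
  have "0 < min t (len e - t)" using t by auto
  from near_circle[OF g this, of t] left_structure[OF e t] left_structure[OF edges_rev[OF e] t', unfolded seg_point_rev]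
    near_faces[OF e t]
  show ?thesis unfolding nrm_rev[OF g] diff_diff_eq2 add_diff_cancel_left'
  proof eventually_elim
    case (elim x)
    show ?case
    proof
      assume x: "x \<in> S2"
      consider "nrm e \<bullet> x = 0" | "0 < nrm e \<bullet> x" | "0 < - nrm e \<bullet> x" using inner_minus_left[of "nrm e" x] by linarith
      then show "(\<exists>f\<in>faces T. x \<in> fint f) \<or> (x \<in> seg_interior e \<and> (\<forall>f\<in>faces T. x \<in> f \<longrightarrow> f \<in> edge_faces e)) \<or>
         (\<exists>e1 e2. e1 \<in> {e, seg_rev e} \<and> corner e1 e2 \<and> x \<in> seg_interior e2 \<and> (\<forall>f\<in>faces T. x \<in> f \<longrightarrow> f = bl e2 \<or> f = wr e2))"
      proof cases
        case 1
        then obtain s where s: "\<bar>s - t\<bar> < min t (len e - t)" "x = seg_point e s" using elim(1) x by blast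
        then have "x \<in> seg_interior e" by (auto simp: abs_less_iff intro!: seg_interiorI)
        then show ?thesis using elim(4) face_cone faces_face by blast
      next
        case 2 then show ?thesis using elim(2) x by blast
      next
        case 3 then show ?thesis using elim(3) x by blast
      qed
    qed
  qed
qed

subsection \<open>Solving for the rotations\<close>

text \<open>In the flip, the black face on the left of \<open>e\<close> slides forward by \<open>lw e\<close> and the white face is turned by
  \<open>pi\<close> about the midpoint of its edge onto the right side.  The two motions differ by the half turn about
  the common vertex of the two faces, and the same holds for the other pairs of faces around \<open>e\<close>.\<close>
definition compat :: "((real^3) set \<Rightarrow> real^3^3) \<Rightarrow> seg \<Rightarrow> bool" where
  "compat R e \<longleftrightarrow> R (bl e) = R (wl e) ** half_turn (seg_point e (lb e)) \<and> R (bl e) = R (wr e) ** half_turn (start e) \<and>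
     R (br e) = R (wr e) ** half_turn (seg_point e (lw e)) \<and> R (br e) = R (wl e) ** half_turn (seg_point e (len e))"

lemma compat_rev: assumes e: "e \<in> edges T" shows "compat R (seg_rev e) = compat R e"
proof -
  have "len e - lb e = lw e" "len e - lw e = lb e" using edge_facts(5)[OF e] by simp_all
  moreover have "bl (seg_rev e) = br e" "wl (seg_rev e) = wr e" by (simp_all add: br_def wr_def)
  ultimately show ?thesis unfolding compat_def seg_point_rev seg_rev_simps br_rev[OF e] wr_rev[OF e] lw_rev[OF e] bl_wl_lb(3)[OF e]
    by (simp only: diff_self seg_point_0) blast
qed

lemma edge_faces_distinct:
  assumes e: "e \<in> edges T"
  shows "bl e \<noteq> wl e" "bl e \<noteq> wr e" "br e \<noteq> wl e" "br e \<noteq> wr e" "bl e \<noteq> br e" "wl e \<noteq> wr e"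
proof -
  note E = edge_facts[OF e]
  show "bl e \<noteq> wl e" "bl e \<noteq> wr e" "br e \<noteq> wl e" "br e \<noteq> wr e" using E(6-9) black_white by metis+
  show "bl e \<noteq> br e" "wl e \<noteq> wr e" using opposite_notin_nrms E(14,15,18-21) by metis+
qed

text \<open>Starting from the identity on \<open>wl e\<close>, three conditions define the other
  rotations. The remaining one, between \<open>br e\<close> and \<open>wr e\<close>, is an instance
  of \<open>half_turn_four\<close> because \<open>lb e - len e + lw e - 0 = 0\<close>.\<close>

lemma compat_exists:
  assumes e: "e \<in> edges T"
  shows "\<exists>R. (\<forall>f. rotation_matrix (R f)) \<and> compat R e"
proof -
  note g = edges_geodesic[OF e] and d = edge_faces_distinct[OF e]
  let ?h = "\<lambda>t. half_turn (seg_point e t)"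
  have rot: "rotation_matrix (?h t)" for t using rotation_half_turn seg_frame(8)[OF g] by blast
  define R where "R f = (if f = bl e then ?h (lb e) else if f = br e then ?h (len e)
     else if f = wr e then ?h (lb e) ** ?h 0 else mat 1)" for f
  have "?h (lb e) ** ?h (len e) = ?h 0 ** ?h (lw e)"
    by (rule half_turn_four[OF g]) (use edge_facts(5)[OF e] in simp)
  then have "?h (lb e) ** ?h (lb e) ** ?h (len e) = ?h (lb e) ** ?h 0 ** ?h (lw e)" by (simp add: matrix_mul_assoc[symmetric])
  then have 1: "?h (len e) = ?h (lb e) ** ?h 0 ** ?h (lw e)"
    using half_turn_square[OF seg_frame(8)[OF g]] by simp
  have 2: "?h (lb e) ** ?h 0 ** ?h 0 = ?h (lb e)" using half_turn_cancel seg_frame(8)[OF g] by blast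
  have "compat R e" using d 1 2 by (auto simp: compat_def R_def)
  moreover have "rotation_matrix (R f)" for f using rot rotation_mult by (simp add: R_def del: seg_point_0)
  ultimately show ?thesis by blast
qed

text \<open>A common right factor cancels in \<open>R f ** rinv (R' f)\<close>, so the ratio is the
  same for any two faces related by a condition, and the conditions connect all four faces.\<close>

lemma compat_ratio:
  assumes e: "e \<in> edges T" and R: "compat R e" "compat R' e" and f: "f \<in> edge_faces e" "h \<in> edge_faces e"
  shows "R f ** rinv (R' f) = R h ** rinv (R' h)"
proof -
  have rot: "rotation_matrix (half_turn (seg_point e t))" for t
    using rotation_half_turn seg_frame(8)[OF edges_geodesic[OF e]] by blast
  have "R f ** rinv (R' f) = R (wl e) ** rinv (R' (wl e))" if "f \<in> edge_faces e" for f
  proof -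
    have 1: "R (bl e) ** rinv (R' (bl e)) = R (wl e) ** rinv (R' (wl e))"
      using R ratio_mult[OF rot] unfolding compat_def by metis
    have 2: "R (bl e) ** rinv (R' (bl e)) = R (wr e) ** rinv (R' (wr e))"
      using R ratio_mult[OF rot[of 0]] unfolding compat_def seg_point_0 by metis
    have 3: "R (br e) ** rinv (R' (br e)) = R (wl e) ** rinv (R' (wl e))"
      using R ratio_mult[OF rot] unfolding compat_def by metis
    show ?thesis using that 1 2 3 by (auto simp: edge_faces_def)
  qed
  then show ?thesis using f by metis
qed

section \<open>Local solutions and their gluing\<close>

definition flip_sol :: "((real^3) set \<Rightarrow> real^3^3) \<Rightarrow> bool" where
  "flip_sol R \<longleftrightarrow> (\<forall>f\<in>faces T. rotation_matrix (R f)) \<and> (\<forall>e\<in>edges T. compat R e)"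

text \<open>A local solution at \<open>y\<close>. The edge through \<open>y\<close> is unique up to
  reversal, so there is only one system to solve; if \<open>y\<close> is inside no edge, the
  rotations are arbitrary.\<close>

definition zloc :: "real^3 \<Rightarrow> (real^3) set \<Rightarrow> real^3^3" where
  "zloc y = (SOME R. (\<forall>f. rotation_matrix (R f)) \<and> (\<forall>e\<in>edges T. y \<in> seg_interior e \<longrightarrow> compat R e))"

lemma zloc: "rotation_matrix (zloc y f)" "e \<in> edges T \<Longrightarrow> y \<in> seg_interior e \<Longrightarrow> compat (zloc y) e"
proof -
  have "\<exists>R. (\<forall>f. rotation_matrix (R f)) \<and> (\<forall>e\<in>edges T. y \<in> seg_interior e \<longrightarrow> compat R e)"
  proof (cases "\<exists>e\<in>edges T. y \<in> seg_interior e")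
    case True
    then obtain e where e: "e \<in> edges T" "y \<in> seg_interior e" by blast
    obtain R where R: "\<forall>f. rotation_matrix (R f)" "compat R e" using compat_exists[OF e(1)] by blast
    have "compat R e'" if "e' \<in> edges T" "y \<in> seg_interior e'" for e'
      using edges_cross[OF e(1) that(1) e(2) that(2)] R compat_rev[OF e(1)] by auto
    then show ?thesis using R by blast
  next
    case False
    then show ?thesis by (intro exI[of _ "\<lambda>_. mat 1"]) auto
  qed
  from someI_ex[OF this, folded zloc_def]
  show "rotation_matrix (zloc y f)" "e \<in> edges T \<Longrightarrow> y \<in> seg_interior e \<Longrightarrow> compat (zloc y) e" by auto
qed

text \<open>This makes the transition maps independent of the chosen face. On an edge leaving at a
  corner, the two faces differ by the half turn about that corner both in the solution at
  \<open>y\<close> and in the one at \<open>x\<close>, so it cancels in the ratio.\<close>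

lemma zloc_ratio:
  assumes y: "y \<in> S2"
  shows "\<forall>\<^sub>F x in nhds y. x \<in> S2 \<longrightarrow> (\<forall>f\<in>faces T. \<forall>h\<in>faces T. x \<in> f \<longrightarrow> x \<in> h \<longrightarrow>
     zloc y f ** rinv (zloc x f) = zloc y h ** rinv (zloc x h))"
  using y
proof (cases rule: point_cases)
  case (1 k)
  then have "\<forall>\<^sub>F x in nhds y. x \<in> fint k" using open_fint faces_face by (intro eventually_nhds_in_open) auto
  then show ?thesis
  proof eventually_elim
    case (elim x)
    have "f = k" if "f \<in> faces T" "x \<in> f" for f using in_fint_unique[OF 1(1) elim that(1)] that face_cone faces_face by blast
    then show ?case by blast
  qed
next
  case (2 e t)
  have ye: "y \<in> seg_interior e" using 2 by (auto intro: seg_interiorI)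
  from near_structure[OF 2(1-3)] show ?thesis unfolding 2(4)[symmetric]
  proof eventually_elim
    case (elim x)
    show ?case
    proof (intro impI ballI)
      fix f h assume x: "x \<in> S2" and f: "f \<in> faces T" "h \<in> faces T" "x \<in> f" "x \<in> h"
      consider k where "k \<in> faces T" "x \<in> fint k" | "x \<in> seg_interior e" "f \<in> edge_faces e" "h \<in> edge_faces e"
        | e1 e2 where "e1 \<in> {e, seg_rev e}" "corner e1 e2" "x \<in> seg_interior e2" "f \<in> {bl e2, wr e2}" "h \<in> {bl e2, wr e2}"
        using elim x f by blast
      then show "zloc y f ** rinv (zloc x f) = zloc y h ** rinv (zloc x h)"
      proof cases
        case 1
        then have "f = k" "h = k" using in_fint_unique f face_cone faces_face by blast+
        then show ?thesis by simp
      next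
        case 2
        then show ?thesis using compat_ratio[OF \<open>e \<in> edges T\<close> zloc(2)[OF _ ye] zloc(2)] \<open>e \<in> edges T\<close> by blast
      next
        case 3
        have e1: "e1 \<in> edges T" "y \<in> seg_interior e1" using 3(1) \<open>e \<in> edges T\<close> edges_rev ye by auto
        have e2: "e2 \<in> edges T" "start e2 = seg_point e1 (lb e1)" "bl e1 = bl e2" "wl e1 = wr e2" using 3(2) by (auto simp: corner_def)
        have "zloc y (bl e2) = zloc y (wr e2) ** half_turn (start e2)" using zloc(2)[OF e1] e2 by (simp add: compat_def)
        moreover have "zloc x (bl e2) = zloc x (wr e2) ** half_turn (start e2)" using zloc(2)[OF e2(1) 3(3)] unfolding compat_def by blast
        moreover have "rotation_matrix (half_turn (start e2))"
          using rotation_half_turn seg_frame(8)[OF edges_geodesic[OF e2(1)], of 0] by simp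
        ultimately have "zloc y (bl e2) ** rinv (zloc x (bl e2)) = zloc y (wr e2) ** rinv (zloc x (wr e2))"
          by (simp add: ratio_mult)
        then show ?thesis using 3(4,5) by auto
      qed
    qed
  qed
qed

definition transition_map :: "real^3 \<Rightarrow> real^3 \<Rightarrow> real^3^3" where
  "transition_map y x = (let f = (SOME f. f \<in> faces T \<and> x \<in> f) in zloc y f ** rinv (zloc x f))"

lemma transition_map_eq:
  assumes y: "y \<in> S2"
  shows "\<forall>\<^sub>F x in nhds y. x \<in> S2 \<longrightarrow> (\<forall>f\<in>faces T. x \<in> f \<longrightarrow> transition_map y x = zloc y f ** rinv (zloc x f))"
  using zloc_ratio[OF y]
proof eventually_elim
  case (elim x)
  show ?case
  proof (intro impI ballI)
    fix f assume x: "x \<in> S2" "f \<in> faces T" "x \<in> f"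
    define h where "h = (SOME f. f \<in> faces T \<and> x \<in> f)"
    have "h \<in> faces T \<and> x \<in> h" unfolding h_def by (rule someI[of _ f]) (use x in auto)
    then show "transition_map y x = zloc y f ** rinv (zloc x f)"
      using elim x unfolding transition_map_def h_def[symmetric] Let_def by blast
  qed
qed

text \<open>By \<open>faces_shrink\<close>, a face through \<open>x'\<close> contains
  \<open>x\<close> as well. All three transition maps can then be computed from this one face, and
  the factors telescope.\<close>

sublocale transition transition_map
proof
  show "rotation_matrix (transition_map y x)" for y x
    using zloc(1) rotation_mult rotation_transpose(1) by (simp add: transition_map_def Let_def)
  fix y assume y: "y \<in> S2"
  from transition_map_eq[OF y]
  have "\<forall>\<^sub>F x in nhds y. \<forall>\<^sub>F x' in nhds x. x' \<in> S2 \<longrightarrow> (\<forall>f\<in>faces T. x' \<in> f \<longrightarrow> transition_map y x' = zloc y f ** rinv (zloc x' f))"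
    by (simp add: eventually_eventually)
  with transition_map_eq[OF y]
  show "\<forall>\<^sub>F y' in nhds y. y' \<in> S2 \<longrightarrow> (\<forall>\<^sub>F y'' in nhds y'. y'' \<in> S2 \<longrightarrow> transition_map y y'' = transition_map y y' ** transition_map y' y'')"
  proof eventually_elim
    case (elim x)
    show ?case
    proof
      assume x: "x \<in> S2"
      from elim(2) transition_map_eq[OF x] faces_shrink[OF x]
      show "\<forall>\<^sub>F x' in nhds x. x' \<in> S2 \<longrightarrow> transition_map y x' = transition_map y x ** transition_map x x'"
      proof eventually_elim
        case (elim x')
        show ?case
        proof
          assume x': "x' \<in> S2"
          then obtain f where f: "f \<in> faces T" "x' \<in> f" using faces_cover by blast
          then have "x' \<in> fcone f" using face_cone faces_face by blast
          then have "x \<in> f" using elim(3) f by blast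
          then have "transition_map y x = zloc y f ** rinv (zloc x f)"
            using \<open>x \<in> S2 \<longrightarrow> _\<close> x f by blast
          moreover have "transition_map y x' = zloc y f ** rinv (zloc x' f)" "transition_map x x' = zloc x f ** rinv (zloc x' f)"
            using elim(1,2) x' f by blast+
          ultimately show "transition_map y x' = transition_map y x ** transition_map x x'"
            using rotation_cancel(2)[OF zloc(1), of "zloc y f" x f] by (simp add: matrix_mul_assoc)
        qed
      qed
    qed
  qed
qed

text \<open>The product \<open>X y ** zloc y f\<close> is locally constant in \<open>y\<close> on
  the connected face \<open>f\<close>, and its value is the rotation of \<open>f\<close>. Each
  condition of \<open>compat\<close> is then read off at a point inside the edge that belongs to
  both faces.\<close>

theorem flip_sol_exists: "\<exists>R. flip_sol R"
proof -
  obtain X where X: "\<And>y. rotation_matrix (X y)"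
    "\<And>y. y \<in> S2 \<Longrightarrow> \<forall>\<^sub>F y' in nhds y. y' \<in> S2 \<longrightarrow> X y' = X y ** transition_map y y'"
    using trivial_S2 unfolding trivial_def trivialises_def by blast
  define s where "s y f = X y ** zloc y f" for y f
  have const: "s y f = s x f" if f: "f \<in> faces T" and yx: "y \<in> f" "x \<in> f" for f y x
  proof (rule connected_local_const[OF connected_face[OF faces_face[OF f]] yx], intro ballI)
    fix a assume a: "a \<in> f"
    then have aS: "a \<in> S2" using face_subset_S2 faces_face f by blast
    from X(2)[OF aS] transition_map_eq[OF aS] have "\<forall>\<^sub>F b in nhds a. b \<in> f \<longrightarrow> s a f = s b f"
    proof eventually_elim
      case (elim b)
      show ?case
      proof
        assume b: "b \<in> f"
        then have "b \<in> S2" using face_subset_S2 faces_face f by blast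
        then show "s a f = s b f" using elim b f rotation_cancel(2)[OF zloc(1), of _ b f]
          by (simp add: s_def matrix_mul_assoc)
      qed
    qed
    then show "\<forall>\<^sub>F b in at a within f. s a f = s b f"
      by (auto simp: eventually_at_filter elim: eventually_mono)
  qed
  define R where "R f = s (SOME y. y \<in> f) f" for f
  have R: "R f = s y f" if "f \<in> faces T" "y \<in> f" for f y
    unfolding R_def using const[OF that(1) _ that(2)] someI[of "\<lambda>y. y \<in> f", OF that(2)] by blast
  have "rotation_matrix (R f)" for f unfolding R_def s_def using X(1) zloc(1) rotation_mult by blast
  moreover have "compat R e" if e: "e \<in> edges T" for e
  proof -
    note E = edge_facts[OF e]
    have z: "compat (zloc (seg_point e t)) e" if "0 < t" "t < len e" for t
      using zloc(2)[OF e] that by (auto intro: seg_interiorI)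
    \<comment> \<open>\<open>bl e\<close> and \<open>wr e\<close> share the parameters up to the
      smaller of the two lengths, \<open>br e\<close> and \<open>wl e\<close> those from the larger
      one on; \<open>t0\<close> and \<open>t1\<close> are common points that are also inside the
      edge.\<close>
    define t0 where "t0 = min (lb e) (lw e)"
    define t1 where "t1 = max (lb e) (lw e)"
    have t0: "0 < t0" "t0 \<le> lb e" "t0 \<le> lw e" "t0 < len e" using E by (auto simp: t0_def)
    have t1: "0 < t1" "lb e \<le> t1" "lw e \<le> t1" "t1 < len e" using E by (auto simp: t1_def)
    have *: "R f = X (seg_point e t) ** zloc (seg_point e t) f" if "f \<in> faces T" "seg_point e t \<in> f" for f t
      using R[OF that] by (simp add: s_def)
    have "R (bl e) = R (wl e) ** half_turn (seg_point e (lb e))"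
      using z[of "lb e"] *[of "bl e" "lb e"] *[of "wl e" "lb e"] edge_points[OF e, of "lb e"] E(1-5,10-13)
      unfolding compat_def by (metis matrix_mul_assoc order_less_imp_le order_refl)
    moreover have "R (bl e) = R (wr e) ** half_turn (start e)"
      using z[of "t0"] *[of "bl e" "t0"] *[of "wr e" "t0"] edge_points[OF e, of "t0"] E(1-5,10-13) t0
      unfolding compat_def by (metis matrix_mul_assoc order_less_imp_le order_refl)
    moreover have "R (br e) = R (wr e) ** half_turn (seg_point e (lw e))"
      using z[of "lw e"] *[of "br e" "lw e"] *[of "wr e" "lw e"] edge_points[OF e, of "lw e"] E(1-5,10-13)
      unfolding compat_def by (metis matrix_mul_assoc order_less_imp_le order_refl)
    moreover have "R (br e) = R (wl e) ** half_turn (seg_point e (len e))"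
      using z[of "t1"] *[of "br e" "t1"] *[of "wl e" "t1"] edge_points[OF e, of "t1"] E(1-5,10-13) t1
      unfolding compat_def by (metis matrix_mul_assoc order_less_imp_le order_refl)
    ultimately show ?thesis by (simp add: compat_def)
  qed
  ultimately show ?thesis unfolding flip_sol_def by blast
qed

text \<open>The ratio of two solutions is the same for all faces through a point and locally
  constant in the point, and the sphere is connected.\<close>

theorem flip_sol_unique:
  assumes R: "flip_sol R" "flip_sol R'"
  shows "\<exists>A. rotation_matrix A \<and> (\<forall>f\<in>faces T. R' f = A ** R f)"
proof -
  define A where "A f = R' f ** rinv (R f)" for f
  define F where "F y = (SOME f. f \<in> faces T \<and> y \<in> f)" for y
  have F: "F y \<in> faces T \<and> y \<in> F y" if "y \<in> S2" for y
    unfolding F_def by (rule someI_ex) (use faces_cover that in blast)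
  have same: "A f = A h" if y: "y \<in> S2" and f: "f \<in> faces T" "y \<in> f" "h \<in> faces T" "y \<in> h" for y f h
    using y
  proof (cases rule: point_cases)
    case (1 k)
    then have "f = k" "h = k" using in_fint_unique f face_cone faces_face by blast+
    then show ?thesis by simp
  next
    case (2 e t)
    have "\<forall>f\<in>faces T. y \<in> fcone f \<longrightarrow> f \<in> edge_faces e"
      using eventually_nhds_x_imp_x[OF near_faces[OF 2(1-3)]] 2(4) by simp
    then have "f \<in> edge_faces e" "h \<in> edge_faces e" using f face_cone faces_face by blast+
    then show ?thesis using compat_ratio[OF 2(1)] R 2(1) unfolding A_def flip_sol_def by blast
  qed
  have const: "A (F y) = A (F x)" if yx: "y \<in> S2" "x \<in> S2" for y x
  proof (rule connected_local_const[OF _ yx], use connected_sphere[where 'a="real^3"] in simp, intro ballI)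
    fix a :: "real^3" assume a: "a \<in> S2"
    from faces_shrink[OF a] have "\<forall>\<^sub>F b in nhds a. b \<in> S2 \<longrightarrow> A (F a) = A (F b)"
    proof eventually_elim
      case (elim b)
      show ?case
      proof
        assume b: "b \<in> S2"
        then have "b \<in> fcone (F b)" using F face_cone faces_face by blast
        then have "a \<in> F b" using elim F b by blast
        then show "A (F a) = A (F b)" using same[OF a] F a b by blast
      qed
    qed
    then show "\<forall>\<^sub>F b in at a within S2. A (F a) = A (F b)"
      by (auto simp: eventually_at_filter elim: eventually_mono)
  qed
  have rot: "rotation_matrix (A f)" if "f \<in> faces T" for f
    using R that rotation_mult rotation_transpose(1) by (simp add: A_def flip_sol_def)
  define y0 :: "real^3" where "y0 = axis 1 1"
  have y0: "y0 \<in> S2" by (simp add: y0_def)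
  have "A f = A (F y0)" if f: "f \<in> faces T" for f
  proof -
    obtain x where x: "x \<in> S2" "x \<in> fint f" using fint_nonempty faces_face f by blast
    then have "x \<in> f" using face_mem[OF faces_face[OF f]] fint_sub_fcone by blast
    then show ?thesis using same[OF x(1) f] F[OF x(1)] const[OF x(1) y0] by metis
  qed
  moreover have "R' f = A f ** R f" if "f \<in> faces T" for f
    using R that by (simp add: A_def flip_sol_def rotation_cancel(2))
  ultimately show ?thesis using rot F y0 by metis
qed

end

subsection \<open>The flipped tiling\<close>

text \<open>The left side of the flipped edge is white for a length \<open>lw e\<close> and then
  black, so the edge begins \<open>lw e\<close> before the image of \<open>start e\<close> under the
  rotation of the black face.\<close>

definition (in rtiling) flip_edge :: "((real^3) set \<Rightarrow> real^3^3) \<Rightarrow> seg \<Rightarrow> seg" where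
  "flip_edge R e = Seg (R (bl e) *v seg_point e (- lw e)) (R (bl e) *v seg_tan e (- lw e)) (len e)"

definition (in rtiling) flipped :: "((real^3) set \<Rightarrow> real^3^3) \<Rightarrow> tiling" where
  "flipped R = Tiling ((\<lambda>f. (*v) (R f) ` f) ` black T) ((\<lambda>f. (*v) (R f) ` f) ` white T) (flip_edge R ` edges T)"

lemma eventually_rotation:
  assumes A: "rotation_matrix A" and P: "\<forall>\<^sub>F x in nhds y. P x"
  shows "\<forall>\<^sub>F x in nhds (A *v y). P (rinv A *v x)"
proof -
  have "filterlim ((*v) (rinv A)) (nhds (rinv A *v (A *v y))) (nhds (A *v y))"
    using rotation_tendsto[where A="rinv A" and x="A *v y"]
      tendsto_at_iff_tendsto_nhds[of "(*v) (rinv A)" "A *v y"] unfolding isCont_def by simp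
  then have "filterlim ((*v) (rinv A)) (nhds y) (nhds (A *v y))" by (simp add: rotation_transpose[OF A])
  then show ?thesis using P eventually_compose_filterlim[of P "nhds y" "(*v) (rinv A)" "nhds (A *v y)"] by simp
qed

lemma rotation_inner_left: "rotation_matrix A \<Longrightarrow> n \<bullet> (rinv A *v x) = (A *v n) \<bullet> x"
  by (simp add: rotation_inner_transpose)

locale flip = rtiling +
  fixes R :: "(real^3) set \<Rightarrow> real^3^3"
  assumes sol: "flip_sol R"
begin

abbreviation fe :: "seg \<Rightarrow> seg" where "fe \<equiv> flip_edge R"

definition im :: "(real^3) set \<Rightarrow> (real^3) set" where "im f = (*v) (R f) ` f"

lemma R_rot: "f \<in> faces T \<Longrightarrow> rotation_matrix (R f)"
  using sol by (simp add: flip_sol_def)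

lemma R_compat: "e \<in> edges T \<Longrightarrow> compat R e"
  using sol by (simp add: flip_sol_def)

lemma im_face: "f \<in> faces T \<Longrightarrow> face (im f)"
  unfolding im_def using rotation_face R_rot faces_face by blast

lemma im_fcone: "f \<in> faces T \<Longrightarrow> x \<in> fcone (im f) \<longleftrightarrow> rinv (R f) *v x \<in> fcone f"
  and im_fint: "f \<in> faces T \<Longrightarrow> x \<in> fint (im f) \<longleftrightarrow> rinv (R f) *v x \<in> fint f"
  and im_nrms: "f \<in> faces T \<Longrightarrow> nrms (im f) = (*v) (R f) ` nrms f"
  using R_rot by (simp_all add: im_def rotation_fcone rotation_fint rotation_nrms rotation_image_iff)

lemma fe_basic:
  assumes e: "e \<in> edges T"
  shows "geodesic_segment (fe e)" "nrm (fe e) = R (bl e) *v nrm e" "len (fe e) = len e"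
    "seg_point (fe e) t = R (bl e) *v seg_point e (t - lw e)"
    "seg_tan (fe e) t = R (bl e) *v seg_tan e (t - lw e)"
proof -
  note g = edges_geodesic[OF e] and r = R_rot[OF edge_facts(10)[OF e]]
  show "geodesic_segment (fe e)"
    using seg_frame[OF g] geodesic_segmentD[OF g] r
    by (simp add: flip_edge_def geodesic_segment_def rotation_inner norm_1_inner)
  show "nrm (fe e) = R (bl e) *v nrm e"
    using seg_frame[OF g] r by (simp add: flip_edge_def nrm_def[of "Seg _ _ _"] cross_rotation_matrix)
  show "len (fe e) = len e" by (simp add: flip_edge_def)
  show "seg_point (fe e) t = R (bl e) *v seg_point e (t - lw e)"
    using seg_point_add[of e "- lw e" t]
    by (simp add: flip_edge_def seg_point_def[of "Seg _ _ _"] matrix_vector_right_distrib matrix_vector_mult_scaleR)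
  show "seg_tan (fe e) t = R (bl e) *v seg_tan e (t - lw e)"
    using seg_tan_add[of e "- lw e" t]
    by (simp add: flip_edge_def seg_tan_def[of "Seg _ _ _"] matrix_vector_mult_diff_distrib matrix_vector_mult_scaleR)
qed

lemma R_white:
  assumes e: "e \<in> edges T"
  shows "R (wr e) = R (bl e) ** half_turn (start e)" "R (wl e) = R (bl e) ** half_turn (seg_point e (lb e))"
proof -
  have s: "start e \<in> S2" "seg_point e (lb e) \<in> S2"
    using seg_frame(8)[OF edges_geodesic[OF e], of 0] seg_frame(8)[OF edges_geodesic[OF e]] by auto
  show "R (wr e) = R (bl e) ** half_turn (start e)" "R (wl e) = R (bl e) ** half_turn (seg_point e (lb e))"
    using R_compat[OF e] half_turn_cancel s unfolding compat_def by metis+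
qed

text \<open>Composing with the half turns of \<open>compat\<close> gives shifts of the parameter for
  the black faces and reflections for the white ones. The reflections reverse the normal: the white
  faces change sides.\<close>

lemma fe_moves:
  assumes e: "e \<in> edges T"
  shows "R (bl e) *v seg_point e t = seg_point (fe e) (t + lw e)" "R (bl e) *v nrm e = nrm (fe e)"
    "R (wr e) *v seg_point e t = seg_point (fe e) (lw e - t)" "R (wr e) *v nrm e = - nrm (fe e)"
    "R (wl e) *v seg_point e t = seg_point (fe e) (len e + lb e - t)" "R (wl e) *v nrm e = - nrm (fe e)"
    "R (br e) *v seg_point e t = seg_point (fe e) (t - lw e)" "R (br e) *v nrm e = nrm (fe e)"
proof -
  note g = edges_geodesic[OF e] and b = fe_basic[OF e]
  show 1: "R (bl e) *v seg_point e t = seg_point (fe e) (t + lw e)" "R (bl e) *v nrm e = nrm (fe e)" for t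
    using b by simp_all
  have h0: "half_turn (start e) *v seg_point e t = seg_point e (- t)" "half_turn (start e) *v nrm e = - nrm e" for t
    using half_turn_seg[OF g, of 0] by simp_all
  show "R (wr e) *v seg_point e t = seg_point (fe e) (lw e - t)" "R (wr e) *v nrm e = - nrm (fe e)"
    unfolding R_white[OF e] matrix_vector_mul_assoc[symmetric] h0 matrix_vector_mult_minus 1
    by simp_all
  have l: "2 * lb e - t + lw e = len e + lb e - t" for t using edge_facts(5)[OF e] by simp
  show 2: "R (wl e) *v seg_point e t = seg_point (fe e) (len e + lb e - t)" "R (wl e) *v nrm e = - nrm (fe e)" for t
    unfolding R_white[OF e] matrix_vector_mul_assoc[symmetric] half_turn_seg[OF g] matrix_vector_mult_minus 1 l
    by simp_all
  have br: "R (br e) = R (wl e) ** half_turn (seg_point e (len e))" using R_compat[OF e] unfolding compat_def by blast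
  have l': "len e + lb e - (2 * len e - t) = t - lw e" using edge_facts(5)[OF e] by simp
  show "R (br e) *v seg_point e t = seg_point (fe e) (t - lw e)" "R (br e) *v nrm e = nrm (fe e)"
    unfolding br matrix_vector_mul_assoc[symmetric] half_turn_seg[OF g] matrix_vector_mult_minus 2 l'
    by simp_all
qed

text \<open>\<open>flip_edge\<close> refers to the left black face only; the position of
  \<open>br e\<close> found in \<open>fe_moves\<close> shows that the right black face leads to the
  same edge.\<close>

lemma fe_rev: assumes e: "e \<in> edges T" shows "fe (seg_rev e) = seg_rev (fe e)"
proof (rule seg_eqI)
  note e' = edges_rev[OF e] and g = edges_geodesic[OF e]
  show "geodesic_segment (fe (seg_rev e))" using fe_basic(1)[OF e'] .
  show "geodesic_segment (seg_rev (fe e))" using fe_basic(1)[OF e] by simp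
  show "len (fe (seg_rev e)) = len (seg_rev (fe e))" using fe_basic(3)[OF e] fe_basic(3)[OF e'] by simp
  have "nrm (fe (seg_rev e)) = R (br e) *v nrm (seg_rev e)" using fe_basic(2)[OF e'] by (simp add: br_def)
  also have "\<dots> = - nrm (fe e)" using fe_moves(8)[OF e] by (simp add: nrm_rev[OF g] matrix_vector_mult_minus)
  finally show "nrm (fe (seg_rev e)) = nrm (seg_rev (fe e))" using nrm_rev[OF fe_basic(1)[OF e]] by simp
  have "start (fe (seg_rev e)) = R (br e) *v seg_point e (len e + lw e)"
    using fe_basic(4)[OF e', of 0] lw_rev[OF e] by (simp add: br_def seg_point_rev)
  then show "start (fe (seg_rev e)) = start (seg_rev (fe e))" using fe_moves(7)[OF e] fe_basic(3)[OF e] by simp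
qed

lemma fe_edge_local:
  assumes e: "e \<in> edges T" and t: "0 < t" "t < len e" "t \<noteq> lw e"
  defines "f \<equiv> if t < lw e then wr e else bl e"
  shows "\<forall>\<^sub>F x in nhds (seg_point (fe e) t). (x \<in> fcone (im f) \<longleftrightarrow> 0 \<le> nrm (fe e) \<bullet> x) \<and> (x \<in> fint (im f) \<longleftrightarrow> 0 < nrm (fe e) \<bullet> x)"
proof (cases "t < lw e")
  case True
  note E = edge_facts[OF e] and g = edges_geodesic[OF e]
  have f: "f = wr e" using True by (simp add: f_def)
  have r: "rotation_matrix (R (wr e))" using R_rot E by blast
  have "\<forall>\<^sub>F x in nhds (seg_point (seg_rev e) (lb e + t)). (x \<in> fcone (wr e) \<longleftrightarrow> 0 \<le> nrm (seg_rev e) \<bullet> x) \<and> (x \<in> fint (wr e) \<longleftrightarrow> 0 < nrm (seg_rev e) \<bullet> x)"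
    by (rule edge_local[OF edges_rev[OF e]]) (use True t E bl_wl_lb(3)[OF e] in \<open>auto simp: wr_def\<close>)
  moreover have "seg_point (seg_rev e) (lb e + t) = seg_point e (lw e - t)" using E(5) by (simp add: seg_point_rev)
  ultimately have "\<forall>\<^sub>F x in nhds (seg_point e (lw e - t)). (x \<in> fcone (wr e) \<longleftrightarrow> 0 \<le> - nrm e \<bullet> x) \<and> (x \<in> fint (wr e) \<longleftrightarrow> 0 < - nrm e \<bullet> x)"
    using nrm_rev[OF g] by simp
  from eventually_rotation[OF r this] show ?thesis
    using fe_moves(3,4)[OF e] E
    by (simp add: f im_fcone im_fint rotation_inner_left[OF r] matrix_vector_mult_minus)
next
  case False
  note E = edge_facts[OF e] and g = edges_geodesic[OF e]
  have f: "f = bl e" using False by (simp add: f_def)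
  have r: "rotation_matrix (R (bl e))" using R_rot E by blast
  have "\<forall>\<^sub>F x in nhds (seg_point e (t - lw e)). (x \<in> fcone (bl e) \<longleftrightarrow> 0 \<le> nrm e \<bullet> x) \<and> (x \<in> fint (bl e) \<longleftrightarrow> 0 < nrm e \<bullet> x)"
    by (rule edge_local[OF e]) (use False t E in auto)
  from eventually_rotation[OF r this] show ?thesis
    using fe_moves(1,2)[OF e] E by (simp add: f im_fcone im_fint rotation_inner_left[OF r])
qed

text \<open>The flip exchanges the roles of the two edges at a corner: \<open>e\<close> started
  inside \<open>e0\<close>, and now \<open>fe e0\<close> ends inside \<open>fe e\<close>, between
  its white and its black face.\<close>

lemma fe_corner_local:
  assumes c: "corner e0 e"
  shows "\<forall>\<^sub>F x in nhds (seg_point (fe e) (lw e)).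
     (x \<in> fcone (im (bl e)) \<longleftrightarrow> 0 \<le> nrm (fe e0) \<bullet> x \<and> 0 \<le> nrm (fe e) \<bullet> x) \<and>
     (x \<in> fint (im (bl e)) \<longleftrightarrow> 0 < nrm (fe e0) \<bullet> x \<and> 0 < nrm (fe e) \<bullet> x) \<and>
     (x \<in> fcone (im (wr e)) \<longleftrightarrow> nrm (fe e0) \<bullet> x \<le> 0 \<and> 0 \<le> nrm (fe e) \<bullet> x) \<and>
     (x \<in> fint (im (wr e)) \<longleftrightarrow> nrm (fe e0) \<bullet> x < 0 \<and> 0 < nrm (fe e) \<bullet> x)"
    "seg_point (fe e) (lw e) = seg_point (fe e0) (len (fe e0))"
proof -
  have e: "e0 \<in> edges T" "e \<in> edges T" "start e = seg_point e0 (lb e0)" "bl e0 = bl e" "wl e0 = wr e" using c by (auto simp: corner_def)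
  note E = edge_facts[OF e(2)]
  have r: "rotation_matrix (R (bl e))" "rotation_matrix (R (wr e))" using R_rot E by blast+
  have b: "R (bl e) *v start e = seg_point (fe e) (lw e)" "R (bl e) *v nrm e = nrm (fe e)" "R (bl e) *v nrm e0 = nrm (fe e0)"
    using fe_moves(1)[OF e(2), of 0] fe_moves(2)[OF e(2)] fe_moves(2)[OF e(1)] e by simp_all
  have w: "R (wr e) *v start e = seg_point (fe e) (lw e)" "R (wr e) *v nrm e = - nrm (fe e)" "R (wr e) *v nrm e0 = - nrm (fe e0)"
    using fe_moves(3)[OF e(2), of 0] fe_moves(4)[OF e(2)] fe_moves(6)[OF e(1)] e by simp_all
  show "seg_point (fe e) (lw e) = seg_point (fe e0) (len (fe e0))"
    using b(1) fe_moves(1)[OF e(1), of "lb e0"] e fe_basic(3)[OF e(1)] edge_facts(5)[OF e(1)] by simp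
  from eventually_rotation[OF r(1) corner_local[OF c]] eventually_rotation[OF r(2) corner_local[OF c]]
  show "\<forall>\<^sub>F x in nhds (seg_point (fe e) (lw e)).
     (x \<in> fcone (im (bl e)) \<longleftrightarrow> 0 \<le> nrm (fe e0) \<bullet> x \<and> 0 \<le> nrm (fe e) \<bullet> x) \<and>
     (x \<in> fint (im (bl e)) \<longleftrightarrow> 0 < nrm (fe e0) \<bullet> x \<and> 0 < nrm (fe e) \<bullet> x) \<and>
     (x \<in> fcone (im (wr e)) \<longleftrightarrow> nrm (fe e0) \<bullet> x \<le> 0 \<and> 0 \<le> nrm (fe e) \<bullet> x) \<and>
     (x \<in> fint (im (wr e)) \<longleftrightarrow> nrm (fe e0) \<bullet> x < 0 \<and> 0 < nrm (fe e) \<bullet> x)"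
    unfolding b(1) w(1)
  proof eventually_elim
    case (elim x)
    then show ?case
      using E(10,13) by (simp add: im_fcone im_fint rotation_inner_left[OF r(1)] rotation_inner_left[OF r(2)] b w)
  qed
qed

lemma fe_left_cover:
  assumes e: "e \<in> edges T" and t: "0 < t" "t < len e"
  shows "\<forall>\<^sub>F x in nhds (seg_point (fe e) t). 0 \<le> nrm (fe e) \<bullet> x \<longrightarrow> x \<in> fcone (im (bl e)) \<or> x \<in> fcone (im (wr e))"
proof (cases "t = lw e")
  case True
  obtain e0 where c: "corner e0 e" using corner_to[OF e] by blast
  from fe_corner_local(1)[OF c] show ?thesis unfolding True by eventually_elim auto
next
  case False
  from fe_edge_local[OF e t False] show ?thesis by eventually_elim (auto split: if_splits)
qed

lemma fe_cover:
  assumes e: "e \<in> edges T" and t: "0 < t" "t < len e"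
  shows "\<forall>\<^sub>F x in nhds (seg_point (fe e) t). \<exists>f\<in>faces T. x \<in> fcone (im f)"
proof -
  have t': "0 < len e - t" "len e - t < len (seg_rev e)" using t by auto
  have "seg_point (fe (seg_rev e)) (len e - t) = seg_point (fe e) t" "nrm (fe (seg_rev e)) = - nrm (fe e)"
    using fe_rev[OF e] fe_basic[OF e] by (simp_all add: seg_point_rev)
  with fe_left_cover[OF edges_rev[OF e] t']
  have "\<forall>\<^sub>F x in nhds (seg_point (fe e) t). 0 \<le> - nrm (fe e) \<bullet> x \<longrightarrow> x \<in> fcone (im (br e)) \<or> x \<in> fcone (im (wl e))"
    using wr_rev[OF e] by (simp add: br_def)
  with fe_left_cover[OF e t] show ?thesis
  proof eventually_elim
    case (elim x)
    have "0 \<le> nrm (fe e) \<bullet> x \<or> 0 \<le> - nrm (fe e) \<bullet> x" by auto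
    then show ?case using elim edge_facts(10-13)[OF e] by blast
  qed
qed

text \<open>Even vertices are carried inside a flipped edge: \<open>start e\<close> goes to the
  parameter \<open>lw e\<close> of \<open>fe e\<close>. Thus \<open>fe_cover\<close> reaches all
  boundary points.\<close>

lemma boundary_image:
  assumes f: "f \<in> faces T" "x \<in> f" "x \<notin> fint f"
  shows "\<exists>e t. e \<in> edges T \<and> 0 < t \<and> t < len e \<and> R f *v x = seg_point (fe e) t"
proof -
  have "x \<in> fcone f" using f face_cone faces_face by blast
  then obtain m where m: "m \<in> nrms f" "m \<bullet> x = 0" using f by (force simp: fint_def fcone_def order_less_le)
  have corner: ?thesis if "corner e0 e" "x = start e" "f = bl e \<or> f = wr e" for e0 e
  proof -
    have e: "e \<in> edges T" using that by (auto simp: corner_def)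
    then have "R f *v x = seg_point (fe e) (lw e)"
      using fe_moves(1,3)[OF e, of 0] that by auto
    then show ?thesis using e edge_facts[OF e] by blast
  qed
  show ?thesis
  proof (cases "f \<in> black T")
    case True
    then obtain e t where e: "e \<in> edges T" "f = bl e" "x = seg_point e t" "0 \<le> t" "t \<le> lb e" using black_edge_at[OF True m(1) f(2) m(2)] by metis
    note E = edge_facts[OF e(1)]
    show ?thesis
    proof (cases "t = lb e")
      case True
      obtain e2 where "corner e e2" using corner_from[OF e(1)] by blast
      then show ?thesis using corner[of e e2] e True by (auto simp: corner_def)
    next
      case False
      then show ?thesis using e E fe_moves(1)[OF e(1), of t] by (intro exI[of _ e] exI[of _ "t + lw e"]) auto
    qed
  next
    case False
    then have "f \<in> white T" using f by (auto simp: faces_def)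
    then obtain e t where e: "e \<in> edges T" "f = wr e" "x = seg_point e t" "0 \<le> t" "t \<le> lw e" using white_edge_at[OF _ m(1) f(2) m(2)] by metis
    note E = edge_facts[OF e(1)]
    show ?thesis
    proof (cases "t = lw e")
      case True
      obtain e2 where c: "corner (seg_rev e) e2" using corner_from[OF edges_rev[OF e(1)]] by blast
      have "seg_point (seg_rev e) (lb (seg_rev e)) = x"
        using bl_wl_lb(3)[OF e(1)] E(5) True e by (simp add: seg_point_rev)
      then show ?thesis using corner[OF c] c e by (auto simp: corner_def wr_def)
    next
      case False
      then show ?thesis using e E fe_moves(3)[OF e(1), of t] by (intro exI[of _ e] exI[of _ "lw e - t"]) auto
    qed
  qed
qed

text \<open>The union is closed, and it is open because the faces around a flipped edge again fill a
  neighbourhood of each of its interior points.\<close>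
lemma im_cover: "(\<Union>f\<in>faces T. im f) = S2"
proof -
  let ?Y = "\<Union>f\<in>faces T. im f"
  have sub: "?Y \<subseteq> S2" using im_face face_subset_S2 by blast
  have cl: "closed ?Y" using finite_faces im_face closed_face by (intro closed_UN) auto
  have op: "\<forall>\<^sub>F z in nhds y. z \<in> S2 \<longrightarrow> z \<in> ?Y" if y: "y \<in> ?Y" for y
  proof -
    obtain f x where f: "f \<in> faces T" "x \<in> f" "y = R f *v x" using y by (auto simp: im_def)
    show ?thesis
    proof (cases "x \<in> fint f")
      case True
      then have "y \<in> fint (im f)" using f im_fint rotation_transpose(4)[OF R_rot] by simp
      then have "\<forall>\<^sub>F z in nhds y. z \<in> fint (im f)" using open_fint im_face f by (intro eventually_nhds_in_open) auto
      then show ?thesis by eventually_elim (use f im_face face_cone fint_sub_fcone in blast)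
    next
      case False
      then obtain e t where "e \<in> edges T" "0 < t" "t < len e" "y = seg_point (fe e) t" using boundary_image f by blast
      then have "\<forall>\<^sub>F x in nhds y. \<exists>f\<in>faces T. x \<in> fcone (im f)" using fe_cover by blast
      then show ?thesis by eventually_elim (use im_face face_cone in blast)
    qed
  qed
  have "openin (top_of_set S2) ?Y"
  proof (subst openin_subopen, intro ballI)
    fix y assume y: "y \<in> ?Y"
    obtain U where U: "open U" "y \<in> U" "\<forall>z\<in>U. z \<in> S2 \<longrightarrow> z \<in> ?Y" using op[OF y] by (auto simp: eventually_nhds)
    have "openin (top_of_set S2) (S2 \<inter> U)" using U(1) by blast
    moreover have "y \<in> S2 \<inter> U" "S2 \<inter> U \<subseteq> ?Y" using U sub y by blast+
    ultimately show "\<exists>T'. openin (top_of_set S2) T' \<and> y \<in> T' \<and> T' \<subseteq> ?Y" by blast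
  qed
  moreover have "closedin (top_of_set S2) ?Y" using cl sub by (simp add: closed_subset)
  moreover have "connected (S2 :: (real^3) set)" using connected_sphere[where 'a="real^3"] by simp
  moreover have "?Y \<noteq> {}"
  proof -
    have "(axis 1 1 :: real^3) \<in> S2" by simp
    then obtain f where "f \<in> faces T" "axis 1 1 \<in> f" using faces_cover by blast
    then show ?thesis by (auto simp: im_def)
  qed
  ultimately show ?thesis using connected_clopen by metis
qed

text \<open>Its volume is a third of the area of the face, so areas are compared by Lebesgue measure
  in R^3.\<close>

definition sector :: "(real^3) set \<Rightarrow> (real^3) set" where
  "sector f = fcone f \<inter> cball 0 1"

lemma sector_measurable: "sector f \<in> lmeasurable"
  unfolding sector_def by (intro lmeasurable_compact closed_Int_compact closed_fcone compact_cball)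

lemma sector_cover:
  assumes F: "\<And>f. f \<in> F \<Longrightarrow> face f" and cov: "\<Union>F = S2" shows "(\<Union>f\<in>F. sector f) = cball 0 1"
proof
  show "cball 0 1 \<subseteq> (\<Union>f\<in>F. sector f)"
  proof
    fix x :: "real^3" assume x: "x \<in> cball 0 1"
    obtain y where y: "y \<in> S2" "x = norm x *\<^sub>R y"
    proof (cases "x = 0")
      case True then show ?thesis using that[of "axis 1 1"] by simp
    next
      case False then show ?thesis using that[of "x /\<^sub>R norm x"] by simp
    qed
    obtain f where f: "f \<in> F" "y \<in> f" using cov y by blast
    then have "y \<in> fcone f" using F face_cone by blast
    then have "norm x *\<^sub>R y \<in> fcone f" by (simp add: fcone_def)
    then show "x \<in> (\<Union>f\<in>F. sector f)" using f x y by (auto simp: sector_def)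
  qed
qed (auto simp: sector_def)

text \<open>The rotated faces have the same total area as the sphere, hence cannot overlap.\<close>
lemma im_disjoint:
  assumes f: "f \<in> faces T" "h \<in> faces T" and x: "x \<in> fint (im f)" "x \<in> fint (im h)"
  shows "f = h"
proof (rule ccontr)
  assume ne: "f \<noteq> h"
  let ?\<mu> = "measure lebesgue"
  have im_sector: "sector (im k) = (*v) (R k) ` sector k" if "k \<in> faces T" for k
    by (rule set_eqI) (simp add: sector_def rotation_image_iff R_rot that im_fcone rotation_transpose(1))
  have mu: "?\<mu> (sector (im k)) = ?\<mu> (sector k)" if "k \<in> faces T" for k
  proof -
    have "orthogonal_transformation ((*v) (R k))"
      using R_rot[OF that] by (simp add: orthogonal_transformation_matrix rotation_matrix_def matrix_of_matrix_vector_mul)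
    then show ?thesis unfolding im_sector[OF that] by (rule measure_orthogonal_image[OF _ sector_measurable])
  qed
  have neg: "negligible (sector k \<inter> sector l)" if kl: "k \<in> faces T" "l \<in> faces T" "k \<noteq> l" for k l
  proof (rule negligible_subset)
    show "sector k \<inter> sector l \<subseteq> \<Union> ((\<lambda>n. {x. n \<bullet> x = 0}) ` nrms k)"
    proof
      fix x assume "x \<in> sector k \<inter> sector l"
      then have "x \<in> fcone k" "x \<notin> fint k" using in_fint_unique[OF kl(1) _ kl(2)] kl(3) by (auto simp: sector_def)
      then show "x \<in> \<Union> ((\<lambda>n. {x. n \<bullet> x = 0}) ` nrms k)" by (force simp: fcone_def fint_def order_less_le)
    qed
    show "negligible (\<Union> ((\<lambda>n. {x. n \<bullet> x = 0}) ` nrms k))"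
    proof (rule negligible_Union)
      show "finite ((\<lambda>n. {x. n \<bullet> x = 0}) ` nrms k)" using face_min(1) faces_face kl by blast
      fix t assume "t \<in> (\<lambda>n. {x. n \<bullet> x = 0}) ` nrms k"
      then obtain n where "n \<in> nrms k" "t = {x. n \<bullet> x = 0}" by blast
      then show "negligible t" using negligible_hyperplane[of n 0] nrms_S2(3)[of n k] by (metis norm_zero zero_neq_one)
    qed
  qed
  have "?\<mu> (\<Union>k\<in>faces T. sector k) = (\<Sum>k\<in>faces T. ?\<mu> (sector k))"
    by (rule measure_negligible_finite_Union_image) (use finite_faces sector_measurable neg in \<open>auto simp: pairwise_def\<close>)
  moreover have "(\<Union>k\<in>faces T. sector k) = cball 0 1" using sector_cover faces_face faces_cover by blast
  ultimately have tot: "?\<mu> (cball (0::real^3) 1) = (\<Sum>k\<in>faces T. ?\<mu> (sector (im k)))" using mu by simp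
  have cov: "(\<Union>k\<in>faces T. sector (im k)) = cball 0 1"
  proof -
    have "\<Union> (im ` faces T) = S2" using im_cover .
    moreover have "face k" if "k \<in> im ` faces T" for k using im_face that by blast
    ultimately have "(\<Union>k\<in>im ` faces T. sector k) = cball 0 1" using sector_cover[of "im ` faces T"] by blast
    then show ?thesis by simp
  qed
  define V where "V = fint (im f) \<inter> fint (im h) \<inter> ball 0 1"
  have oV: "open V" unfolding V_def using open_fint im_face f by blast
  define c where "c = inverse (2 * (1 + norm x))"
  have np: "0 < 1 + norm x" by (rule add_pos_nonneg) auto
  then have c: "0 < c" "c * norm x < 1" by (auto simp: c_def field_simps)
  have "c *\<^sub>R x \<in> V" using c x by (simp add: V_def fint_scale)
  then have "\<not> negligible V" using oV open_not_negligible by blast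
  moreover have mV: "V \<in> lmeasurable" using oV by (intro lmeasurable_open) (auto simp: V_def intro: bounded_subset[OF bounded_ball])
  ultimately have posV: "0 < ?\<mu> V" by (metis negligible_iff_measure measure_nonneg order_le_less)
  have Vsub: "V \<subseteq> sector (im f)" "V \<subseteq> sector (im h)" using fint_sub_fcone by (auto simp: V_def sector_def)
  \<comment> \<open>\<open>V\<close> is counted in two sectors; taking it away from that of
    \<open>f\<close> still leaves a cover of the ball, but one whose total volume is too
    small.\<close>
  define D where "D k = (if k = f then sector (im f) - V else sector (im k))" for k
  have mD: "D k \<in> lmeasurable" for k using sector_measurable mV by (auto simp: D_def intro: fmeasurable.Diff)
  have "(\<Union>k\<in>faces T. D k) = cball 0 1"
    unfolding cov[symmetric] using Vsub f ne by (auto simp: D_def split: if_splits)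
  then have "?\<mu> (cball (0::real^3) 1) \<le> (\<Sum>k\<in>faces T. ?\<mu> (D k))"
    using measure_UNION_le[OF finite_faces, of D lebesgue] mD by (metis fmeasurableD)
  also have "\<dots> = ?\<mu> (D f) + (\<Sum>k\<in>faces T - {f}. ?\<mu> (D k))" using finite_faces f by (simp add: sum.remove)
  also have "(\<Sum>k\<in>faces T - {f}. ?\<mu> (D k)) = (\<Sum>k\<in>faces T - {f}. ?\<mu> (sector (im k)))"
    by (rule sum.cong) (auto simp: D_def)
  also have "?\<mu> (D f) = ?\<mu> (sector (im f)) - ?\<mu> V"
    using Vsub measurable_measure_Diff[OF sector_measurable _ Vsub(1)] mV by (auto simp: D_def fmeasurableD)
  also have "?\<mu> (sector (im f)) - ?\<mu> V + (\<Sum>k\<in>faces T - {f}. ?\<mu> (sector (im k))) = (\<Sum>k\<in>faces T. ?\<mu> (sector (im k))) - ?\<mu> V"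
    using finite_faces f by (simp add: sum.remove)
  finally show False using tot posV by simp
qed

end

lemma infinite_common_interior:
  assumes b: "infinite b" "b \<subseteq> seg_set u" "b \<subseteq> seg_set v"
  shows "\<exists>x. x \<in> seg_interior u \<and> x \<in> seg_interior v"
proof -
  have "infinite (b - (seg_point u ` {0, len u} \<union> seg_point v ` {0, len v}))" using b(1) by (intro Diff_infinite_finite) auto
  then have "b - (seg_point u ` {0, len u} \<union> seg_point v ` {0, len v}) \<noteq> {}" by (rule infinite_imp_nonempty)
  then obtain x where x: "x \<in> b" "x \<notin> seg_point u ` {0, len u}" "x \<notin> seg_point v ` {0, len v}" by blast
  have "x \<in> seg_interior w" if w: "x \<in> seg_set w" "x \<notin> seg_point w ` {0, len w}" for w
  proof -
    obtain t where t: "0 \<le> t" "t \<le> len w" "x = seg_point w t" using w by (auto simp: seg_set_def seg_arc_def)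
    then have "t \<noteq> 0" "t \<noteq> len w" using w(2) by blast+
    then show ?thesis using t by (auto simp: seg_interior_def)
  qed
  then show ?thesis using x b by blast
qed

context rtiling
begin

lemma face_edge_edge_faces:
  assumes f: "f \<in> faces T" and a: "a \<in> polygon_edges f"
  obtains e where "e \<in> edges T" "f \<in> edge_faces e" "a = f \<inter> {x. nrm e \<bullet> x = 0}" "a \<subseteq> seg_set e"
proof -
  obtain m where m: "m \<in> nrms f" "a = f \<inter> {x. m \<bullet> x = 0}" using a by (auto simp: polygon_edges_nrms)
  obtain e where e: "e \<in> edges T" "m = nrm e" "f = bl e \<or> f = wl e" using face_edge[OF f m(1)] by blast
  have "seg_arc e p q \<subseteq> seg_set e" if "0 \<le> p" "q \<le> len e" for p q
    using that by (auto simp: seg_set_def seg_arc_def)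
  note sub = this
  have "a \<subseteq> seg_set e"
    using e(3)
  proof
    assume "f = bl e" then show ?thesis using sub edge_facts(1,2,22)[OF e(1)] m(2) e(2) by simp
  next
    assume "f = wl e" then show ?thesis using sub edge_facts(1,2,23)[OF e(1)] m(2) e(2) by simp
  qed
  then show thesis using that[of e] e m by (auto simp: edge_faces_def)
qed

lemma edge_faces_edge:
  assumes e: "e \<in> edges T" and f: "f \<in> edge_faces e"
  shows "f \<inter> {x. nrm e \<bullet> x = 0} \<in> polygon_edges f" "f \<inter> {x. nrm e \<bullet> x = 0} \<subseteq> seg_set e"
proof -
  note E = edge_facts[OF e]
  have neg: "{x. nrm e \<bullet> x = 0} = {x. - nrm e \<bullet> x = 0}" by auto
  have "nrm e \<in> nrms f \<or> - nrm e \<in> nrms f" using f E(18-21) by (auto simp: edge_faces_def)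
  then show "f \<inter> {x. nrm e \<bullet> x = 0} \<in> polygon_edges f"
    unfolding polygon_edges_nrms using neg by blast
  have sub: "seg_arc e p q \<subseteq> seg_set e" if "0 \<le> p" "q \<le> len e" for p q
    using that by (auto simp: seg_set_def seg_arc_def)
  consider "f = bl e" | "f = wl e" | "f = br e" | "f = wr e" using f by (auto simp: edge_faces_def)
  then show "f \<inter> {x. nrm e \<bullet> x = 0} \<subseteq> seg_set e"
    by cases (use sub E(1-4,22-25) in simp_all)
qed

lemma edge_faces_edge_iff:
  assumes e: "e \<in> edges T" "e' \<in> edges T" and f: "f \<in> edge_faces e"
  shows "f \<inter> {x. nrm e \<bullet> x = 0} \<subseteq> seg_set e' \<longleftrightarrow> e' = e \<or> e' = seg_rev e"
proof
  assume "f \<inter> {x. nrm e \<bullet> x = 0} \<subseteq> seg_set e'"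
  moreover have "infinite (f \<inter> {x. nrm e \<bullet> x = 0})"
    using edge_faces_edge(1)[OF e(1) f] by (auto simp: polygon_edges_def)
  ultimately show "e' = e \<or> e' = seg_rev e"
    using infinite_common_interior[OF _ edge_faces_edge(2)[OF e(1) f]] edges_cross[OF e] by blast
qed (use edge_faces_edge(2)[OF e(1) f] in auto)

lemma incident_edge_faces:
  assumes f: "f \<in> faces T" "a \<in> polygon_edges f" and e: "e \<in> edges T" "a \<subseteq> seg_set e"
  shows "f \<in> edge_faces e"
proof -
  obtain e1 where e1: "e1 \<in> edges T" "f \<in> edge_faces e1" "a = f \<inter> {x. nrm e1 \<bullet> x = 0}" "a \<subseteq> seg_set e1"
    using face_edge_edge_faces[OF f] .
  then have "e = e1 \<or> e = seg_rev e1" using edge_faces_edge_iff[OF e1(1) e(1) e1(2)] e(2) by simp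
  then show ?thesis using e1 edge_faces_rev[OF e1(1)] by auto
qed

end

context flip
begin

lemma im_unique:
  assumes f: "f \<in> faces T" "x \<in> fint (im f)" and h: "h \<in> faces T" "x \<in> fcone (im h)" shows "h = f"
proof -
  have "\<forall>\<^sub>F z in nhds x. z \<in> fint (im f)" using open_fint im_face f by (intro eventually_nhds_in_open) auto
  then obtain z where "z \<in> fint (im h)" "z \<in> fint (im f)" using face_accum[OF im_face[OF h(1)] h(2), of _ "{}"] by auto
  then show ?thesis using im_disjoint f h by blast
qed

lemma im_inj: "f \<in> faces T \<Longrightarrow> h \<in> faces T \<Longrightarrow> im f = im h \<Longrightarrow> f = h"
  using im_disjoint fint_nonempty im_face by metis

lemma fe_points:
  assumes e: "e \<in> edges T"
  shows "0 \<le> t \<Longrightarrow> t \<le> lw e \<Longrightarrow> seg_point (fe e) t \<in> im (wr e)" "lw e \<le> t \<Longrightarrow> t \<le> len e \<Longrightarrow> seg_point (fe e) t \<in> im (bl e)"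
    "0 \<le> t \<Longrightarrow> t \<le> lb e \<Longrightarrow> seg_point (fe e) t \<in> im (br e)" "lb e \<le> t \<Longrightarrow> t \<le> len e \<Longrightarrow> seg_point (fe e) t \<in> im (wl e)"
proof -
  note E = edge_facts(5)[OF e] and m = fe_moves[OF e] and p = edge_points[OF e]
  show "seg_point (fe e) t \<in> im (wr e)" if "0 \<le> t" "t \<le> lw e"
    using m(3)[of "lw e - t"] p(3)[of "lw e - t"] that by (simp add: im_def) (metis image_eqI)
  show "seg_point (fe e) t \<in> im (bl e)" if "lw e \<le> t" "t \<le> len e"
    using m(1)[of "t - lw e"] p(1)[of "t - lw e"] that E by (simp add: im_def) (metis image_eqI)
  show "seg_point (fe e) t \<in> im (br e)" if "0 \<le> t" "t \<le> lb e"
    using m(7)[of "t + lw e"] p(4)[of "t + lw e"] that E by (simp add: im_def) (metis image_eqI)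
  show "seg_point (fe e) t \<in> im (wl e)" if "lb e \<le> t" "t \<le> len e"
    using m(5)[of "len e + lb e - t"] p(2)[of "len e + lb e - t"] that E by (simp add: im_def) (metis image_eqI)
qed

text \<open>Such a point belongs to a face image on the left and to one on the right, coming from
  different faces, while a point inside a face image belongs to no other.\<close>

lemma fe_not_interior:
  assumes e: "e \<in> edges T" and t: "0 \<le> t" "t \<le> len e" and f: "f \<in> faces T"
  shows "seg_point (fe e) t \<notin> fint (im f)"
proof
  assume x: "seg_point (fe e) t \<in> fint (im f)"
  note E = edge_facts[OF e]
  have eq: "h = f" if "h \<in> faces T" "seg_point (fe e) t \<in> im h" for h
    using im_unique[OF f x that(1)] that face_cone im_face by blast
  have "wr e = f \<or> bl e = f" using eq fe_points(1,2)[OF e, of t] t E by (metis linear)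
  moreover have "br e = f \<or> wl e = f" using eq fe_points(3,4)[OF e, of t] t E by (metis linear)
  ultimately show False using edge_faces_distinct[OF e] by auto
qed

text \<open>A little ahead of \<open>y\<close>, one face image fills the left side of each flipped
  edge. These images overlap, so they come from the same face with the same rotation; hence
  \<open>e\<close> and \<open>e'\<close> have the same normal and a common face.\<close>

lemma fe_overlap:
  assumes e: "e \<in> edges T" "e' \<in> edges T" and n: "nrm (fe e) = nrm (fe e')"
    and y: "y \<in> seg_interior (fe e)" "y \<in> seg_interior (fe e')"
  shows "e = e'"
proof -
  obtain t where t: "0 < t" "t < len e" "y = seg_point (fe e) t" using y(1) fe_basic(3)[OF e(1)] by (auto simp: seg_interior_def)
  obtain t' where t': "0 < t'" "t' < len e'" "y = seg_point (fe e') t'" using y(2) fe_basic(3)[OF e(2)] by (auto simp: seg_interior_def)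
  note g = fe_basic(1)[OF e(1)] fe_basic(1)[OF e(2)]
  have tan: "seg_tan u r = cross3 (nrm u) (seg_point u r)" if "geodesic_segment u" for u r
    using seg_frame(1,3,6)[OF that, of r] by (metis (no_types, lifting) Lagrange cross_skew inner_commute scaleR_one scale_zero_left diff_zero minus_diff_eq)
  have shift: "seg_point (fe e) (t + s) = seg_point (fe e') (t' + s)" for s
    using tan[OF g(1), of t] tan[OF g(2), of t'] n t(3) t'(3) by (simp add: seg_point_add)
  \<comment> \<open>The distances from \<open>y\<close> to the ends of the two edges and to the
    colour changes still ahead; half of the least one is a step that stops short of all of
    them.\<close>
  define A where "A = {len e - t, len e' - t'} \<union> {d. d > 0 \<and> (d = lw e - t \<or> d = lw e' - t')}"
  define M where "M = Min A"
  have fA: "finite A" "A \<noteq> {}" "\<And>a. a \<in> A \<Longrightarrow> 0 < a" using t t' by (auto simp: A_def)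
  have M: "M > 0" "\<And>a. a \<in> A \<Longrightarrow> M \<le> a"
    unfolding M_def using fA by (simp_all add: Min_gr_iff)
  define s where "s = M / 2"
  have s: "0 < s" "\<And>a. a \<in> A \<Longrightarrow> s < a" using M by (fastforce simp: s_def)+
  have r: "0 < t + s" "t + s < len e" "0 < t' + s" "t' + s < len e'" "t + s \<noteq> lw e" "t' + s \<noteq> lw e'"
  proof -
    have "s < len e - t" "s < len e' - t'" by (rule s(2), simp add: A_def)+
    then show "0 < t + s" "t + s < len e" "0 < t' + s" "t' + s < len e'" using s(1) t t' by auto
    show "t + s \<noteq> lw e"
    proof
      assume eq: "t + s = lw e"
      have "s < lw e - t" by (rule s(2)) (use eq s(1) in \<open>simp add: A_def\<close>)
      then show False using eq by simp
    qed
    show "t' + s \<noteq> lw e'"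
    proof
      assume eq: "t' + s = lw e'"
      have "s < lw e' - t'" by (rule s(2)) (use eq s(1) in \<open>simp add: A_def\<close>)
      then show False using eq by simp
    qed
  qed
  let ?z = "seg_point (fe e) (t + s)"
  define f where "f = (if t + s < lw e then wr e else bl e)"
  define f' where "f' = (if t' + s < lw e' then wr e' else bl e')"
  have ff: "f \<in> faces T" "f' \<in> faces T" using edge_facts e by (auto simp: f_def f'_def)
  have "\<forall>\<^sub>F x in nhds ?z. (x \<in> fint (im f) \<longleftrightarrow> 0 < nrm (fe e) \<bullet> x)"
    using fe_edge_local[OF e(1) r(1,2,5)] unfolding f_def by eventually_elim blast
  moreover have "\<forall>\<^sub>F x in nhds ?z. (x \<in> fint (im f') \<longleftrightarrow> 0 < nrm (fe e) \<bullet> x)"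
    using fe_edge_local[OF e(2) r(3,4,6)] unfolding f'_def shift[symmetric] n by eventually_elim blast
  ultimately have ev: "\<forall>\<^sub>F x in nhds ?z. x \<in> fint (im f) \<longrightarrow> x \<in> fint (im f')" by eventually_elim blast
  have "?z \<in> im f" using fe_points(1,2)[OF e(1), of "t + s"] r by (auto simp: f_def)
  then have "?z \<in> fcone (im f)" using face_cone im_face ff by blast
  then obtain x where "x \<in> fint (im f)" "x \<in> fint (im f')" using face_accum[OF im_face[OF ff(1)] _ ev, of "{}"] by auto
  then have same: "f = f'" using im_disjoint ff by blast
  have black: "f \<in> black T \<longleftrightarrow> \<not> t + s < lw e" "f' \<in> black T \<longleftrightarrow> \<not> t' + s < lw e'"
    using edge_facts(6,9) e black_white by (auto simp: f_def f'_def)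
  have cases: "bl e = bl e' \<or> wr e = wr e'" "f = bl e \<and> f = bl e' \<or> f = wr e \<and> f = wr e'"
    using same black by (auto simp: f_def f'_def split: if_splits)
  have "nrm e = nrm e'"
  proof (rule rotation_inj[OF R_rot[OF ff(1)]])
    show "R f *v nrm e = R f *v nrm e'"
      using cases(2) fe_moves(2,4)[OF e(1)] fe_moves(2,4)[OF e(2)] n by metis
  qed
  then show ?thesis using same_normal[OF e] cases(1) by blast
qed

lemma fe_overlap':
  assumes e: "e \<in> edges T" "e' \<in> edges T" and n: "nrm (fe e) = nrm (fe e') \<or> nrm (fe e) = - nrm (fe e')"
    and y: "y \<in> seg_interior (fe e)" "y \<in> seg_interior (fe e')"
  shows "e' = e \<or> e' = seg_rev e"
  using n
proof
  assume "nrm (fe e) = nrm (fe e')" then show ?thesis using fe_overlap[OF e] y by blast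
next
  assume n: "nrm (fe e) = - nrm (fe e')"
  have "nrm (fe (seg_rev e')) = nrm (fe e)" using n fe_rev[OF e(2)] fe_basic(1)[OF e(2)] by simp
  moreover have "y \<in> seg_interior (fe (seg_rev e'))" using y fe_rev[OF e(2)] by simp
  ultimately have "e = seg_rev e'" using fe_overlap[OF e(1) edges_rev[OF e(2)]] y by metis
  then show ?thesis using edges_geodesic[OF e(2)] by simp
qed

text \<open>If \<open>fe e'\<close> crossed \<open>fe e\<close> transversally, its points just left
  of \<open>fe e\<close> would be inside no face image. This is possible only if \<open>y\<close> is
  the corner on \<open>fe e\<close> and \<open>fe e'\<close> runs along the circle of the edge
  \<open>fe e0\<close> that ends there. Then \<open>fe e'\<close> overlaps \<open>fe e0\<close> and
  equals it up to reversal, although \<open>y\<close> is inside the one and an end of the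
  other.\<close>

lemma fe_no_cross:
  assumes e: "e \<in> edges T" "e' \<in> edges T" and y: "y \<in> seg_interior (fe e)" "y \<in> seg_interior (fe e')"
  shows "e' = e \<or> e' = seg_rev e"
proof (cases "nrm (fe e) = nrm (fe e') \<or> nrm (fe e) = - nrm (fe e')")
  case True then show ?thesis using fe_overlap'[OF e] y by blast
next
  case False
  obtain t where t: "0 < t" "t < len e" "y = seg_point (fe e) t" using y(1) fe_basic(3)[OF e(1)] by (auto simp: seg_interior_def)
  obtain t' where t': "0 < t'" "t' < len e'" "y = seg_point (fe e') t'" using y(2) fe_basic(3)[OF e(2)] by (auto simp: seg_interior_def)
  note g = fe_basic(1)[OF e(1)] and g' = fe_basic(1)[OF e(2)]
  have dot: "m \<bullet> seg_point (fe e') (t' + s) = sin s * (m \<bullet> seg_tan (fe e') t')" if "m \<bullet> y = 0" for m s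
    using that t'(3) by (simp add: seg_point_add inner_right_distrib)
  have par: "m = nrm (fe e') \<or> m = - nrm (fe e')" if "m \<in> S2" "m \<bullet> y = 0" "m \<bullet> seg_tan (fe e') t' = 0" for m
    using that seg_frame[OF g'] t'(3) by (intro parallel_unit[of _ _ y "seg_tan (fe e') t'"]) auto
  define k where "k = nrm (fe e) \<bullet> seg_tan (fe e') t'"
  have ny: "nrm (fe e) \<bullet> y = 0" using seg_frame(4)[OF g] t by simp
  have k: "k \<noteq> 0" using par[OF seg_frame(10)[OF g] ny] False by (auto simp: k_def)
  obtain e0 where c: "corner e0 e" using corner_to[OF e(1)] by blast
  then have e0: "e0 \<in> edges T" by (auto simp: corner_def)
  note g0 = fe_basic(1)[OF e0]
  have ev: "t = lw e \<and> nrm (fe e0) \<bullet> x = 0" if ev: "nrm (fe e) \<bullet> x > 0" "\<forall>f\<in>faces T. x \<notin> fint (im f)"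
    and a: "t \<noteq> lw e \<longrightarrow> (x \<in> fint (im (if t < lw e then wr e else bl e)) \<longleftrightarrow> 0 < nrm (fe e) \<bullet> x)"
    and b: "t = lw e \<longrightarrow> (x \<in> fint (im (bl e)) \<longleftrightarrow> 0 < nrm (fe e0) \<bullet> x \<and> 0 < nrm (fe e) \<bullet> x) \<and> (x \<in> fint (im (wr e)) \<longleftrightarrow> nrm (fe e0) \<bullet> x < 0 \<and> 0 < nrm (fe e) \<bullet> x)" for x
    using ev a b edge_facts(10,13)[OF e(1)] by (auto split: if_splits)
  have A: "\<forall>\<^sub>F x in nhds y. t \<noteq> lw e \<longrightarrow> (x \<in> fint (im (if t < lw e then wr e else bl e)) \<longleftrightarrow> 0 < nrm (fe e) \<bullet> x)"
  proof (cases "t = lw e")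
    case False
    from fe_edge_local[OF e(1) t(1,2) False] show ?thesis unfolding t(3) by eventually_elim blast
  qed simp
  have B: "\<forall>\<^sub>F x in nhds y. t = lw e \<longrightarrow> (x \<in> fint (im (bl e)) \<longleftrightarrow> 0 < nrm (fe e0) \<bullet> x \<and> 0 < nrm (fe e) \<bullet> x) \<and> (x \<in> fint (im (wr e)) \<longleftrightarrow> nrm (fe e0) \<bullet> x < 0 \<and> 0 < nrm (fe e) \<bullet> x)"
  proof (cases "t = lw e")
    case True
    from fe_corner_local(1)[OF c] show ?thesis unfolding t(3) True by eventually_elim blast
  qed simp
  from A B have "\<forall>\<^sub>F x in nhds y. nrm (fe e) \<bullet> x > 0 \<longrightarrow> (\<forall>f\<in>faces T. x \<notin> fint (im f)) \<longrightarrow> t = lw e \<and> nrm (fe e0) \<bullet> x = 0"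
    by eventually_elim (use ev in blast)
  then have "\<forall>\<^sub>F r in nhds t'. nrm (fe e) \<bullet> seg_point (fe e') r > 0 \<longrightarrow> (\<forall>f\<in>faces T. seg_point (fe e') r \<notin> fint (im f)) \<longrightarrow> t = lw e \<and> nrm (fe e0) \<bullet> seg_point (fe e') r = 0"
    unfolding t'(3) by (rule eventually_seg_point)
  then obtain d where d: "d > 0" "\<And>r. \<bar>r - t'\<bar> < d \<Longrightarrow> nrm (fe e) \<bullet> seg_point (fe e') r > 0 \<Longrightarrow> (\<forall>f\<in>faces T. seg_point (fe e') r \<notin> fint (im f)) \<Longrightarrow> t = lw e \<and> nrm (fe e0) \<bullet> seg_point (fe e') r = 0"
    by (auto simp: eventually_nhds_metric dist_real_def)
  define h where "h = Min {d / 2, t' / 2, (len e' - t') / 2, 1}"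
  have "0 < h" using d(1) t' by (simp add: h_def)
  moreover have "h \<le> d / 2" "h \<le> t' / 2" "h \<le> (len e' - t') / 2" "h \<le> 1"
    unfolding h_def by (rule Min_le; simp)+
  ultimately have h: "0 < h" "h < d" "h < t'" "h < len e' - t'" "h < pi" using d(1) t' pi_gt3 by auto
  \<comment> \<open>The sign selects the direction in which \<open>fe e'\<close> enters the left
    side of \<open>fe e\<close>.\<close>
  define s where "s = (if k > 0 then h else - h)"
  have "sin h > 0" using h by (simp add: sin_gt_zero)
  then have sk: "sin s * k > 0" "sin s \<noteq> 0" using k by (auto simp: s_def mult_neg_neg zero_less_mult_iff)
  have s: "\<bar>s\<bar> < d" "0 \<le> t' + s" "t' + s \<le> len e'" using h by (auto simp: s_def)
  have "nrm (fe e) \<bullet> seg_point (fe e') (t' + s) > 0" using dot[OF ny] sk by (simp add: k_def)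
  then have tl: "t = lw e" "nrm (fe e0) \<bullet> seg_point (fe e') (t' + s) = 0"
    using d(2)[of "t' + s"] s fe_not_interior[OF e(2) s(2,3)] by auto
  have y0: "y = seg_point (fe e0) (len (fe e0))" using fe_corner_local(2)[OF c] t(3) tl(1) by simp
  then have n0y: "nrm (fe e0) \<bullet> y = 0" using seg_frame(4)[OF g0] by simp
  then have "nrm (fe e0) \<bullet> seg_tan (fe e') t' = 0" using dot[OF n0y, of s] tl(2) sk(2) by simp
  then have n0: "nrm (fe e0) = nrm (fe e') \<or> nrm (fe e0) = - nrm (fe e')" using par[OF seg_frame(10)[OF g0] n0y] by blast
  have "0 < min t' (len e' - t')" using t' by simp
  from near_circle[OF g' this, of t'] have "\<forall>\<^sub>F x in nhds y. x \<in> S2 \<and> nrm (fe e') \<bullet> x = 0 \<longrightarrow> x \<in> seg_interior (fe e')"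
    unfolding t'(3)[symmetric]
  proof eventually_elim
    case (elim x)
    show ?case
    proof
      assume "x \<in> S2 \<and> nrm (fe e') \<bullet> x = 0"
      then obtain s where s: "\<bar>s - t'\<bar> < min t' (len e' - t')" "x = seg_point (fe e') s" using elim by blast
      then show "x \<in> seg_interior (fe e')" using fe_basic(3)[OF e(2)] by (auto simp: abs_less_iff intro!: seg_interiorI)
    qed
  qed
  then have "\<forall>\<^sub>F r in nhds (len (fe e0)). seg_point (fe e0) r \<in> S2 \<and> nrm (fe e') \<bullet> seg_point (fe e0) r = 0 \<longrightarrow> seg_point (fe e0) r \<in> seg_interior (fe e')"
    unfolding y0 by (rule eventually_seg_point)
  moreover have "nrm (fe e') \<bullet> seg_point (fe e0) r = 0" for r
    using n0 seg_frame(4)[OF g0, of r] by auto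
  ultimately have "\<forall>\<^sub>F r in nhds (len (fe e0)). seg_point (fe e0) r \<in> seg_interior (fe e')"
    using seg_frame(8)[OF g0] by simp
  then obtain q where q: "q > 0" "\<And>r. \<bar>r - len (fe e0)\<bar> < q \<Longrightarrow> seg_point (fe e0) r \<in> seg_interior (fe e')"
    by (auto simp: eventually_nhds_metric dist_real_def)
  have l0: "0 < len (fe e0)" "len (fe e0) \<le> 2 * pi" using geodesic_segmentD[OF g0] by auto
  \<comment> \<open>A parameter just before the end of \<open>fe e0\<close>: close to
    \<open>y\<close>, yet inside the edge.\<close>
  define r where "r = len (fe e0) - min q (len (fe e0)) / 2"
  have r: "0 < r" "r < len (fe e0)" "\<bar>r - len (fe e0)\<bar> < q" using q(1) l0 by (auto simp: r_def min_def)
  have "seg_point (fe e0) r \<in> seg_interior (fe e0)" using r by (intro seg_interiorI) auto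
  then have "e' = e0 \<or> e' = seg_rev e0" using fe_overlap'[OF e0 e(2) n0] q(2)[OF r(3)] by blast
  then have "y \<in> seg_interior (fe e0)" using y(2) fe_rev[OF e0] by auto
  then obtain p where p: "0 < p" "p < len (fe e0)" "y = seg_point (fe e0) p" by (auto simp: seg_interior_def)
  have "len (fe e0) = p" by (rule seg_point_inj[OF g0]) (use p y0 l0 in auto)
  then show ?thesis using p by simp
qed

lemma fe_inj: assumes e: "e \<in> edges T" "e' \<in> edges T" and eq: "fe e = fe e'" shows "e = e'"
proof -
  have "seg_point (fe e) (len (fe e) / 2) \<in> seg_interior (fe e)"
    using geodesic_segmentD[OF fe_basic(1)[OF e(1)]] by (intro seg_interiorI) auto
  then show ?thesis using fe_overlap[OF e] eq by simp
qed

lemma R_arcs: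
  assumes e: "e \<in> edges T"
  shows "(*v) (R (bl e)) ` seg_arc e 0 (lb e) = seg_arc (fe e) (lw e) (len e)"
    "(*v) (R (wr e)) ` seg_arc e 0 (lw e) = seg_arc (fe e) 0 (lw e)"
    "(*v) (R (br e)) ` seg_arc e (lw e) (len e) = seg_arc (fe e) 0 (lb e)"
    "(*v) (R (wl e)) ` seg_arc e (lb e) (len e) = seg_arc (fe e) (lb e) (len e)"
proof -
  note m = fe_moves[OF e] and E = edge_facts(5)[OF e]
  have "{lw e..len e} = (\<lambda>t. t + lw e) ` {0..lb e}" "{0..lb e} = (\<lambda>t. t - lw e) ` {lw e..len e}"
    "{0..lw e} = (\<lambda>t. lw e - t) ` {0..lw e}" "{lb e..len e} = (\<lambda>t. len e + lb e - t) ` {lb e..len e}"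
    using E by (simp_all add: algebra_simps)
  note i = this
  show "(*v) (R (bl e)) ` seg_arc e 0 (lb e) = seg_arc (fe e) (lw e) (len e)"
    unfolding seg_arc_def i(1) image_image m by simp
  show "(*v) (R (br e)) ` seg_arc e (lw e) (len e) = seg_arc (fe e) 0 (lb e)"
    unfolding seg_arc_def i(2) image_image m by simp
  show "(*v) (R (wr e)) ` seg_arc e 0 (lw e) = seg_arc (fe e) 0 (lw e)"
  proof -
    have "(*v) (R (wr e)) ` seg_arc e 0 (lw e) = seg_point (fe e) ` (\<lambda>t. lw e - t) ` {0..lw e}"
      unfolding seg_arc_def image_image m ..
    then show ?thesis unfolding i(3)[symmetric] by (simp add: seg_arc_def)
  qed
  show "(*v) (R (wl e)) ` seg_arc e (lb e) (len e) = seg_arc (fe e) (lb e) (len e)"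
  proof -
    have "(*v) (R (wl e)) ` seg_arc e (lb e) (len e) = seg_point (fe e) ` (\<lambda>t. len e + lb e - t) ` {lb e..len e}"
      unfolding seg_arc_def image_image m ..
    then show ?thesis unfolding i(4)[symmetric] by (simp add: seg_arc_def)
  qed
qed

lemma fe_edge_face:
  assumes e: "e \<in> edges T"
  shows "nrm (fe e) \<in> nrms (im (bl e))" "nrm (fe e) \<in> nrms (im (wr e))"
    "- nrm (fe e) \<in> nrms (im (br e))" "- nrm (fe e) \<in> nrms (im (wl e))"
    "im (bl e) \<inter> {x. nrm (fe e) \<bullet> x = 0} = seg_arc (fe e) (lw e) (len e)"
    "im (wr e) \<inter> {x. nrm (fe e) \<bullet> x = 0} = seg_arc (fe e) 0 (lw e)"
    "im (br e) \<inter> {x. nrm (fe e) \<bullet> x = 0} = seg_arc (fe e) 0 (lb e)"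
    "im (wl e) \<inter> {x. nrm (fe e) \<bullet> x = 0} = seg_arc (fe e) (lb e) (len e)"
proof -
  note E = edge_facts[OF e] and m = fe_moves[OF e] and r = R_arcs[OF e]
  have n: "R f *v n \<in> nrms (im f)" if "f \<in> faces T" "n \<in> nrms f" for f n using im_nrms that by blast
  show "nrm (fe e) \<in> nrms (im (bl e))" using n[OF E(10,18)] m by simp
  show "nrm (fe e) \<in> nrms (im (wr e))" using n[OF E(13,21)] m by (simp add: matrix_vector_mult_minus)
  show "- nrm (fe e) \<in> nrms (im (br e))" using n[OF E(12,20)] m by (simp add: matrix_vector_mult_minus)
  show "- nrm (fe e) \<in> nrms (im (wl e))" using n[OF E(11,19)] m by simp
  have i: "im f \<inter> {x. (R f *v nrm e) \<bullet> x = 0} = (*v) (R f) ` (f \<inter> {x. nrm e \<bullet> x = 0})" if "f \<in> faces T" for f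
    using rotation_inter[OF R_rot[OF that]] rotation_plane[OF R_rot[OF that]] by (simp add: im_def)
  show "im (bl e) \<inter> {x. nrm (fe e) \<bullet> x = 0} = seg_arc (fe e) (lw e) (len e)" using i[OF E(10)] E r m by simp
  show "im (wr e) \<inter> {x. nrm (fe e) \<bullet> x = 0} = seg_arc (fe e) 0 (lw e)" using i[OF E(13)] E r m by simp
  show "im (br e) \<inter> {x. nrm (fe e) \<bullet> x = 0} = seg_arc (fe e) 0 (lb e)" using i[OF E(12)] E r m by simp
  show "im (wl e) \<inter> {x. nrm (fe e) \<bullet> x = 0} = seg_arc (fe e) (lb e) (len e)" using i[OF E(11)] E r m by simp
qed

lemma R_edge_faces_arc:
  assumes e: "e \<in> edges T" and f: "f \<in> edge_faces e"
  shows "(*v) (R f) ` (f \<inter> {x. nrm e \<bullet> x = 0}) \<subseteq> seg_set (fe e)"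
proof -
  note E = edge_facts[OF e] and r = R_arcs[OF e]
  have "seg_arc (fe e) a b \<subseteq> seg_set (fe e)" if "0 \<le> a" "b \<le> len e" for a b
    using that fe_basic(3)[OF e] by (auto simp: seg_set_def seg_arc_def)
  note sub = this
  consider "f = bl e" | "f = wl e" | "f = br e" | "f = wr e" using f by (auto simp: edge_faces_def)
  then show ?thesis
  proof cases
    case 1 show ?thesis unfolding 1 E(22) r(1) using sub E(1-5) by simp
  next
    case 2 show ?thesis unfolding 2 E(23) r(4) using sub E(1-5) by simp
  next
    case 3 show ?thesis unfolding 3 E(24) r(3) using sub E(1-5) by simp
  next
    case 4 show ?thesis unfolding 4 E(25) r(2) using sub E(1-5) by simp
  qed
qed

text \<open>Either side says that \<open>e\<close> is, up to reversal, the edge that carries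
  \<open>a\<close>: in \<open>T\<close> because edges do not cross, after the flip by
  \<open>fe_no_cross\<close>.\<close>

lemma face_im_seg:
  assumes f: "f \<in> faces T" and a: "a \<in> polygon_edges f" and e: "e \<in> edges T"
  shows "a \<subseteq> seg_set e \<longleftrightarrow> (*v) (R f) ` a \<subseteq> seg_set (fe e)"
proof -
  obtain e1 where e1: "e1 \<in> edges T" "f \<in> edge_faces e1" "a = f \<inter> {x. nrm e1 \<bullet> x = 0}" "a \<subseteq> seg_set e1"
    using face_edge_edge_faces[OF f a] .
  have sub1: "(*v) (R f) ` a \<subseteq> seg_set (fe e1)" using R_edge_faces_arc[OF e1(1,2)] e1 by simp
  have inf: "infinite a" using a by (auto simp: polygon_edges_nrms nrms_def)
  have inf': "infinite ((*v) (R f) ` a)" using inf rotation_inj[OF R_rot[OF f]] by (subst finite_image_iff) (auto simp: inj_on_def)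
  note common = infinite_common_interior
  show ?thesis
  proof
    assume "a \<subseteq> seg_set e"
    then have "e = e1 \<or> e = seg_rev e1" using common[OF inf e1(4)] edges_cross[OF e1(1) e] by blast
    then show "(*v) (R f) ` a \<subseteq> seg_set (fe e)" using sub1 fe_rev[OF e1(1)] by auto
  next
    assume "(*v) (R f) ` a \<subseteq> seg_set (fe e)"
    then have "e = e1 \<or> e = seg_rev e1" using common[OF inf' sub1] fe_no_cross[OF e1(1) e] by blast
    then show "a \<subseteq> seg_set e" using e1(4) by auto
  qed
qed

lemma flipped_simps:
  "black (flipped R) = im ` black T" "white (flipped R) = im ` white T" "edges (flipped R) = fe ` edges T"
  "faces (flipped R) = im ` faces T"
  by (auto simp: flipped_def im_def faces_def)

lemma flipped_tiling: "tiling_of_S2 (flipped R)"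
  unfolding tiling_of_S2_def flipped_simps
proof (intro conjI ballI impI)
  fix f assume "f \<in> im ` faces T"
  then show "convex_polygon f \<or> digon f" using im_face by (auto simp: face_def)
next
  show "im ` black T \<inter> im ` white T = {}"
    using im_inj black_face white_face black_white by blast
next
  fix f h assume "f \<in> im ` faces T" "h \<in> im ` faces T" "f \<noteq> h"
  then show "S2_interior f \<inter> S2_interior h = {}"
    using im_disjoint S2_interior_fint im_face by blast
next
  show "\<Union> (im ` faces T) = S2" using im_cover .
next
  fix u assume "u \<in> fe ` edges T"
  then show "geodesic_segment u" "seg_rev u \<in> fe ` edges T"
    using fe_basic(1) fe_rev edges_rev by (auto simp: image_iff) metis
next
  fix f a assume f: "f \<in> im ` faces T" and a: "a \<in> polygon_edges f"
  then obtain h where h: "h \<in> faces T" "f = im h" by blast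
  then obtain b where b: "b \<in> polygon_edges h" "a = (*v) (R h) ` b"
    using a rotation_polygon_edges[OF R_rot[OF h(1)]] by (auto simp: im_def)
  obtain e where e: "e \<in> edges T" "b \<subseteq> seg_set e" using polygon_edge_in_edge h b by blast
  then have "a \<subseteq> seg_set (fe e)" using face_im_seg[OF h(1) b(1) e(1)] b by simp
  then show "\<exists>u\<in>fe ` edges T. a \<subseteq> seg_set u" using e by blast
next
  fix u v assume uv: "u \<in> fe ` edges T" "v \<in> fe ` edges T" "v \<noteq> u \<and> v \<noteq> seg_rev u"
  then obtain e e' where e: "e \<in> edges T" "u = fe e" "e' \<in> edges T" "v = fe e'" by blast
  then have "e' \<noteq> e \<and> e' \<noteq> seg_rev e" using uv fe_rev by auto
  then show "seg_interior u \<inter> seg_interior v = {}" using fe_no_cross e by blast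
qed

theorem flipped_left_flippable: "left_flippable (flipped R)"
  unfolding left_flippable_def
proof (intro conjI ballI flipped_tiling)
  fix u assume "u \<in> edges (flipped R)"
  then obtain e where e: "e \<in> edges T" "u = fe e" unfolding flipped_simps by blast
  note E = edge_facts[OF e(1)] and F = fe_edge_face[OF e(1)]
  have l: "left_of u f" "f \<inter> {x. nrm u \<bullet> x = 0} \<in> polygon_edges f" if "nrm u \<in> nrms f" for f
    using that by (auto simp: left_of_nrm nrms_def closed_hemisphere_def polygon_edges_nrms)
  have r: "right_of u f" "f \<inter> {x. nrm u \<bullet> x = 0} \<in> polygon_edges f" if n: "- nrm u \<in> nrms f" for f
  proof -
    show "right_of u f" using n by (auto simp: right_of_def nrm_def[symmetric] nrms_def closed_hemisphere_def)
    have "f \<inter> {x. nrm u \<bullet> x = 0} = f \<inter> {x. - nrm u \<bullet> x = 0}" by auto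
    then show "f \<inter> {x. nrm u \<bullet> x = 0} \<in> polygon_edges f" using n unfolding polygon_edges_nrms by blast
  qed
  show "edge_pattern left_of right_of (flipped R) u"
    unfolding edge_pattern_def flipped_simps
  proof (rule exI[of _ "lb e"], rule exI[of _ "lw e"], intro conjI)
    show "0 < lb e" "0 < lw e" "len u = lb e + lw e" using E e fe_basic(3) by auto
    have L: "len u = len e" using e fe_basic(3) by simp
    show "\<exists>f\<in>im ` white T. left_of u f \<and> seg_arc u 0 (lw e) \<in> polygon_edges f"
      using l[of "im (wr e)"] F E e by auto
    show "\<exists>f\<in>im ` black T. left_of u f \<and> seg_arc u (lw e) (len u) \<in> polygon_edges f"
      using l[of "im (bl e)"] F E e L by auto
    show "\<exists>f\<in>im ` black T. right_of u f \<and> seg_arc u 0 (lb e) \<in> polygon_edges f"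
      using r[of "im (br e)"] F E e by auto
    show "\<exists>f\<in>im ` white T. right_of u f \<and> seg_arc u (lb e) (len u) \<in> polygon_edges f"
      using r[of "im (wl e)"] F E e L by auto
  qed
qed

theorem flips_to_flipped: "flips_to T (flipped R)"
  unfolding flips_to_def
proof (intro exI[of _ im] exI[of _ R] exI[of _ fe] conjI ballI)
  show "bij_betw im (black T) (black (flipped R))" "bij_betw im (white T) (white (flipped R))"
    unfolding flipped_simps using im_inj black_face white_face by (auto intro!: inj_on_imp_bij_betw inj_onI)
  show "bij_betw fe (edges T) (edges (flipped R))"
    unfolding flipped_simps using fe_inj by (auto intro!: inj_on_imp_bij_betw inj_onI)
qed (use R_rot fe_rev face_im_seg in \<open>auto simp: im_def\<close>)

end

subsection \<open>Uniqueness of the flip\<close>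

lemma seg_tan_cross: "geodesic_segment u \<Longrightarrow> seg_tan u r = cross3 (nrm u) (seg_point u r)"
  using seg_frame(1,3,6)[of u r]
  by (metis (no_types, lifting) Lagrange cross_skew inner_commute scaleR_one scale_zero_left diff_zero minus_diff_eq)

lemma rotation_seg_point:
  assumes e: "geodesic_segment e" and u: "geodesic_segment u" and Q: "rotation_matrix Q"
    and n: "Q *v nrm e = nrm u" and p: "Q *v seg_point e a = seg_point u c"
  shows "Q *v seg_point e (a + t) = seg_point u (c + t)"
proof -
  have "Q *v seg_tan e a = seg_tan u c"
    using seg_tan_cross[OF e] seg_tan_cross[OF u] n p by (simp add: cross_rotation_matrix[OF Q, symmetric])
  then show ?thesis using p by (simp add: seg_point_add matrix_vector_right_distrib matrix_vector_mult_scaleR)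
qed

text \<open>Both arcs omit a piece of their circles. If the image of the first began after
  \<open>a'\<close>, the points of the second just before that beginning would have to be images
  too, from the omitted piece.\<close>

lemma arc_match:
  assumes e: "geodesic_segment e" and u: "geodesic_segment u" and Q: "rotation_matrix Q" and n: "Q *v nrm e = nrm u"
    and ab: "a < b" "b < a + 2 * pi" and ab': "a' < b'" "b' < a' + 2 * pi"
    and arc: "(*v) Q ` seg_arc e a b = seg_arc u a' b'"
  shows "b - a = b' - a'" "Q *v seg_point e (a + t) = seg_point u (a' + t)"
proof -
  have "Q *v seg_point e a \<in> seg_arc u a' b'" unfolding arc[symmetric] using ab by (auto simp: seg_arc_def)
  then obtain c where c: "a' \<le> c" "c \<le> b'" "Q *v seg_point e a = seg_point u c" by (auto simp: seg_arc_def)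
  note shift = rotation_seg_point[OF e u Q n c(3)]
  have "c = a'"
  proof (rule ccontr)
    assume "c \<noteq> a'"
    define h where "h = min (c - a') ((2 * pi - (b - a)) / 2)"
    have h: "0 < h" "h \<le> c - a'" "h < 2 * pi - (b - a)" using \<open>c \<noteq> a'\<close> c ab by (auto simp: h_def min_def)
    have "seg_point u (c - h) \<in> seg_arc u a' b'" using h c by (auto simp: seg_arc_def)
    then obtain r where r: "a \<le> r" "r \<le> b" "seg_point u (c - h) = Q *v seg_point e r"
      unfolding arc[symmetric] by (auto simp: seg_arc_def)
    have "Q *v seg_point e r = seg_point u (c + (r - a))" using shift[of "r - a"] by simp
    then have "c - h = c + (r - a)" using r h ab by (intro seg_point_inj[OF u]) auto
    then show False using h r by simp
  qed
  then show pt: "Q *v seg_point e (a + t) = seg_point u (a' + t)" for t using shift by simp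
  have "b - a \<le> b' - a'"
  proof (rule ccontr)
    assume con: "\<not> ?thesis"
    have "Q *v seg_point e b \<in> seg_arc u a' b'" unfolding arc[symmetric] using ab by (auto simp: seg_arc_def)
    then obtain r where r: "a' \<le> r" "r \<le> b'" "seg_point u (a' + (b - a)) = seg_point u r"
      using pt[of "b - a"] by (auto simp: seg_arc_def)
    have "a' + (b - a) = r" by (rule seg_point_inj[OF u r(3)]) (use r con ab ab' in auto)
    then show False using con r by simp
  qed
  moreover have "b' - a' \<le> b - a"
  proof (rule ccontr)
    assume con: "\<not> ?thesis"
    have "seg_point u b' \<in> seg_arc u a' b'" using ab' by (auto simp: seg_arc_def)
    then obtain r where r: "a \<le> r" "r \<le> b" "seg_point u b' = Q *v seg_point e r"
      unfolding arc[symmetric] by (auto simp: seg_arc_def)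
    have eq: "seg_point u b' = seg_point u (a' + (r - a))" using pt[of "r - a"] r by simp
    have "b' = a' + (r - a)" by (rule seg_point_inj[OF u eq]) (use r con ab ab' in auto)
    then show False using con r by simp
  qed
  ultimately show "b - a = b' - a'" by simp
qed

text \<open>All normals of a face with two antipodal points are perpendicular to them. A third
  normal would be a nonnegative combination of \<open>n1\<close> and \<open>n2\<close>, and a point
  on its edge off the circle of \<open>n1\<close> forces the coefficient of \<open>n1\<close> to
  vanish.\<close>

lemma lune_nrms:
  assumes f: "face f" and n: "n1 \<in> nrms f" "n2 \<in> nrms f" "n1 \<noteq> n2" and x: "x \<in> f" "- x \<in> f"
  shows "nrms f = {n1, n2}"
proof -
  have perp: "m \<bullet> x = 0" if "m \<in> nrms f" for m
  proof -
    have "0 \<le> m \<bullet> x" "0 \<le> m \<bullet> (- x)" using x that by (auto simp: nrms_def closed_hemisphere_def)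
    then show ?thesis by simp
  qed
  have xx: "x \<bullet> x = 1" using x face_subset_S2[OF f] by (auto simp: norm_1_inner)
  have ne: "n1 \<noteq> - n2" using opposite_notin_nrms[OF f n(2)] n(1) by auto
  have side: "\<exists>z. z \<in> f \<and> n \<bullet> z = 0 \<and> m \<bullet> z > 0" if n: "n \<in> nrms f" "m \<in> nrms f" "n \<noteq> m" for n m
  proof -
    have "infinite (f \<inter> {z. n \<bullet> z = 0} - (S2 \<inter> {z. n \<bullet> z = 0} \<inter> {z. m \<bullet> z = 0}))"
    proof (rule Diff_infinite_finite)
      have "(S2 \<inter> {z. n \<bullet> z = 0} \<inter> {z. m \<bullet> z = 0}) \<subseteq> (\<Union>m\<in>nrms f - {n}. S2 \<inter> {x. n \<bullet> x = 0} \<inter> {x. m \<bullet> x = 0})"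
        using n by blast
      then show "finite (S2 \<inter> {z. n \<bullet> z = 0} \<inter> {z. m \<bullet> z = 0})"
        using finite_subset finite_other_circles[OF f n(1)] by blast
    qed (use n in \<open>auto simp: nrms_def\<close>)
    then have "f \<inter> {z. n \<bullet> z = 0} - (S2 \<inter> {z. n \<bullet> z = 0} \<inter> {z. m \<bullet> z = 0}) \<noteq> {}" by (rule infinite_imp_nonempty)
    then obtain z where z: "z \<in> f" "n \<bullet> z = 0" "m \<bullet> z \<noteq> 0" using face_subset_S2[OF f] by blast
    moreover have "0 \<le> m \<bullet> z" using z n by (auto simp: nrms_def closed_hemisphere_def)
    ultimately show ?thesis by (intro exI[of _ z]) auto
  qed
  obtain z1 where z1: "z1 \<in> f" "n1 \<bullet> z1 = 0" "n2 \<bullet> z1 > 0" using side[OF n] by blast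
  obtain z2 where z2: "z2 \<in> f" "n2 \<bullet> z2 = 0" "n1 \<bullet> z2 > 0" using side[OF n(2,1)] n(3) by metis
  have "m = n1 \<or> m = n2" if m: "m \<in> nrms f" for m
  proof (rule ccontr)
    assume con: "\<not> ?thesis"
    \<comment> \<open>The coefficients for which \<open>m\<close> and the combination of
      \<open>n1\<close> and \<open>n2\<close> agree on \<open>z1\<close> and \<open>z2\<close>; they
      also agree on \<open>x\<close>.\<close>
    define a where "a = (m \<bullet> z2) / (n1 \<bullet> z2)"
    define b where "b = (m \<bullet> z1) / (n2 \<bullet> z1)"
    have ab: "0 \<le> a" "0 \<le> b" using m z1 z2 by (auto simp: a_def b_def nrms_def closed_hemisphere_def)
    define d where "d = m - a *\<^sub>R n1 - b *\<^sub>R n2"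
    have d0: "d \<bullet> x = 0" "d \<bullet> z1 = 0" "d \<bullet> z2 = 0"
      using perp m n z1 z2 by (simp_all add: d_def inner_diff_left a_def b_def)
    have "d = 0"
    proof (rule ccontr)
      assume "d \<noteq> 0"
      define d' where "d' = d /\<^sub>R norm d"
      have d': "d' \<in> S2" "d' \<bullet> x = 0" "d' \<bullet> z1 = 0" "d' \<bullet> z2 = 0" using \<open>d \<noteq> 0\<close> d0 by (auto simp: d'_def)
      define v where "v = (z1 - (z1 \<bullet> x) *\<^sub>R x) /\<^sub>R norm (z1 - (z1 \<bullet> x) *\<^sub>R x)"
      have nz: "z1 - (z1 \<bullet> x) *\<^sub>R x \<noteq> 0"
      proof
        assume "z1 - (z1 \<bullet> x) *\<^sub>R x = 0"
        then have "n2 \<bullet> z1 = n2 \<bullet> ((z1 \<bullet> x) *\<^sub>R x)" by simp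
        then show False using z1 perp[OF n(2)] by simp
      qed
      have v: "v \<bullet> v = 1" "x \<bullet> v = 0" "d' \<bullet> v = 0" "n1 \<bullet> v = 0"
        using nz d' z1 perp[OF n(1)] xx
        by (simp_all add: v_def inner_diff_right inner_commute dot_square_norm power2_eq_square)
      have "d' = n1 \<or> d' = - n1"
        using parallel_unit[of d' n1 x v] d' v xx nrms_S2(1)[OF n(1)] perp[OF n(1)] by auto
      then show False using d'(4) z2 by auto
    qed
    then have meq: "m = a *\<^sub>R n1 + b *\<^sub>R n2" by (simp add: d_def algebra_simps)
    obtain z where z: "z \<in> f" "m \<bullet> z = 0" "n1 \<bullet> z > 0" using side[OF m n(1)] con by blast
    have "0 \<le> n2 \<bullet> z" using z n by (auto simp: nrms_def closed_hemisphere_def)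
    then have "0 \<le> b * (n2 \<bullet> z)" "0 \<le> a * (n1 \<bullet> z)" using z ab by auto
    moreover have "a * (n1 \<bullet> z) + b * (n2 \<bullet> z) = 0" using z(2) by (simp add: meq inner_add_left)
    ultimately have "a * (n1 \<bullet> z) = 0" by linarith
    then have "a = 0" using z by simp
    then have "m = b *\<^sub>R n2" using meq by simp
    then have "m = n2" using nrms_S2(3)[OF m] nrms_S2(3)[OF n(2)] ab by simp
    then show False using con by simp
  qed
  then show ?thesis using n by blast
qed

text \<open>\<open>U\<close> is the target of a flip with its colours exchanged, so it is right
  flippable too and the same combinatorics serves both tilings; accordingly \<open>\<phi>\<close>
  exchanges the colours.\<close>

locale flip_pair = rtiling T + U: rtiling U for T U +
  fixes \<phi> :: "(real^3) set \<Rightarrow> (real^3) set" and R :: "(real^3) set \<Rightarrow> real^3^3" and \<psi> :: "seg \<Rightarrow> seg"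
  assumes phi_black: "bij_betw \<phi> (black T) (white U)" and phi_white: "bij_betw \<phi> (white T) (black U)"
    and phi_R: "f \<in> faces T \<Longrightarrow> rotation_matrix (R f) \<and> \<phi> f = (*v) (R f) ` f"
    and psi_bij: "bij_betw \<psi> (edges T) (edges U)"
    and psi_rev: "e \<in> edges T \<Longrightarrow> \<psi> (seg_rev e) = seg_rev (\<psi> e)"
    and incidence: "f \<in> faces T \<Longrightarrow> a \<in> polygon_edges f \<Longrightarrow> e \<in> edges T \<Longrightarrow>
       a \<subseteq> seg_set e \<longleftrightarrow> (*v) (R f) ` a \<subseteq> seg_set (\<psi> e)"
begin

text \<open>Incidence speaks only of the point sets of edges, so the orientation of
  \<open>\<psi> e\<close> carries no information.\<close>

definition linked :: "seg \<Rightarrow> seg \<Rightarrow> bool" where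
  "linked e u \<longleftrightarrow> e \<in> edges T \<and> u \<in> edges U \<and> (u = \<psi> e \<or> u = seg_rev (\<psi> e))"

lemma psi_edges: "e \<in> edges T \<Longrightarrow> \<psi> e \<in> edges U"
  using psi_bij by (auto simp: bij_betw_def)

lemma linked_rev:
  assumes "linked e u" shows "linked (seg_rev e) u" "linked e (seg_rev u)"
  using assms edges_rev U.edges_rev psi_rev psi_edges U.edges_geodesic by (auto simp: linked_def)

lemma linked_seg_set: "linked e u \<Longrightarrow> seg_set u = seg_set (\<psi> e)"
  by (auto simp: linked_def)

lemma phi_faces: "f \<in> faces T \<Longrightarrow> \<phi> f \<in> faces U"
  using phi_black phi_white by (auto simp: faces_def bij_betw_def)

lemma phi_black_mem: "f \<in> black T \<Longrightarrow> \<phi> f \<in> white U" and phi_white_mem: "f \<in> white T \<Longrightarrow> \<phi> f \<in> black U"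
  using phi_black phi_white by (auto simp: bij_betw_def)

lemma phi_inj:
  assumes "f \<in> black T \<and> h \<in> black T \<or> f \<in> white T \<and> h \<in> white T" "\<phi> f = \<phi> h" shows "f = h"
  using assms phi_black phi_white by (auto simp: bij_betw_def inj_on_def)

lemma phi_edge_faces:
  assumes l: "linked e u" and f: "f \<in> edge_faces e" shows "\<phi> f \<in> U.edge_faces u"
proof -
  have e: "e \<in> edges T" "u \<in> edges U" using l by (auto simp: linked_def)
  have ff: "f \<in> faces T" using edge_faces_faces e f by blast
  have r: "rotation_matrix (R f)" "\<phi> f = (*v) (R f) ` f" using phi_R[OF ff] by auto
  let ?a = "f \<inter> {x. nrm e \<bullet> x = 0}"
  have "(*v) (R f) ` ?a \<subseteq> seg_set u"
    using incidence[OF ff edge_faces_edge(1)[OF e(1) f] e(1)] edge_faces_edge(2)[OF e(1) f] linked_seg_set[OF l] by simp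
  moreover have "(*v) (R f) ` ?a \<in> polygon_edges (\<phi> f)"
    unfolding r(2) rotation_polygon_edges[OF r(1)] using edge_faces_edge(1)[OF e(1) f] by blast
  ultimately show ?thesis using U.incident_edge_faces[OF phi_faces[OF ff]] e by blast
qed

text \<open>Incidence puts the image of the polygon edge on the circle of \<open>u\<close>, the
  inner normals fix the side, and \<open>arc_match\<close> fixes the position.\<close>

lemma left_match:
  assumes l: "linked e u" and f: "f \<in> edge_faces e" "nrm e \<in> nrms f" "f \<inter> {x. nrm e \<bullet> x = 0} = seg_arc e a b"
    and ab: "a < b" "b < a + 2 * pi"
    and h: "nrm u \<in> nrms (\<phi> f)" "\<phi> f \<inter> {x. nrm u \<bullet> x = 0} = seg_arc u a' b'" and ab': "a' < b'" "b' < a' + 2 * pi"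
  shows "R f *v nrm e = nrm u" "b - a = b' - a'" "R f *v seg_point e (a + t) = seg_point u (a' + t)"
proof -
  have e: "e \<in> edges T" "u \<in> edges U" using l by (auto simp: linked_def)
  note g = edges_geodesic[OF e(1)] and gu = U.edges_geodesic[OF e(2)]
  have ff: "f \<in> faces T" using edge_faces_faces e f by blast
  have r: "rotation_matrix (R f)" "\<phi> f = (*v) (R f) ` f" using phi_R[OF ff] by auto
  let ?a = "f \<inter> {x. nrm e \<bullet> x = 0}"
  have img: "(*v) (R f) ` ?a = \<phi> f \<inter> {x. (R f *v nrm e) \<bullet> x = 0}"
    unfolding r(2) rotation_inter[OF r(1)] rotation_plane[OF r(1)] ..
  have n: "R f *v nrm e \<in> nrms (\<phi> f)" using f r by (simp add: rotation_nrms)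
  have "(*v) (R f) ` ?a \<subseteq> seg_set u"
    using incidence[OF ff edge_faces_edge(1)[OF e(1) f(1)] e(1)] edge_faces_edge(2)[OF e(1) f(1)] linked_seg_set[OF l] by simp
  then have "\<phi> f \<inter> {x. (R f *v nrm e) \<bullet> x = 0} \<subseteq> S2 \<inter> {x. (R f *v nrm e) \<bullet> x = 0} \<inter> {x. nrm u \<bullet> x = 0}"
    unfolding img using seg_frame(4,8)[OF gu] by (auto simp: seg_set_def seg_arc_def)
  moreover have "infinite (\<phi> f \<inter> {x. (R f *v nrm e) \<bullet> x = 0})" using n by (auto simp: nrms_def)
  ultimately have "infinite (S2 \<inter> {x. (R f *v nrm e) \<bullet> x = 0} \<inter> {x. nrm u \<bullet> x = 0})" using infinite_super by blast
  then have "R f *v nrm e = nrm u \<or> R f *v nrm e = - nrm u"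
    using infinite_circle_inter nrms_S2(1) n h(1) by blast
  then show nn: "R f *v nrm e = nrm u"
    using opposite_notin_nrms[OF U.faces_face[OF phi_faces[OF ff]] h(1)] n by auto
  have arc: "(*v) (R f) ` seg_arc e a b = seg_arc u a' b'" using img f(3) h(2) nn by simp
  show "b - a = b' - a'" "R f *v seg_point e (a + t) = seg_point u (a' + t)"
    using arc_match[OF g gu r(1) nn ab ab' arc] by auto
qed

lemma match_bl:
  assumes l: "linked e u" and b: "\<phi> (bl e) = U.wl u"
  shows "R (bl e) *v nrm e = nrm u" "lb e = U.lw u" "R (bl e) *v seg_point e t = seg_point u (U.lb u + t)"
proof -
  have e: "e \<in> edges T" "u \<in> edges U" using l by (auto simp: linked_def)
  note E = edge_facts[OF e(1)] and V = U.edge_facts[OF e(2)] and L = edges_len[OF e(1)] U.edges_len[OF e(2)]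
  have "lb e < 0 + 2 * pi" "len u < U.lb u + 2 * pi" using E V L by linarith+
  note m = left_match[OF l _ E(18) E(22) E(1) this(1), unfolded b, OF _ V(19) V(23) V(2) this(2)]
  show "R (bl e) *v nrm e = nrm u" "lb e = U.lw u" "R (bl e) *v seg_point e t = seg_point u (U.lb u + t)"
    using m(1,2) m(3)[of t] V(5) by (auto simp: edge_faces_def)
qed

lemma match_wl:
  assumes l: "linked e u" and b: "\<phi> (wl e) = U.bl u"
  shows "R (wl e) *v nrm e = nrm u" "lw e = U.lb u" "R (wl e) *v seg_point e (lb e + t) = seg_point u t"
proof -
  have e: "e \<in> edges T" "u \<in> edges U" using l by (auto simp: linked_def)
  note E = edge_facts[OF e(1)] and V = U.edge_facts[OF e(2)] and L = edges_len[OF e(1)] U.edges_len[OF e(2)]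
  have "len e < lb e + 2 * pi" "U.lb u < 0 + 2 * pi" using E V L by linarith+
  note m = left_match[OF l _ E(19) E(23) E(2) this(1), unfolded b, OF _ V(18) V(22) V(1) this(2)]
  show "R (wl e) *v nrm e = nrm u" "lw e = U.lb u" "R (wl e) *v seg_point e (lb e + t) = seg_point u t"
    using m(1,2) m(3)[of t] E(5) by (auto simp: edge_faces_def)
qed

definition aligned :: "seg \<Rightarrow> seg \<Rightarrow> bool" where
  "aligned e u \<longleftrightarrow> linked e u \<and> \<phi> (bl e) = U.wl u \<and> \<phi> (br e) = U.wr u"

text \<open>The white faces change sides across the edge in a good flip, and stay on their side in a bad one.\<close>
definition good :: "seg \<Rightarrow> seg \<Rightarrow> bool" where
  "good e u \<longleftrightarrow> aligned e u \<and> \<phi> (wr e) = U.bl u \<and> \<phi> (wl e) = U.br u"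

definition bad :: "seg \<Rightarrow> seg \<Rightarrow> bool" where
  "bad e u \<longleftrightarrow> aligned e u \<and> \<phi> (wl e) = U.bl u \<and> \<phi> (wr e) = U.br u"

lemma aligned_edges: "aligned e u \<Longrightarrow> e \<in> edges T \<and> u \<in> edges U"
  by (auto simp: aligned_def linked_def)

text \<open>The two black faces of \<open>e\<close> go to the two white faces of
  \<open>\<psi> e\<close>; if they land on the wrong sides, reversing the edge corrects
  both.\<close>

lemma aligned_exists:
  assumes e: "e \<in> edges T" shows "\<exists>u. aligned e u"
proof -
  note u = psi_edges[OF e]
  have l: "linked e (\<psi> e)" using e u by (simp add: linked_def)
  note E = edge_facts[OF e] and V = U.edge_facts[OF u]
  have b: "\<phi> f = U.wl (\<psi> e) \<or> \<phi> f = U.wr (\<psi> e)" if "f = bl e \<or> f = br e" for f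
  proof -
    have "f \<in> edge_faces e" "f \<in> black T" using that E by (auto simp: edge_faces_def)
    then have "\<phi> f \<in> U.edge_faces (\<psi> e)" "\<phi> f \<in> white U" using phi_edge_faces[OF l] phi_black_mem by auto
    then show ?thesis using V(6,8) U.black_white by (auto simp: U.edge_faces_def)
  qed
  have "\<phi> (bl e) \<noteq> \<phi> (br e)" using phi_inj[of "bl e" "br e"] E(6,8) edge_faces_distinct(5)[OF e] by blast
  then consider "\<phi> (bl e) = U.wl (\<psi> e) \<and> \<phi> (br e) = U.wr (\<psi> e)" | "\<phi> (bl e) = U.wr (\<psi> e) \<and> \<phi> (br e) = U.wl (\<psi> e)"
    using b[of "bl e"] b[of "br e"] by auto
  then show ?thesis
  proof cases
    case 1 then show ?thesis using l by (auto simp: aligned_def)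
  next
    case 2
    then have "aligned e (seg_rev (\<psi> e))" using linked_rev(2)[OF l] U.wr_rev[OF u] by (simp add: aligned_def U.wr_def)
    then show ?thesis by blast
  qed
qed

lemma good_or_bad:
  assumes a: "aligned e u" shows "good e u \<or> bad e u"
proof -
  have l: "linked e u" and e: "e \<in> edges T" "u \<in> edges U" using a by (auto simp: aligned_def linked_def)
  note E = edge_facts[OF e(1)] and V = U.edge_facts[OF e(2)]
  have w: "\<phi> f = U.bl u \<or> \<phi> f = U.br u" if "f = wl e \<or> f = wr e" for f
  proof -
    have "f \<in> edge_faces e" "f \<in> white T" using that E by (auto simp: edge_faces_def)
    then have "\<phi> f \<in> U.edge_faces u" "\<phi> f \<in> black U" using phi_edge_faces[OF l] phi_white_mem by auto
    then show ?thesis using V(7,9) U.black_white by (auto simp: U.edge_faces_def)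
  qed
  have "\<phi> (wl e) \<noteq> \<phi> (wr e)" using phi_inj[of "wl e" "wr e"] E(7,9) edge_faces_distinct(6)[OF e(1)] by blast
  then show ?thesis using w[of "wl e"] w[of "wr e"] a by (auto simp: good_def bad_def)
qed

lemma aligned_rev:
  assumes "aligned e u" shows "aligned (seg_rev e) (seg_rev u)"
proof -
  have e: "e \<in> edges T" "u \<in> edges U" using aligned_edges assms by auto
  show ?thesis using assms linked_rev br_rev[OF e(1)] U.wr_rev[OF e(2)] by (auto simp: aligned_def br_def U.wr_def)
qed

lemma good_rev: assumes "good e u" shows "good (seg_rev e) (seg_rev u)"
proof -
  have e: "e \<in> edges T" "u \<in> edges U" using aligned_edges assms by (auto simp: good_def)
  show ?thesis using assms aligned_rev wr_rev[OF e(1)] U.br_rev[OF e(2)] by (auto simp: good_def wr_def U.br_def)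
qed

lemma bad_rev: assumes "bad e u" shows "bad (seg_rev e) (seg_rev u)"
proof -
  have e: "e \<in> edges T" "u \<in> edges U" using aligned_edges assms by (auto simp: bad_def)
  show ?thesis using assms aligned_rev wr_rev[OF e(1)] U.br_rev[OF e(2)] by (auto simp: bad_def wr_def U.br_def)
qed

text \<open>On a good edge the rotations are known from \<open>left_match\<close>: a black and a
  white one agree at the common vertex and send the normal to opposite vectors, which is the
  situation of \<open>half_turn_unique\<close>.\<close>

lemma good_compat_left:
  assumes g: "good e u"
  shows "R (bl e) = R (wl e) ** half_turn (seg_point e (lb e))" "R (bl e) = R (wr e) ** half_turn (start e)"
    "flip_edge R e = u"
proof -
  have a: "aligned e u" and w: "\<phi> (wr e) = U.bl u" "\<phi> (wl e) = U.br u" using g by (auto simp: good_def)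
  have l: "linked e u" and b: "\<phi> (bl e) = U.wl u" using a by (auto simp: aligned_def)
  have e: "e \<in> edges T" "u \<in> edges U" using aligned_edges a by auto
  note E = edge_facts[OF e(1)] and V = U.edge_facts[OF e(2)]
  note ge = edges_geodesic[OF e(1)] and gu = U.edges_geodesic[OF e(2)]
  have rot: "rotation_matrix (R f)" if "f \<in> edge_faces e" for f using phi_R edge_faces_faces[OF e(1)] that by blast
  have B: "R (bl e) *v nrm e = nrm u" "lb e = U.lw u" "R (bl e) *v seg_point e t = seg_point u (U.lb u + t)" for t
    using match_bl[OF l b] by auto
  have "\<phi> (wl e) = U.bl (seg_rev u)" using w by (simp add: U.br_def)
  from match_wl[OF linked_rev(2)[OF l] this]
  have WL: "R (wl e) *v nrm e = - nrm u" "lw e = U.lb u" "R (wl e) *v seg_point e (lb e + t) = seg_point u (len u - t)" for t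
    using nrm_rev[OF gu] U.bl_wl_lb(3)[OF e(2)] by (auto simp: seg_point_rev)
  have "\<phi> (wl (seg_rev e)) = U.bl u" using w by (simp add: wr_def)
  from match_wl[OF linked_rev(1)[OF l] this]
  have WR: "R (wr e) *v - nrm e = nrm u" "R (wr e) *v seg_point e (lw e - t) = seg_point u t" for t
    using nrm_rev[OF ge] bl_wl_lb(3)[OF e(1)] E(5) by (auto simp: seg_point_rev wr_def)
  have len: "len u = len e" using B(2) WL(2) E(5) V(5) by simp
  show "R (bl e) = R (wl e) ** half_turn (seg_point e (lb e))"
  proof (rule half_turn_unique[OF rot rot ge])
    show "R (bl e) *v seg_point e (lb e) = R (wl e) *v seg_point e (lb e)"
      using B(3)[of "lb e"] WL(3)[of 0] B(2) V(5) by (simp add: add.commute)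
    show "R (bl e) *v nrm e = - (R (wl e) *v nrm e)" using B WL by simp
  qed (auto simp: edge_faces_def)
  have "R (bl e) = R (wr e) ** half_turn (seg_point e 0)"
  proof (rule half_turn_unique[OF rot rot ge])
    show "R (bl e) *v seg_point e 0 = R (wr e) *v seg_point e 0"
      using B(3)[of 0] WR(2)[of "lw e"] WL(2) by simp
    show "R (bl e) *v nrm e = - (R (wr e) *v nrm e)" using B WR(1) by (simp add: matrix_vector_mult_minus)
  qed (auto simp: edge_faces_def)
  then show "R (bl e) = R (wr e) ** half_turn (start e)" by simp
  show "flip_edge R e = u"
  proof (rule seg_eqI)
    have r: "rotation_matrix (R (bl e))" using rot by (simp add: edge_faces_def)
    show "geodesic_segment (flip_edge R e)"
      using seg_frame[OF ge] geodesic_segmentD[OF ge] r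
      by (simp add: flip_edge_def geodesic_segment_def rotation_inner norm_1_inner)
    show "nrm (flip_edge R e) = nrm u"
      using seg_frame[OF ge] r B(1) by (simp add: flip_edge_def nrm_def[of "Seg _ _ _"] cross_rotation_matrix)
    show "start (flip_edge R e) = start u" using B(3)[of "- lw e"] WL(2) by (simp add: flip_edge_def)
    show "len (flip_edge R e) = len u" using len by (simp add: flip_edge_def)
  qed (rule gu)
qed

lemma all_good_flipped:
  assumes good: "\<And>e. e \<in> edges T \<Longrightarrow> \<exists>u. good e u"
  shows "flip_sol R" "flipped R = Tiling (white U) (black U) (edges U)"
proof -
  have "compat R e" if e: "e \<in> edges T" for e
  proof -
    obtain u where u: "good e u" using good e by blast
    have l: "len e - lb e = lw e" using edge_facts(5)[OF e] by simp
    show ?thesis unfolding compat_def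
      using good_compat_left(1,2)[OF u] good_compat_left(1,2)[OF good_rev[OF u]]
        br_rev[OF e] wr_rev[OF e] bl_wl_lb(3)[OF e] l by (simp add: br_def wr_def seg_point_rev)
  qed
  then show "flip_sol R" using phi_R by (auto simp: flip_sol_def)
  have "(\<lambda>f. (*v) (R f) ` f) ` black T = \<phi> ` black T" "(\<lambda>f. (*v) (R f) ` f) ` white T = \<phi> ` white T"
    using phi_R black_face white_face by auto
  moreover have "\<phi> ` black T = white U" "\<phi> ` white T = black U" using phi_black phi_white by (auto simp: bij_betw_def)
  moreover have "flip_edge R ` edges T = edges U"
  proof
    show "flip_edge R ` edges T \<subseteq> edges U"
    proof
      fix v assume "v \<in> flip_edge R ` edges T"
      then obtain e where e: "e \<in> edges T" "v = flip_edge R e" by blast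
      obtain u where u: "good e u" using good e by blast
      then show "v \<in> edges U" using good_compat_left(3)[OF u] aligned_edges[of e u] e by (simp add: good_def)
    qed
    show "edges U \<subseteq> flip_edge R ` edges T"
    proof
      fix v assume "v \<in> edges U"
      then obtain e where e: "e \<in> edges T" "v = \<psi> e" using psi_bij by (auto simp: bij_betw_def)
      obtain u where u: "good e u" using good e by blast
      then have "u = v \<or> u = seg_rev v" using e by (auto simp: good_def aligned_def linked_def)
      moreover have "flip_edge R e = u" "flip_edge R (seg_rev e) = seg_rev u"
        using good_compat_left(3) u good_rev by blast+
      moreover have "seg_rev (seg_rev v) = v" using U.edges_geodesic \<open>v \<in> edges U\<close> by simp
      ultimately show "v \<in> flip_edge R ` edges T" using e(1) edges_rev by (metis image_eqI)
    qed
  qed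
  ultimately show "flipped R = Tiling (white U) (black U) (edges U)" by (simp add: flipped_def)
qed

text \<open>A bad edge forces the white faces around the black face on its left to alternate between only
  two faces, so this black face is a digon.\<close>
lemma bad_step:
  assumes b: "bad e u" and c: "corner e e2"
  shows "\<exists>u2. bad e2 u2" "wl e2 = wr e" "lb e2 = pi" "lb e = pi"
proof -
  have a: "aligned e u" and w: "\<phi> (wl e) = U.bl u" "\<phi> (wr e) = U.br u" using b by (auto simp: bad_def)
  have l: "linked e u" and bb: "\<phi> (bl e) = U.wl u" using a by (auto simp: aligned_def)
  have e: "e \<in> edges T" "u \<in> edges U" using aligned_edges a by auto
  have e2: "e2 \<in> edges T" "start e2 = seg_point e (lb e)" "bl e = bl e2" "wl e = wr e2" using c by (auto simp: corner_def)
  obtain u2 where a2: "aligned e2 u2" using aligned_exists[OF e2(1)] by blast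
  have l2: "linked e2 u2" and bb2: "\<phi> (bl e2) = U.wl u2" using a2 by (auto simp: aligned_def)
  have u2: "u2 \<in> edges U" using aligned_edges a2 by auto
  note E = edge_facts[OF e(1)] and E2 = edge_facts[OF e2(1)] and V = U.edge_facts[OF e(2)]
  note ge = edges_geodesic[OF e(1)] and ge2 = edges_geodesic[OF e2(1)] and gu = U.edges_geodesic[OF e(2)]
  \<comment> \<open>The edge leaving at the corner of \<open>u2\<close> has the same start and the
    same white face on its right as \<open>seg_rev u\<close>, so it is that edge; this identifies
    \<open>U.bl u2\<close>.\<close>
  obtain u3 where c3: "U.corner u2 u3" using U.corner_from[OF u2] by blast
  then have u3: "u3 \<in> edges U" "start u3 = seg_point u2 (U.lb u2)" "U.bl u2 = U.bl u3" "U.wl u2 = U.wr u3" by (auto simp: U.corner_def)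
  have "seg_point u2 (U.lb u2) = R (bl e) *v start e2" using match_bl(3)[OF l2 bb2, of 0] e2 by simp
  also have "\<dots> = start (seg_rev u)" using match_bl(2,3)[OF l bb] e2 V(5) by simp
  finally have st: "start u3 = start (seg_rev u)" using u3 by simp
  have "U.wr u3 = U.wr (seg_rev u)" using u3 bb bb2 e2 U.wr_rev[OF e(2)] by simp
  then have "u3 = seg_rev u" using U.same_start[OF u3(1) U.edges_rev[OF e(2)] st] by blast
  then have bu2: "U.bl u2 = \<phi> (wr e)" using u3 w by (simp add: U.br_def)
  have "\<not> good e2 u2"
  proof
    assume "good e2 u2"
    then have "\<phi> (wl e) = U.bl u2" using e2 by (simp add: good_def)
    then show False using bu2 w U.edge_faces_distinct(5)[OF e(2)] by simp
  qed
  then have b2: "bad e2 u2" using good_or_bad[OF a2] by blast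
  then show "\<exists>u2. bad e2 u2" by blast
  have "\<phi> (wl e2) = \<phi> (wr e)" using b2 bu2 by (simp add: bad_def)
  then show W: "wl e2 = wr e" using phi_inj E2(7) E(9) by blast
  \<comment> \<open>The far end of the black side on \<open>e2\<close> is in a face on the left and
    in one on the right of \<open>e\<close>, hence on the circle of \<open>e\<close>. As
    \<open>e2\<close> starts on that circle, the two ends are antipodal.\<close>
  define x2 where "x2 = seg_point e2 (lb e2)"
  have x2: "x2 \<in> bl e" "x2 \<in> wr e"
    using edge_points(1,2)[OF e2(1), of "lb e2"] E2(1,2) e2 W by (auto simp: x2_def)
  have "0 \<le> nrm e \<bullet> x2" "0 \<le> - nrm e \<bullet> x2" using x2 E(18,21) by (auto simp: nrms_def closed_hemisphere_def)
  then have z: "nrm e \<bullet> x2 = 0" by simp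
  have z0: "nrm e \<bullet> start e2 = 0" using seg_frame(4)[OF ge] e2 by simp
  have pos: "0 < nrm e \<bullet> dir e2" by (rule corner_dir_pos[OF c])
  have "nrm e \<bullet> x2 = sin (lb e2) * (nrm e \<bullet> dir e2)"
    using z0 by (simp add: x2_def seg_point_def inner_right_distrib)
  then have "sin (lb e2) = 0" using z pos by simp
  moreover have l2len: "0 < lb e2" "lb e2 < 2 * pi" using E2 edges_len[OF e2(1)] by auto
  ultimately show lb2: "lb e2 = pi"
    using sin_gt_zero[of "lb e2"] sin_lt_zero[of "lb e2"] by (metis linorder_neqE_linordered_idom less_irrefl)
  have "x2 = - start e2" using seg_point_pi(1)[of e2 0] lb2 by (simp add: x2_def)
  then have x2': "x2 = seg_point e (lb e - pi)" using e2 by simp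
  have llen: "0 < lb e" "lb e < 2 * pi" using E edges_len[OF e(1)] by auto
  \<comment> \<open>The black side on \<open>e\<close> ends at \<open>start e2\<close> and contains
    its antipode, so it has length at least pi; it is no longer, since its start is on the left of
    \<open>e2\<close>.\<close>
  have "x2 \<in> seg_arc e 0 (lb e)" using x2 z E(22) by blast
  then obtain s where s: "0 \<le> s" "s \<le> lb e" "x2 = seg_point e s" by (auto simp: seg_arc_def)
  have "s = lb e - pi" by (rule seg_point_inj[OF ge]) (use s x2' llen in auto)
  then have ge_pi: "pi \<le> lb e" using s by simp
  have neg: "nrm e2 \<bullet> seg_tan e (lb e) = - (nrm e \<bullet> dir e2)"
    using cross_triple[of "start e2" "dir e2" "seg_tan e (lb e)"] cross_triple[of "start e2" "seg_tan e (lb e)" "dir e2"]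
      cross_skew[of "dir e2" "seg_tan e (lb e)"] seg_frame(6)[OF ge, of "lb e"] e2(2) by (simp add: nrm_def[of e2])
  have "start e \<in> bl e" using edge_points(1)[OF e(1), of 0] E by simp
  then have "0 \<le> nrm e2 \<bullet> start e" using E2(18) e2 by (auto simp: nrms_def closed_hemisphere_def)
  also have "start e = cos (- lb e) *\<^sub>R seg_point e (lb e) + sin (- lb e) *\<^sub>R seg_tan e (lb e)"
    using seg_point_add[of e "lb e" "- lb e"] by simp
  also have "nrm e2 \<bullet> \<dots> = sin (lb e) * (nrm e \<bullet> dir e2)"
    using neg geodesic_segmentD(6)[OF ge2] e2(2) by (simp add: inner_right_distrib inner_diff_right)
  finally have "0 \<le> sin (lb e)" using pos by (simp add: zero_le_mult_iff)
  then have "lb e \<le> pi" using sin_lt_zero[of "lb e"] llen by linarith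
  then show "lb e = pi" using ge_pi by simp
qed

text \<open>Needed for the white lengths on a bad edge, where \<open>bad_step\<close> is applied to
  the inverse, and for the symmetry of \<open>flips_to\<close>.\<close>

lemma inverse_pair: "\<exists>\<phi>' R' \<psi>'. flip_pair U T \<phi>' R' \<psi>' \<and> (\<forall>f\<in>faces T. \<phi>' (\<phi> f) = f) \<and> (\<forall>e\<in>edges T. \<psi>' (\<psi> e) = e)"
proof -
  define \<phi>' where "\<phi>' g = (if g \<in> white U then inv_into (black T) \<phi> g else inv_into (white T) \<phi> g)" for g
  define R' where "R' g = rinv (R (\<phi>' g))" for g
  define \<psi>' where "\<psi>' = inv_into (edges T) \<psi>"
  have inv: "\<phi>' (\<phi> f) = f" if "f \<in> faces T" for f
  proof (cases "f \<in> black T")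
    case True
    then have "\<phi> f \<in> white U" using phi_black_mem by blast
    then show ?thesis using True phi_black by (simp add: \<phi>'_def bij_betw_inv_into_left)
  next
    case False
    then have f: "f \<in> white T" using that by (simp add: faces_def)
    then have "\<phi> f \<notin> white U" using phi_white_mem U.black_white by blast
    then show ?thesis using f phi_white by (simp add: \<phi>'_def bij_betw_inv_into_left)
  qed
  have surj: "\<exists>f\<in>faces T. g = \<phi> f" if "g \<in> faces U" for g
  proof -
    have "g \<in> \<phi> ` white T \<or> g \<in> \<phi> ` black T"
      using that phi_black phi_white by (auto simp: faces_def bij_betw_def)
    then show ?thesis by (auto simp: faces_def)
  qed
  have inve: "\<psi>' (\<psi> e) = e" if "e \<in> edges T" for e using that psi_bij by (simp add: \<psi>'_def bij_betw_inv_into_left)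
  have surje: "\<exists>e\<in>edges T. u = \<psi> e" if "u \<in> edges U" for u using that psi_bij by (auto simp: bij_betw_def)
  have "flip_pair U T \<phi>' R' \<psi>'"
  proof
    have "bij_betw (inv_into (white T) \<phi>) (black U) (white T)" using phi_white by (rule bij_betw_inv_into)
    then show "bij_betw \<phi>' (black U) (white T)"
      using U.black_white by (subst bij_betw_cong[of _ _ "inv_into (white T) \<phi>"]) (auto simp: \<phi>'_def)
    have "bij_betw (inv_into (black T) \<phi>) (white U) (black T)" using phi_black by (rule bij_betw_inv_into)
    then show "bij_betw \<phi>' (white U) (black T)"
      by (subst bij_betw_cong[of _ _ "inv_into (black T) \<phi>"]) (auto simp: \<phi>'_def)
    show "bij_betw \<psi>' (edges U) (edges T)" unfolding \<psi>'_def using psi_bij by (rule bij_betw_inv_into)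
  next
    fix g assume "g \<in> faces U"
    then obtain f where f: "f \<in> faces T" "g = \<phi> f" using surj by blast
    then have "R' g = rinv (R f)" "\<phi>' g = f" "rotation_matrix (R f)" "g = (*v) (R f) ` f" using inv phi_R by (auto simp: R'_def)
    then show "rotation_matrix (R' g) \<and> \<phi>' g = (*v) (R' g) ` g"
      using rotation_transpose(1,4) by (simp add: image_image)
  next
    fix u assume "u \<in> edges U"
    then obtain e where e: "e \<in> edges T" "u = \<psi> e" using surje by blast
    then show "\<psi>' (seg_rev u) = seg_rev (\<psi>' u)" using psi_rev[OF e(1)] inve edges_rev by (metis)
  next
    fix g a u assume g: "g \<in> faces U" and a: "a \<in> polygon_edges g" and u: "u \<in> edges U"
    obtain f where f: "f \<in> faces T" "g = \<phi> f" using surj g by blast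
    obtain e where e: "e \<in> edges T" "u = \<psi> e" using surje u by blast
    have r: "rotation_matrix (R f)" "g = (*v) (R f) ` f" using phi_R f by auto
    obtain b where b: "b \<in> polygon_edges f" "a = (*v) (R f) ` b" using a unfolding r(2) rotation_polygon_edges[OF r(1)] by blast
    have "(*v) (R' g) ` a = b" using f inv b r rotation_transpose(4) by (simp add: R'_def image_image)
    then show "a \<subseteq> seg_set u \<longleftrightarrow> (*v) (R' g) ` a \<subseteq> seg_set (\<psi>' u)"
      using incidence[OF f(1) b(1) e(1)] b(2) e inve by simp
  qed
  then show ?thesis using inv inve by blast
qed

text \<open>A bad edge is also bad for the inverse pair, whose black lengths are the white lengths
  here; so \<open>bad_step\<close> gives both.\<close>

lemma bad_len:
  assumes b: "bad e u" shows "lb e = pi" "lw e = pi" "len e = 2 * pi"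
proof -
  have a: "aligned e u" and w: "\<phi> (wl e) = U.bl u" "\<phi> (wr e) = U.br u" using b by (auto simp: bad_def)
  have e: "e \<in> edges T" "u \<in> edges U" using aligned_edges a by auto
  have l: "linked e u" and bb: "\<phi> (bl e) = U.wl u" "\<phi> (br e) = U.wr u" using a by (auto simp: aligned_def)
  note E = edge_facts[OF e(1)]
  obtain e2 where "corner e e2" using corner_from[OF e(1)] by blast
  then show 1: "lb e = pi" using bad_step(4)[OF b] by blast
  obtain \<phi>' R' \<psi>' where I: "flip_pair U T \<phi>' R' \<psi>'" and inv: "\<forall>f\<in>faces T. \<phi>' (\<phi> f) = f" "\<forall>e\<in>edges T. \<psi>' (\<psi> e) = e"
    using inverse_pair by blast
  interpret I: flip_pair U T \<phi>' R' \<psi>' by (rule I)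
  have "u = \<psi> e \<or> u = seg_rev (\<psi> e)" using l by (simp add: linked_def)
  then have "I.linked u e" using e inv(2) I.psi_rev psi_edges edges_geodesic by (auto simp: I.linked_def)
  moreover have "\<phi>' (U.bl u) = wl e" "\<phi>' (U.br u) = wr e" "\<phi>' (U.wl u) = bl e" "\<phi>' (U.wr u) = br e"
    using inv(1) w bb E(10-13) by metis+
  ultimately have "I.bad u e" by (simp add: I.bad_def I.aligned_def)
  moreover obtain u2 where "U.corner u u2" using U.corner_from[OF e(2)] by blast
  ultimately have "U.lb u = pi" using I.bad_step(4) by blast
  then show 2: "lw e = pi" using match_wl(2)[OF l w(1)] by simp
  show "len e = 2 * pi" using 1 2 E(5) by simp
qed

end

lemma face_eqI:
  assumes "face f" "face h" "nrms f = nrms h" shows "f = h"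
proof -
  have "f = S2 \<inter> fcone f" by (rule face_cone[OF assms(1)])
  also have "\<dots> = S2 \<inter> fcone h" using assms(3) by (simp add: fcone_def)
  also have "\<dots> = h" by (rule face_cone[OF assms(2), symmetric])
  finally show ?thesis .
qed

context flip_pair
begin

text \<open>If an edge is bad, the tiling consists of four lunes cut out by two great circles, and exchanging
  the images of the two white lunes makes all edges good.\<close>
lemma bad_solution:
  assumes b: "bad e u"
  shows "\<exists>R'. flip_sol R' \<and> flipped R' = Tiling (white U) (black U) (edges U)"
proof -
  have e: "e \<in> edges T" using aligned_edges b by (auto simp: bad_def)
  obtain e2 where c: "corner e e2" using corner_from[OF e] by blast
  then have e2: "e2 \<in> edges T" "start e2 = seg_point e (lb e)" "bl e2 = bl e" "wr e2 = wl e" by (auto simp: corner_def)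
  obtain u2 where b2: "bad e2 u2" and W: "wl e2 = wr e" using bad_step(1,2)[OF b c] by blast
  note L = bad_len[OF b]
  note E = edge_facts[OF e] and E2 = edge_facts[OF e2(1)]
  note g = edges_geodesic[OF e] and g2 = edges_geodesic[OF e2(1)]
  \<comment> \<open>Both lengths on \<open>e\<close> are pi, so all four faces around
    \<open>e\<close> contain \<open>x\<close> and its antipode and are lunes with these
    vertices.\<close>
  define x where "x = start e2"
  have x: "x = seg_point e pi" "- x = start e" using e2 L(1) seg_point_pi(1)[of e 0] by (auto simp: x_def)
  have xS: "x \<in> S2" using x(1) seg_frame(8)[OF g] by simp
  have end_e: "seg_point e (2 * pi) = - x" using x seg_point_periodic(1)[of e 0] by simp
  have mem: "x \<in> bl e" "- x \<in> bl e" "x \<in> wl e" "- x \<in> wl e" "x \<in> wr e" "- x \<in> wr e" "x \<in> br e" "- x \<in> br e"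
    using edge_points(1)[OF e, of pi] edge_points(1)[OF e, of 0] edge_points(2)[OF e, of pi] edge_points(2)[OF e, of "2 * pi"]
      edge_points(3)[OF e, of pi] edge_points(3)[OF e, of 0] edge_points(4)[OF e, of pi] edge_points(4)[OF e, of "2 * pi"]
      L x end_e pi_gt_zero by auto
  let ?n = "nrm e" and ?m = "nrm e2"
  have nm: "?m \<noteq> ?n" "?m \<noteq> - ?n" "?n \<noteq> - ?m" using corner_neq[OF c] by auto
  have nx: "?n \<bullet> x = 0" "?m \<bullet> x = 0" using seg_frame(4)[OF g] x(1) geodesic_segmentD(6)[OF g2] by (auto simp: x_def)
  have N1: "nrms (bl e) = {?n, ?m}" using lune_nrms[OF E(14) E(18) _ _ mem(1,2), of ?m] E2(18) e2 nm by auto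
  have N2: "nrms (wl e) = {?n, - ?m}" using lune_nrms[OF E(15) E(19) _ _ mem(3,4), of "- ?m"] E2(21) e2 nm by auto
  have N3: "nrms (wr e) = {- ?n, ?m}" using lune_nrms[OF E(17) E(21) _ _ mem(5,6), of ?m] E2(19) W nm by auto
  obtain e3 where c3: "corner (seg_rev e) e3" using corner_from[OF edges_rev[OF e]] by blast
  then have e3: "e3 \<in> edges T" "bl e3 = br e" "wr e3 = wr e" by (auto simp: corner_def br_def wr_def)
  have "- nrm e3 \<in> {- ?n, ?m}" using edge_facts(21)[OF e3(1)] N3 e3 by simp
  moreover have "nrm e3 \<noteq> ?n" using corner_neq(2)[OF c3] g by simp
  ultimately have "- nrm e3 = ?m" by auto
  then have n3: "nrm e3 = - ?m" by (metis minus_minus)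
  have N4: "nrms (br e) = {- ?n, - ?m}"
    using lune_nrms[OF E(16) E(20) _ _ mem(7,8), of "- ?m"] edge_facts(18)[OF e3(1)] n3 e3 nm by auto
  \<comment> \<open>A point inside \<open>f\<close> off the two circles is inside one of the four
    lunes, so \<open>f\<close> is that lune.\<close>
  have F: "f = bl e \<or> f = wl e \<or> f = wr e \<or> f = br e" if f: "f \<in> faces T" for f
  proof -
    have "0 \<notin> {?n, ?m}" using nrms_S2(3)[of ?n "bl e"] nrms_S2(3)[of ?m "bl e"] N1 by auto
    then obtain z where z: "z \<in> fint f" "\<forall>k\<in>{?n, ?m}. k \<bullet> z \<noteq> 0"
      using nonempty_avoid[OF open_fint[OF faces_face[OF f]], of "{?n, ?m}"] fint_nonempty[OF faces_face[OF f]] by blast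
    then have "?n \<bullet> z \<noteq> 0" "?m \<bullet> z \<noteq> 0" by auto
    then have "z \<in> fint (bl e) \<or> z \<in> fint (wl e) \<or> z \<in> fint (wr e) \<or> z \<in> fint (br e)"
      by (auto simp: fint_def N1 N2 N3 N4 neq_iff)
    then show ?thesis using fint_disjoint[OF f _ z(1)] E(10-13) by blast
  qed
  have black: "f = bl e \<or> f = br e" if "f \<in> black T" for f
    using F[OF black_face[OF that]] that E(7,9) black_white by blast
  have br2: "br e2 = br e" using black[OF E2(8)] edge_faces_distinct(5)[OF e2(1)] e2 by auto
  have edges: "e' = e \<or> e' = seg_rev e \<or> e' = e2 \<or> e' = seg_rev e2" if e': "e' \<in> edges T" for e'
    using black[OF edge_facts(6)[OF e']]
  proof
    assume bl: "bl e' = bl e"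
    then have "nrm e' = ?n \<or> nrm e' = ?m" using edge_facts(18)[OF e'] N1 by auto
    then show ?thesis using same_normal[OF e' e] same_normal[OF e' e2(1)] bl e2 by auto
  next
    assume br: "bl e' = br e"
    then have "nrm e' = nrm (seg_rev e) \<or> nrm e' = nrm (seg_rev e2)" using edge_facts(18)[OF e'] N4 g g2 by auto
    then show ?thesis
      using same_normal[OF e' edges_rev[OF e]] same_normal[OF e' edges_rev[OF e2(1)]] br br2 by (auto simp: br_def)
  qed
  \<comment> \<open>The half turn about the common vertex reverses both normals, and therefore
    exchanges the two white lunes.\<close>
  define \<rho> where "\<rho> = half_turn x"
  have rot: "rotation_matrix \<rho>" unfolding \<rho>_def using rotation_half_turn xS by blast
  have neg: "\<rho> *v ?n = - ?n" "\<rho> *v ?m = - ?m" using nx by (auto simp: \<rho>_def half_turn_apply inner_commute)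
  have im1: "(*v) \<rho> ` wl e = wr e"
    by (rule face_eqI[OF rotation_face[OF rot E(15)] E(17)])
      (simp add: rotation_nrms[OF rot] N2 N3 neg matrix_vector_mult_minus)
  have im2: "(*v) \<rho> ` wr e = wl e"
    by (rule face_eqI[OF rotation_face[OF rot E(17)] E(15)])
      (simp add: rotation_nrms[OF rot] N2 N3 neg matrix_vector_mult_minus)
  have wne: "wl e \<noteq> wr e" using edge_faces_distinct(6)[OF e] .
  have notblack: "wl e \<notin> black T" "wr e \<notin> black T" using E(7,9) black_white by blast+
  define s where "s f = (if f = wl e then wr e else if f = wr e then wl e else f)" for f
  define \<phi>' where "\<phi>' f = \<phi> (s f)" for f
  define R' where "R' f = (if f = wl e \<or> f = wr e then R (s f) ** \<rho> else R f)" for f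
  have s_im: "(*v) \<rho> ` f = s f" if "f = wl e \<or> f = wr e" for f using that im1 im2 wne by (auto simp: s_def)
  have s_bl: "s f = f" if "f \<in> black T" for f using that notblack by (auto simp: s_def)
  have s_faces: "s f \<in> faces T" if "f \<in> faces T" for f using that E(11,13) by (auto simp: s_def)
  interpret N: flip_pair T U \<phi>' R' \<psi>
  proof
    show "bij_betw \<phi>' (black T) (white U)"
      using phi_black s_bl by (subst bij_betw_cong[of _ _ \<phi>]) (auto simp: \<phi>'_def)
    have "bij_betw s (white T) (white T)"
      by (rule bij_betw_byWitness[of _ s]) (use E(7,9) wne in \<open>auto simp: s_def\<close>)
    then show "bij_betw \<phi>' (white T) (black U)"
      using bij_betw_trans[OF _ phi_white, of s] by (simp add: \<phi>'_def[abs_def] comp_def)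
    show "bij_betw \<psi> (edges T) (edges U)" by (fact psi_bij)
  next
    fix f assume f: "f \<in> faces T"
    show "rotation_matrix (R' f) \<and> \<phi>' f = (*v) (R' f) ` f"
    proof (cases "f = wl e \<or> f = wr e")
      case True
      have "(*v) (R (s f) ** \<rho>) ` f = (*v) (R (s f)) ` (*v) \<rho> ` f"
        by (simp add: image_image matrix_vector_mul_assoc)
      then show ?thesis using True phi_R[OF s_faces[OF f]] s_im rotation_mult rot by (simp add: R'_def \<phi>'_def)
    next
      case False
      then show ?thesis using phi_R[OF f] by (simp add: R'_def \<phi>'_def s_def)
    qed
  next
    show "\<psi> (seg_rev e) = seg_rev (\<psi> e)" if "e \<in> edges T" for e using psi_rev that by blast
  next
    fix f a e' assume f: "f \<in> faces T" and a: "a \<in> polygon_edges f" and e': "e' \<in> edges T"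
    show "a \<subseteq> seg_set e' \<longleftrightarrow> (*v) (R' f) ` a \<subseteq> seg_set (\<psi> e')"
    proof (cases "f = wl e \<or> f = wr e")
      case True
      obtain k where k: "k \<in> nrms f" "a = f \<inter> {z. k \<bullet> z = 0}" using a by (auto simp: polygon_edges_nrms)
      have "k = ?n \<or> k = - ?n \<or> k = ?m \<or> k = - ?m" using k True N2 N3 by auto
      then have "\<exists>e1\<in>{e, e2}. {z. k \<bullet> z = 0} = {z. nrm e1 \<bullet> z = 0}" by auto
      then obtain e1 where e1: "e1 \<in> {e, e2}" "a = f \<inter> {z. nrm e1 \<bullet> z = 0}" using k by auto
      have e1T: "e1 \<in> edges T" and edge_faces: "f \<in> edge_faces e1" "s f \<in> edge_faces e1"
        using e1 e e2 True W by (auto simp: edge_faces_def s_def)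
      have "{z. (\<rho> *v nrm e1) \<bullet> z = 0} = {z. nrm e1 \<bullet> z = 0}" using e1(1) neg by auto
      then have "(*v) \<rho> ` a = s f \<inter> {z. nrm e1 \<bullet> z = 0}"
        unfolding e1(2) rotation_inter[OF rot] rotation_plane[OF rot] using s_im[OF True] by simp
      then have im: "(*v) (R' f) ` a = (*v) (R (s f)) ` (s f \<inter> {z. nrm e1 \<bullet> z = 0})"
        using True by (simp add: R'_def image_image matrix_vector_mul_assoc[symmetric]) (metis image_image)
      have "a \<subseteq> seg_set e' \<longleftrightarrow> e' = e1 \<or> e' = seg_rev e1" using edge_faces_edge_iff[OF e1T e' edge_faces(1)] e1 by simp
      also have "\<dots> \<longleftrightarrow> s f \<inter> {z. nrm e1 \<bullet> z = 0} \<subseteq> seg_set e'" using edge_faces_edge_iff[OF e1T e' edge_faces(2)] by simp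
      also have "\<dots> \<longleftrightarrow> (*v) (R' f) ` a \<subseteq> seg_set (\<psi> e')"
        unfolding im by (rule incidence[OF s_faces[OF f] edge_faces_edge(1)[OF e1T edge_faces(2)] e'])
      finally show ?thesis .
    next
      case False
      then show ?thesis using incidence[OF f a e'] by (simp add: R'_def)
    qed
  qed
  have "\<exists>u. N.good e' u" if e': "e' \<in> edges T" for e'
  proof -
    have "\<exists>u'. bad e' u' \<and> (wl e' = wl e \<and> wr e' = wr e \<or> wl e' = wr e \<and> wr e' = wl e)"
      using edges[OF e'] b b2 bad_rev[OF b] bad_rev[OF b2] wr_rev[OF e] wr_rev[OF e2(1)] W e2 by (auto simp: wr_def)
    then obtain u' where u': "bad e' u'" and W': "wl e' = wl e \<and> wr e' = wr e \<or> wl e' = wr e \<and> wr e' = wl e" by blast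
    have s': "s (wl e') = wr e'" "s (wr e') = wl e'" using W' wne by (elim disjE; simp add: s_def)+
    have "N.linked e' u'" using u' by (simp add: N.linked_def bad_def aligned_def linked_def)
    moreover have "s (bl e') = bl e'" "s (br e') = br e'" using s_bl edge_facts(6,8)[OF e'] by auto
    ultimately have "N.good e' u'"
      using u' s' by (simp add: N.good_def N.aligned_def \<phi>'_def bad_def aligned_def)
    then show ?thesis by blast
  qed
  then show ?thesis using N.all_good_flipped by blast
qed

text \<open>With a bad edge the solution uses other rotations than the given flip, but it produces
  the same tiling.\<close>

theorem pair_solution: "\<exists>R'. flip_sol R' \<and> flipped R' = Tiling (white U) (black U) (edges U)"
proof (cases "\<exists>e u. bad e u")
  case True then show ?thesis using bad_solution by blast
next
  case False
  then have "\<exists>u. good e u" if "e \<in> edges T" for e using aligned_exists[OF that] good_or_bad by blast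
  then show ?thesis using all_good_flipped by blast
qed

end

subsection \<open>Exchanging the colours\<close>

definition recolour :: "tiling \<Rightarrow> tiling" where
  "recolour T = Tiling (white T) (black T) (edges T)"

lemma recolour_simps [simp]:
  "black (recolour T) = white T" "white (recolour T) = black T" "edges (recolour T) = edges T"
  "faces (recolour T) = faces T" "recolour (recolour T) = T"
  by (auto simp: recolour_def faces_def)

lemma recolour_tiling: "tiling_of_S2 (recolour T) = tiling_of_S2 T"
  by (simp add: tiling_of_S2_def Int_commute)

text \<open>Exchanging the colours exchanges \<open>l\<close> with \<open>w\<close> and one side of
  the edge with the other.\<close>

lemma recolour_pattern: "edge_pattern A B T e \<Longrightarrow> edge_pattern B A (recolour T) e"
proof -
  assume "edge_pattern A B T e"
  then obtain l w where lw: "0 < l" "0 < w" "len e = l + w"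
        "\<exists>f\<in>white T. A e f \<and> seg_arc e 0 w \<in> polygon_edges f"
        "\<exists>f\<in>black T. A e f \<and> seg_arc e w (len e) \<in> polygon_edges f"
        "\<exists>f\<in>black T. B e f \<and> seg_arc e 0 l \<in> polygon_edges f"
        "\<exists>f\<in>white T. B e f \<and> seg_arc e l (len e) \<in> polygon_edges f"
    unfolding edge_pattern_def by (elim exE conjE) (rule that)
  have "len e = w + l" using lw(3) by simp
  show ?thesis unfolding edge_pattern_def recolour_simps
    by (rule exI[of _ w], rule exI[of _ l], intro conjI lw \<open>len e = w + l\<close>)
qed

lemma recolour_right: "right_flippable (recolour T) \<longleftrightarrow> left_flippable T"
  and recolour_left: "left_flippable (recolour T) \<longleftrightarrow> right_flippable T"
  using recolour_pattern[of _ _ T] recolour_pattern[of _ _ "recolour T"]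
  by (auto simp: right_flippable_def left_flippable_def recolour_tiling)

lemma recolour_flips: "flips_to (recolour T) (recolour T') \<longleftrightarrow> flips_to T T'"
proof -
  have "flips_to (recolour T) (recolour T')" if "flips_to T T'" for T T'
    using that unfolding flips_to_def recolour_simps by (elim exE conjE) (intro exI conjI; assumption)
  from this[of T T'] this[of "recolour T" "recolour T'"] show ?thesis by auto
qed

lemma recolour_congruent: "congruent_tilings (recolour T) (recolour T') \<longleftrightarrow> congruent_tilings T T'"
proof -
  have "congruent_tilings (recolour T) (recolour T')" if "congruent_tilings T T'" for T T'
    using that by (auto simp: congruent_tilings_def rotate_tiling_def recolour_def)
  from this[of T T'] this[of "recolour T" "recolour T'"] show ?thesis by auto
qed

subsection \<open>The theorem\<close>

lemma flip_pair_of_flips_to: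
  assumes "right_flippable T" "left_flippable T'" "flips_to T T'"
  obtains \<phi> R \<psi> where "flip_pair T (recolour T') \<phi> R \<psi>"
proof -
  obtain \<phi> R \<psi> where d: "bij_betw \<phi> (black T) (black T')" "bij_betw \<phi> (white T) (white T')"
        "\<forall>f\<in>faces T. rotation_matrix (R f) \<and> \<phi> f = (*v) (R f) ` f"
        "bij_betw \<psi> (edges T) (edges T')" "\<forall>e\<in>edges T. \<psi> (seg_rev e) = seg_rev (\<psi> e)"
        "\<forall>f\<in>faces T. \<forall>a\<in>polygon_edges f. \<forall>e\<in>edges T. a \<subseteq> seg_set e \<longleftrightarrow> (*v) (R f) ` a \<subseteq> seg_set (\<psi> e)"
    using assms(3) unfolding flips_to_def by (elim exE conjE) (rule that)
  have "flip_pair T (recolour T') \<phi> R \<psi>"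
    by unfold_locales (use d assms recolour_right in auto)
  then show thesis by (rule that)
qed

lemma flips_to_of_flip_pair:
  assumes "flip_pair T U \<phi> R \<psi>" shows "flips_to T (recolour U)"
proof -
  interpret flip_pair T U \<phi> R \<psi> by (rule assms)
  show ?thesis unfolding flips_to_def recolour_simps
    using phi_black phi_white phi_R psi_bij psi_rev incidence
    by (intro exI[of _ \<phi>] exI[of _ R] exI[of _ \<psi>] conjI ballI) auto
qed

lemma flips_to_sym:
  assumes "right_flippable T" "left_flippable T'" "flips_to T T'" shows "flips_to T' T"
proof -
  obtain \<phi> R \<psi> where "flip_pair T (recolour T') \<phi> R \<psi>" using flip_pair_of_flips_to[OF assms] .
  then obtain \<phi>' R' \<psi>' where "flip_pair (recolour T') T \<phi>' R' \<psi>'" using flip_pair.inverse_pair by blast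
  then have "flips_to (recolour T') (recolour T)" by (rule flips_to_of_flip_pair)
  then show ?thesis using recolour_flips by blast
qed

lemma right_flip_exists:
  assumes "right_flippable T" shows "\<exists>T'. left_flippable T' \<and> flips_to T T'"
proof -
  interpret rtiling T by unfold_locales (rule assms)
  obtain R where R: "flip_sol R" using flip_sol_exists by blast
  interpret flip T R by unfold_locales (rule R)
  show ?thesis using flipped_left_flippable flips_to_flipped by blast
qed

text \<open>By \<open>pair_solution\<close> both flips come from solutions of the same system, which
  differ by one rotation of the sphere.\<close>

lemma right_flip_unique:
  assumes T: "right_flippable T" and T1: "left_flippable T1" "flips_to T T1" and T2: "left_flippable T2" "flips_to T T2"
  shows "congruent_tilings T1 T2"
proof -
  interpret rtiling T by unfold_locales (rule T)
  have sol: "\<exists>R. flip_sol R \<and> T' = flipped R" if T': "left_flippable T'" "flips_to T T'" for T'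
  proof -
    obtain \<phi> R \<psi> where "flip_pair T (recolour T') \<phi> R \<psi>" using flip_pair_of_flips_to[OF T T'] .
    then interpret P: flip_pair T "recolour T'" \<phi> R \<psi> .
    show ?thesis using P.pair_solution by (metis recolour_simps(1-3) tiling.collapse)
  qed
  obtain R1 R2 where R: "flip_sol R1" "T1 = flipped R1" "flip_sol R2" "T2 = flipped R2" using sol T1 T2 by metis
  obtain A where A: "rotation_matrix A" "\<forall>f\<in>faces T. R2 f = A ** R1 f" using flip_sol_unique[OF R(1,3)] by blast
  have f: "(*v) (R2 f) ` f = (*v) A ` ((*v) (R1 f) ` f)" if "f \<in> faces T" for f
    using A that by (simp add: image_image matrix_vector_mul_assoc)
  have e: "flip_edge R2 e = rotate_seg A (flip_edge R1 e)" if "e \<in> edges T" for e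
    using A(2) edge_facts(10)[OF that] by (simp add: flip_edge_def rotate_seg_def matrix_vector_mul_assoc)
  have "T2 = rotate_tiling A T1"
    unfolding R rotate_tiling_def flipped_def using f e black_face white_face by (auto simp: image_image)
  then show ?thesis using A by (auto simp: congruent_tilings_def)
qed

theorem theoremS1:
  shows "(\<forall>T. right_flippable T \<longrightarrow>
            (\<exists>T'. left_flippable T' \<and> flips_to T T' \<and>
               (\<forall>T''. left_flippable T'' \<and> flips_to T T'' \<longrightarrow> congruent_tilings T' T'')))
       \<and> (\<forall>T. left_flippable T \<longrightarrow>
            (\<exists>T'. right_flippable T' \<and> flips_to T T' \<and>
               (\<forall>T''. right_flippable T'' \<and> flips_to T T'' \<longrightarrow> congruent_tilings T' T'')))
       \<and> (\<forall>T T' T''. right_flippable T \<and> left_flippable T' \<and> right_flippable T'' \<and>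
            flips_to T T' \<and> flips_to T' T'' \<longrightarrow> congruent_tilings T T'')
       \<and> (\<forall>T T' T''. left_flippable T \<and> right_flippable T' \<and> left_flippable T'' \<and>
            flips_to T T' \<and> flips_to T' T'' \<longrightarrow> congruent_tilings T T'')"
proof -
  have left_unique: "congruent_tilings T1 T2"
    if "left_flippable T" "right_flippable T1" "flips_to T T1" "right_flippable T2" "flips_to T T2" for T T1 T2
    using right_flip_unique[of "recolour T" "recolour T1" "recolour T2"] that
    by (simp add: recolour_right recolour_left recolour_flips recolour_congruent)
  have left_exists: "\<exists>T'. right_flippable T' \<and> flips_to T T'" if "left_flippable T" for T
  proof -
    obtain T' where "left_flippable T'" "flips_to (recolour T) T'"
      using right_flip_exists[of "recolour T"] \<open>left_flippable T\<close> recolour_right by blast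
    then show ?thesis using recolour_flips[of T "recolour T'"] recolour_right[of T'] by (intro exI[of _ "recolour T'"]) simp
  qed
  have left_sym: "flips_to T' T" if "left_flippable T" "right_flippable T'" "flips_to T T'" for T T'
    using flips_to_sym[of "recolour T" "recolour T'"] that by (simp add: recolour_right recolour_left recolour_flips)
  \<comment> \<open>For flipping twice: by symmetry \<open>T\<close> and \<open>T''\<close> are both
    flips of \<open>T'\<close>, hence congruent.\<close>
  show ?thesis
    using right_flip_exists right_flip_unique left_exists left_unique flips_to_sym left_sym by meson
qed

end
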